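(* The only non-trivial subtopos of $\mathcal K$ (i.e. other than $\mathcal K$ itself and the degenerate topos) is the subtopos $\mathcal K_{\neg\neg}$ of $\neg\neg$-sheaves, and $\mathcal K_{\neg\neg}$ is equivalent to $\mathbf{Set}$; this subtopos is the geometric embedding $\mathbf{Set}\to\mathcal K$ with inverse image $\Gamma:\mathcal K\to\mathbf{Set}$ (global sections) and direct image $\nabla:\mathbf{Set}\to\mathcal K$, the right adjoint of $\Gamma$.
   Context: $\mathcal K=\mathbf{Sh}(\mathbf{Kp},J)$, where $\mathbf{Kp}$ is the category of finite posets and open maps (monotone $f:P\to Q$ such that $f(p)\le q$ implies there is $p'\ge p$ with $f(p')=q$) and $J$ is the Grothendieck topology whose covering sieves are the jointly surjective ones. $\Gamma=\mathcal K(1,-)$ is the global sections functor; it has a fully faithful right adjoint $\nabla$, given by $\nabla S(P)\cong S^{\max P}$ where $\max P$ is the set of maximal elements of $P$. *)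

theory Defs
  imports Main "HOL-Library.FuncSet" "HOL-Library.Equipollence"
begin

section \<open>Categories and functors\<close>

record ('o, 'm) cat =
  Obj :: "'o set"
  Arr :: "'m set"
  Dom :: "'m \<Rightarrow> 'o"
  Cod :: "'m \<Rightarrow> 'o"
  Ide :: "'o \<Rightarrow> 'm"
  Cmp :: "'m \<Rightarrow> 'm \<Rightarrow> 'm"   (* Cmp C g f is g after f *)

definition hom :: "('o, 'm) cat \<Rightarrow> 'o \<Rightarrow> 'o \<Rightarrow> 'm set" where
  "hom C a b = {f \<in> Arr C. Dom C f = a \<and> Cod C f = b}"

definition category :: "('o, 'm) cat \<Rightarrow> bool" where
  "category C \<longleftrightarrow>
     (\<forall>f\<in>Arr C. Dom C f \<in> Obj C \<and> Cod C f \<in> Obj C) \<and>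
     (\<forall>a\<in>Obj C. Ide C a \<in> hom C a a) \<and>
     (\<forall>a b c. \<forall>f\<in>hom C a b. \<forall>g\<in>hom C b c. Cmp C g f \<in> hom C a c) \<and>
     (\<forall>a b. \<forall>f\<in>hom C a b. Cmp C f (Ide C a) = f \<and> Cmp C (Ide C b) f = f) \<and>
     (\<forall>a b c d. \<forall>f\<in>hom C a b. \<forall>g\<in>hom C b c. \<forall>h\<in>hom C c d.
        Cmp C h (Cmp C g f) = Cmp C (Cmp C h g) f)"

definition op_cat :: "('o, 'm) cat \<Rightarrow> ('o, 'm) cat" where
  "op_cat C = \<lparr>Obj = Obj C, Arr = Arr C, Dom = Cod C, Cod = Dom C, Ide = Ide C,
               Cmp = (\<lambda>g f. Cmp C f g)\<rparr>"

definition full_sub :: "('o, 'm) cat \<Rightarrow> 'o set \<Rightarrow> ('o, 'm) cat" where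
  "full_sub C D = C\<lparr>Obj := Obj C \<inter> D, Arr := {f \<in> Arr C. Dom C f \<in> D \<and> Cod C f \<in> D}\<rparr>"

definition is_iso :: "('o, 'm) cat \<Rightarrow> 'm \<Rightarrow> bool" where
  "is_iso C f \<longleftrightarrow> f \<in> Arr C \<and>
     (\<exists>g\<in>hom C (Cod C f) (Dom C f). Cmp C g f = Ide C (Dom C f) \<and> Cmp C f g = Ide C (Cod C f))"

definition isomorphic :: "('o, 'm) cat \<Rightarrow> 'o \<Rightarrow> 'o \<Rightarrow> bool" where
  "isomorphic C a b \<longleftrightarrow> (\<exists>f\<in>hom C a b. is_iso C f)"

definition terminal :: "('o, 'm) cat \<Rightarrow> 'o \<Rightarrow> bool" where
  "terminal C t \<longleftrightarrow> t \<in> Obj C \<and> (\<forall>a\<in>Obj C. \<exists>!f. f \<in> hom C a t)"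

definition terminal_obj :: "('o, 'm) cat \<Rightarrow> 'o" where
  "terminal_obj C = (SOME t. terminal C t)"

record ('o, 'm, 'p, 'n) func =
  fob :: "'o \<Rightarrow> 'p"
  far :: "'m \<Rightarrow> 'n"

definition is_functor :: "('o, 'm) cat \<Rightarrow> ('p, 'n) cat \<Rightarrow> ('o, 'm, 'p, 'n) func \<Rightarrow> bool" where
  "is_functor C D F \<longleftrightarrow> category C \<and> category D \<and>
     (\<forall>a\<in>Obj C. fob F a \<in> Obj D) \<and>
     (\<forall>f\<in>Arr C. far F f \<in> hom D (fob F (Dom C f)) (fob F (Cod C f))) \<and>
     (\<forall>a\<in>Obj C. far F (Ide C a) = Ide D (fob F a)) \<and>
     (\<forall>a b c. \<forall>f\<in>hom C a b. \<forall>g\<in>hom C b c. far F (Cmp C g f) = Cmp D (far F g) (far F f))"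

definition id_func :: "('o, 'm, 'o, 'm) func" where
  "id_func = \<lparr>fob = (\<lambda>a. a), far = (\<lambda>f. f)\<rparr>"

definition comp_func ::
  "('p, 'n, 'q, 'k) func \<Rightarrow> ('o, 'm, 'p, 'n) func \<Rightarrow> ('o, 'm, 'q, 'k) func" where
  "comp_func G F = \<lparr>fob = (\<lambda>a. fob G (fob F a)), far = (\<lambda>f. far G (far F f))\<rparr>"

definition nat_trans :: "('o, 'm) cat \<Rightarrow> ('p, 'n) cat \<Rightarrow> ('o, 'm, 'p, 'n) func \<Rightarrow>
    ('o, 'm, 'p, 'n) func \<Rightarrow> ('o \<Rightarrow> 'n) \<Rightarrow> bool" where
  "nat_trans C D F G \<eta> \<longleftrightarrow> is_functor C D F \<and> is_functor C D G \<and>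
     (\<forall>a\<in>Obj C. \<eta> a \<in> hom D (fob F a) (fob G a)) \<and>
     (\<forall>a b. \<forall>f\<in>hom C a b. Cmp D (\<eta> b) (far F f) = Cmp D (far G f) (\<eta> a))"

definition nat_isomorphic :: "('o, 'm) cat \<Rightarrow> ('p, 'n) cat \<Rightarrow> ('o, 'm, 'p, 'n) func \<Rightarrow>
    ('o, 'm, 'p, 'n) func \<Rightarrow> bool" where
  "nat_isomorphic C D F G \<longleftrightarrow> (\<exists>\<eta>. nat_trans C D F G \<eta> \<and> (\<forall>a\<in>Obj C. is_iso D (\<eta> a)))"

(* Families of components are extensional on the objects, so that natural transformations
   are equal as arrows exactly when their components are. *)
definition functor_cat :: "('o, 'm) cat \<Rightarrow> ('p, 'n) cat \<Rightarrow>
    (('o, 'm, 'p, 'n) func, ('o, 'm, 'p, 'n) func \<times> ('o \<Rightarrow> 'n) \<times> ('o, 'm, 'p, 'n) func) cat" where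
  "functor_cat C D =
     \<lparr>Obj = {F. is_functor C D F},
      Arr = {(F, \<eta>, G). nat_trans C D F G \<eta> \<and> \<eta> \<in> extensional (Obj C)},
      Dom = (\<lambda>(F, \<eta>, G). F),
      Cod = (\<lambda>(F, \<eta>, G). G),
      Ide = (\<lambda>F. (F, \<lambda>a\<in>Obj C. Ide D (fob F a), F)),
      Cmp = (\<lambda>(G', \<theta>, H) (F, \<eta>, G). (F, \<lambda>a\<in>Obj C. Cmp D (\<theta> a) (\<eta> a), H))\<rparr>"

definition fully_faithful :: "('o, 'm) cat \<Rightarrow> ('p, 'n) cat \<Rightarrow> ('o, 'm, 'p, 'n) func \<Rightarrow> bool" where
  "fully_faithful C D F \<longleftrightarrow>
     (\<forall>a\<in>Obj C. \<forall>b\<in>Obj C. bij_betw (far F) (hom C a b) (hom D (fob F a) (fob F b)))"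

definition is_equivalence :: "('o, 'm) cat \<Rightarrow> ('p, 'n) cat \<Rightarrow> ('o, 'm, 'p, 'n) func \<Rightarrow> bool" where
  "is_equivalence C D F \<longleftrightarrow> is_functor C D F \<and>
     (\<exists>G. is_functor D C G \<and> nat_isomorphic C C id_func (comp_func G F) \<and>
          nat_isomorphic D D (comp_func F G) id_func)"

definition left_adjoint :: "('o, 'm) cat \<Rightarrow> ('p, 'n) cat \<Rightarrow>
    ('o, 'm, 'p, 'n) func \<Rightarrow> ('p, 'n, 'o, 'm) func \<Rightarrow> bool" where
  "left_adjoint C D F G \<longleftrightarrow> is_functor C D F \<and> is_functor D C G \<and>
     (\<exists>\<phi>. (\<forall>c\<in>Obj C. \<forall>d\<in>Obj D. bij_betw (\<phi> c d) (hom D (fob F c) d) (hom C c (fob G d))) \<and>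
          (\<forall>c'\<in>Obj C. \<forall>c\<in>Obj C. \<forall>d\<in>Obj D. \<forall>d'\<in>Obj D.
             \<forall>u\<in>hom C c' c. \<forall>h\<in>hom D (fob F c) d. \<forall>v\<in>hom D d d'.
               \<phi> c' d' (Cmp D v (Cmp D h (far F u))) = Cmp C (far G v) (Cmp C (\<phi> c d h) u)))"

definition is_cone :: "('i, 'j) cat \<Rightarrow> ('o, 'm) cat \<Rightarrow> ('i, 'j, 'o, 'm) func \<Rightarrow>
    'o \<Rightarrow> ('i \<Rightarrow> 'm) \<Rightarrow> bool" where
  "is_cone I C X l \<pi> \<longleftrightarrow> l \<in> Obj C \<and> (\<forall>i\<in>Obj I. \<pi> i \<in> hom C l (fob X i)) \<and>
     (\<forall>u\<in>Arr I. Cmp C (far X u) (\<pi> (Dom I u)) = \<pi> (Cod I u))"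

definition is_limit :: "('i, 'j) cat \<Rightarrow> ('o, 'm) cat \<Rightarrow> ('i, 'j, 'o, 'm) func \<Rightarrow>
    'o \<Rightarrow> ('i \<Rightarrow> 'm) \<Rightarrow> bool" where
  "is_limit I C X l \<pi> \<longleftrightarrow> is_cone I C X l \<pi> \<and>
     (\<forall>k \<kappa>. is_cone I C X k \<kappa> \<longrightarrow>
        (\<exists>!h. h \<in> hom C k l \<and> (\<forall>i\<in>Obj I. Cmp C (\<pi> i) h = \<kappa> i)))"

(* Up to isomorphism every finite category has natural numbers as objects and arrows. *)
definition preserves_finite_limits ::
  "('o, 'm) cat \<Rightarrow> ('p, 'n) cat \<Rightarrow> ('o, 'm, 'p, 'n) func \<Rightarrow> bool" where
  "preserves_finite_limits C D F \<longleftrightarrow>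
     (\<forall>(I :: (nat, nat) cat) X l \<pi>. finite (Arr I) \<and> is_functor I C X \<and> is_limit I C X l \<pi> \<longrightarrow>
        is_limit I D (comp_func F X) (fob F l) (\<lambda>i. far F (\<pi> i)))"


section \<open>Subtoposes\<close>

(* A geometric embedding from E to C with inverse image F and direct image G. *)
definition geometric_embedding :: "('p, 'n) cat \<Rightarrow> ('o, 'm) cat \<Rightarrow>
    ('o, 'm, 'p, 'n) func \<Rightarrow> ('p, 'n, 'o, 'm) func \<Rightarrow> bool" where
  "geometric_embedding E C F G \<longleftrightarrow>
     left_adjoint C E F G \<and> preserves_finite_limits C E F \<and> fully_faithful E C G"

(* A subtopos, i.e. a geometric embedding up to equivalence over C, is represented by the
   essential image of its direct image functor: a replete full subcategory whose inclusion
   is the direct image of a geometric embedding.  (A left exact reflective subcategory of a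
   topos is automatically a topos.) *)
definition subtopos :: "('o, 'm) cat \<Rightarrow> 'o set \<Rightarrow> bool" where
  "subtopos C D \<longleftrightarrow> D \<subseteq> Obj C \<and> (\<forall>a\<in>D. \<forall>b\<in>Obj C. isomorphic C a b \<longrightarrow> b \<in> D) \<and>
     (\<exists>L. geometric_embedding (full_sub C D) C L id_func)"

(* Equivalent to the category with a single arrow. *)
definition degenerate :: "('o, 'm) cat \<Rightarrow> bool" where
  "degenerate C \<longleftrightarrow> Obj C \<noteq> {} \<and> (\<forall>a\<in>Obj C. terminal C a)"


section \<open>Double negation sheaves\<close>

definition monic :: "('o, 'm) cat \<Rightarrow> 'm \<Rightarrow> bool" where
  "monic C m \<longleftrightarrow> m \<in> Arr C \<and>
     (\<forall>a. \<forall>f\<in>hom C a (Dom C m). \<forall>g\<in>hom C a (Dom C m). Cmp C m f = Cmp C m g \<longrightarrow> f = g)"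

(* Subobjects of b are represented by monomorphisms into b, preordered by factorization. *)
definition Sub :: "('o, 'm) cat \<Rightarrow> 'o \<Rightarrow> 'm set" where
  "Sub C b = {m. monic C m \<and> Cod C m = b}"

definition sub_le :: "('o, 'm) cat \<Rightarrow> 'm \<Rightarrow> 'm \<Rightarrow> bool" where
  "sub_le C m n \<longleftrightarrow> (\<exists>f\<in>hom C (Dom C m) (Dom C n). m = Cmp C n f)"

definition sub_disjoint :: "('o, 'm) cat \<Rightarrow> 'o \<Rightarrow> 'm \<Rightarrow> 'm \<Rightarrow> bool" where
  "sub_disjoint C b m n \<longleftrightarrow>
     (\<forall>k\<in>Sub C b. sub_le C k m \<and> sub_le C k n \<longrightarrow> (\<forall>k'\<in>Sub C b. sub_le C k k'))"

(* n represents the pseudocomplement (negation) of m in Sub(b). *)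
definition is_neg :: "('o, 'm) cat \<Rightarrow> 'o \<Rightarrow> 'm \<Rightarrow> 'm \<Rightarrow> bool" where
  "is_neg C b m n \<longleftrightarrow> n \<in> Sub C b \<and> sub_disjoint C b m n \<and>
     (\<forall>n'\<in>Sub C b. sub_disjoint C b m n' \<longrightarrow> sub_le C n' n)"

(* The double negation of m is the top element of Sub(b). *)
definition nn_dense :: "('o, 'm) cat \<Rightarrow> 'o \<Rightarrow> 'm \<Rightarrow> bool" where
  "nn_dense C b m \<longleftrightarrow> m \<in> Sub C b \<and> (\<exists>n. is_neg C b m n \<and> is_neg C b n (Ide C b))"

definition nn_sheaves :: "('o, 'm) cat \<Rightarrow> 'o set" where
  "nn_sheaves C = {x \<in> Obj C. \<forall>b\<in>Obj C. \<forall>m. nn_dense C b m \<longrightarrow>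
     (\<forall>f\<in>hom C (Dom C m) x. \<exists>!g. g \<in> hom C b x \<and> Cmp C g m = f)}"


section \<open>The category of sets\<close>

(* HOL has no type of all sets, so Set is the category of the small subsets of a type, where
   U is the collection of small sets.  The conditions on U hold for the small sets of any
   Grothendieck universe, and for the collection of all subsets of an infinite type. *)
definition set_universe :: "'u set set \<Rightarrow> bool" where
  "set_universe U \<longleftrightarrow>
     (\<exists>x y. x \<noteq> y \<and> {x, y} \<in> U) \<and>
     (\<forall>A\<in>U. \<forall>B. B \<lesssim> A \<longrightarrow> B \<in> U) \<and>
     (\<forall>A\<in>U. \<forall>B\<in>U. \<exists>C\<in>U. A \<times> B \<lesssim> C)"

lemma set_universe_UNIV:
  assumes "infinite (UNIV :: 'u set)"
  shows "set_universe (UNIV :: 'u set set)"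
proof -
  have "\<exists>x y :: 'u. x \<noteq> y"
  proof (rule ccontr)
    assume "\<not> (\<exists>x y :: 'u. x \<noteq> y)"
    then have "(UNIV :: 'u set) = {undefined}" by auto
    with assms show False by (metis finite.emptyI finite.insertI)
  qed
  moreover obtain e where "bij_betw e ((UNIV :: 'u set) \<times> (UNIV :: 'u set)) (UNIV :: 'u set)"
    using card_of_Times_same_infinite[OF assms] card_of_ordIso by blast
  then have "A \<times> B \<lesssim> (UNIV :: 'u set)" for A B :: "'u set"
    unfolding lepoll_def bij_betw_def by (metis UNIV_Times_UNIV inj_on_subset subset_UNIV)
  ultimately show ?thesis
    unfolding set_universe_def by blast
qed

type_synonym 'u setarr = "'u set \<times> ('u \<Rightarrow> 'u) \<times> 'u set"

definition Sets :: "'u set set \<Rightarrow> ('u set, 'u setarr) cat" where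
  "Sets U =
     \<lparr>Obj = U,
      Arr = {(A, f, B). A \<in> U \<and> B \<in> U \<and> f \<in> A \<rightarrow>\<^sub>E B},
      Dom = (\<lambda>(A, f, B). A),
      Cod = (\<lambda>(A, f, B). B),
      Ide = (\<lambda>A. (A, \<lambda>x\<in>A. x, A)),
      Cmp = (\<lambda>(B', g, C) (A, f, B). (A, compose A g f, C))\<rparr>"

definition app :: "'u setarr \<Rightarrow> 'u \<Rightarrow> 'u" where
  "app = (\<lambda>(A, f, B). f)"

(* Sets such as hom-sets and function spaces do not consist of elements of type 'u;
   small_set replaces such a set by a chosen bijective copy in U, and small_map transports
   a function along these bijections. *)
definition code :: "'u set set \<Rightarrow> 'x set \<Rightarrow> 'x \<Rightarrow> 'u" where
  "code U X = (SOME e. inj_on e X \<and> e ` X \<in> U)"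

definition small_set :: "'u set set \<Rightarrow> 'x set \<Rightarrow> 'u set" where
  "small_set U X = code U X ` X"

definition small_map :: "'u set set \<Rightarrow> 'x set \<Rightarrow> 'y set \<Rightarrow> ('x \<Rightarrow> 'y) \<Rightarrow> 'u setarr" where
  "small_map U X Y h =
     (small_set U X, \<lambda>s\<in>small_set U X. code U Y (h (inv_into X (code U X) s)), small_set U Y)"

definition hom_func :: "'u set set \<Rightarrow> ('o, 'm) cat \<Rightarrow> 'o \<Rightarrow> ('o, 'm, 'u set, 'u setarr) func" where
  "hom_func U C a =
     \<lparr>fob = (\<lambda>b. small_set U (hom C a b)),
      far = (\<lambda>h. small_map U (hom C a (Dom C h)) (hom C a (Cod C h)) (Cmp C h))\<rparr>"


section \<open>Sheaves on a site\<close>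

definition sieve :: "('o, 'm) cat \<Rightarrow> 'o \<Rightarrow> 'm set \<Rightarrow> bool" where
  "sieve C a S \<longleftrightarrow> S \<subseteq> {f \<in> Arr C. Cod C f = a} \<and>
     (\<forall>f\<in>S. \<forall>g\<in>Arr C. Cod C g = Dom C f \<longrightarrow> Cmp C f g \<in> S)"

definition matching_family :: "('o, 'm) cat \<Rightarrow> ('o, 'm, 'u set, 'u setarr) func \<Rightarrow>
    'm set \<Rightarrow> ('m \<Rightarrow> 'u) \<Rightarrow> bool" where
  "matching_family C F S x \<longleftrightarrow> (\<forall>f\<in>S. x f \<in> fob F (Dom C f)) \<and>
     (\<forall>f\<in>S. \<forall>g\<in>Arr C. Cod C g = Dom C f \<longrightarrow> app (far F g) (x f) = x (Cmp C f g))"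

definition is_sheaf :: "'u set set \<Rightarrow> ('o, 'm) cat \<Rightarrow> ('o \<Rightarrow> 'm set set) \<Rightarrow>
    ('o, 'm, 'u set, 'u setarr) func \<Rightarrow> bool" where
  "is_sheaf U C J F \<longleftrightarrow> is_functor (op_cat C) (Sets U) F \<and>
     (\<forall>a\<in>Obj C. \<forall>S\<in>J a. \<forall>x. matching_family C F S x \<longrightarrow>
        (\<exists>!y. y \<in> fob F a \<and> (\<forall>f\<in>S. app (far F f) y = x f)))"

definition Sh :: "'u set set \<Rightarrow> ('o, 'm) cat \<Rightarrow> ('o \<Rightarrow> 'm set set) \<Rightarrow>
    (('o, 'm, 'u set, 'u setarr) func,
     ('o, 'm, 'u set, 'u setarr) func \<times> ('o \<Rightarrow> 'u setarr) \<times> ('o, 'm, 'u set, 'u setarr) func) cat" where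
  "Sh U C J = full_sub (functor_cat (op_cat C) (Sets U)) {F. is_sheaf U C J F}"


section \<open>Finite posets and open maps\<close>

(* A carrier together with an order relation.  Carriers are finite sets of natural numbers,
   which yields a small category equivalent to that of all finite posets. *)
type_synonym poset = "nat set \<times> (nat \<times> nat) set"
type_synonym posetarr = "poset \<times> (nat \<Rightarrow> nat) \<times> poset"

definition finite_poset :: "poset \<Rightarrow> bool" where
  "finite_poset P \<longleftrightarrow> finite (fst P) \<and> partial_order_on (fst P) (snd P)"

definition open_map :: "poset \<Rightarrow> poset \<Rightarrow> (nat \<Rightarrow> nat) \<Rightarrow> bool" where
  "open_map P Q f \<longleftrightarrow> f \<in> fst P \<rightarrow>\<^sub>E fst Q \<and>
     (\<forall>p p'. (p, p') \<in> snd P \<longrightarrow> (f p, f p') \<in> snd Q) \<and>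
     (\<forall>p\<in>fst P. \<forall>q. (f p, q) \<in> snd Q \<longrightarrow> (\<exists>p'. (p, p') \<in> snd P \<and> f p' = q))"

definition Kp :: "(poset, posetarr) cat" where
  "Kp =
     \<lparr>Obj = {P. finite_poset P},
      Arr = {(P, f, Q). finite_poset P \<and> finite_poset Q \<and> open_map P Q f},
      Dom = (\<lambda>(P, f, Q). P),
      Cod = (\<lambda>(P, f, Q). Q),
      Ide = (\<lambda>P. (P, \<lambda>p\<in>fst P. p, P)),
      Cmp = (\<lambda>(Q', g, R) (P, f, Q). (P, compose (fst P) g f, R))\<rparr>"

definition J_surj :: "poset \<Rightarrow> posetarr set set" where
  "J_surj P = {S. sieve Kp P S \<and> (\<forall>p\<in>fst P. \<exists>(Q, f, P')\<in>S. p \<in> f ` fst Q)}"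

definition max_elems :: "poset \<Rightarrow> nat set" where
  "max_elems P = {p \<in> fst P. \<forall>q. (p, q) \<in> snd P \<longrightarrow> q = p}"


section \<open>The topos and its global sections\<close>

type_synonym 'u psh = "(poset, posetarr, 'u set, 'u setarr) func"
type_synonym 'u psharr = "'u psh \<times> (poset \<Rightarrow> 'u setarr) \<times> 'u psh"

definition KK :: "'u set set \<Rightarrow> ('u psh, 'u psharr) cat" where
  "KK U = Sh U Kp J_surj"

definition Gamma :: "'u set set \<Rightarrow> ('u psh, 'u psharr, 'u set, 'u setarr) func" where
  "Gamma U = hom_func U (KK U) (terminal_obj (KK U))"

(* The sheaf P \<mapsto> S^(max P); an open map Q \<rightarrow> P sends max Q to max P and acts by precomposition. *)
definition nabla_ob :: "'u set set \<Rightarrow> 'u set \<Rightarrow> 'u psh" where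
  "nabla_ob U S =
     \<lparr>fob = (\<lambda>P. small_set U (max_elems P \<rightarrow>\<^sub>E S)),
      far = (\<lambda>(Q, f, P). small_map U (max_elems P \<rightarrow>\<^sub>E S) (max_elems Q \<rightarrow>\<^sub>E S)
                            (\<lambda>s. compose (max_elems Q) s f))\<rparr>"

definition nabla :: "'u set set \<Rightarrow> ('u set, 'u setarr, 'u psh, 'u psharr) func" where
  "nabla U =
     \<lparr>fob = nabla_ob U,
      far = (\<lambda>(S, g, T).
        (nabla_ob U S,
         \<lambda>P\<in>Obj Kp. small_map U (max_elems P \<rightarrow>\<^sub>E S) (max_elems P \<rightarrow>\<^sub>E T)
                       (\<lambda>s. compose (max_elems P) g s),
         nabla_ob U T))\<rparr>"

end

theory Submission
  imports Defs
begin

text \<open>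
  A subtopos is a full subcategory \<open>D\<close> with a left exact reflector. Call an upset
  \<open>V\<close> of a finite poset \<open>P\<close> dense if every sheaf in \<open>D\<close>
  has the same sections over \<open>V\<close> as over \<open>P\<close>. Left exactness makes
  density stable under preimage along open maps; and since sieves closed for the topology are
  given by upsets, the locus where two sections are identified by the unit, or where a section
  lies in the image of an injective unit, is a dense upset.

  If no proper upset is dense, all units are isomorphisms and \<open>D\<close> is everything.
  If the empty upset of the point is dense, \<open>D\<close> is degenerate. Otherwise take a
  proper dense upset, restrict it to the principal upset of a maximal element of its complement
  and collapse everything strictly above that element: by descent, the top of the two element
  chain is dense. Every poset \<open>Q\<close> maps to this chain with the set of maximal
  elements as preimage of the top, so the maximal elements of \<open>Q\<close> are dense in
  \<open>Q\<close>, and \<open>D\<close> consists exactly of the sheaves with \<open>x(Q) =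
  x(1)^(max Q)\<close>. These are the double negation sheaves and also the sheaves isomorphic
  to some \<open>\<nabla>S\<close>, because a subobject is dense for double negation iff it
  contains all points.
\<close>

section \<open>Categories, reflections and orthogonality\<close>

text \<open>The reflector is used only through the arrows that it inverts, and these are exactly the
  arrows to which every object of \<open>D\<close> is orthogonal. By Yoneda, orthogonality to the
  inclusion of an upset \<open>V\<close> of \<open>P\<close> says that restriction from
  \<open>P\<close> to \<open>V\<close> is bijective; this is why density can be expressed by
  sections alone, without the reflector. Left exactness enters through a single limit, that of a
  parallel pair into \<open>w\<close> together with another arrow into \<open>w\<close>. It is
  evaluated once in \<open>dense_closed\<close>, and three choices of the data give stability of
  density, the equality locus and the image locus. The delicate point is the descent to the two
  element chain. The collapse onto the chain is not injective, so a section upstairs descends only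
  if its restrictions along any two maps identified by the collapse agree. This is checked on a
  dense preimage, where the section comes from a one element poset and there is nothing to compare.
  For the double negation sheaves, no negation is computed in general: a sheaf without points has
  sections over the empty poset only, so it lies below every subobject, and all statements about
  disjointness reduce to statements about points.\<close>

lemma hom_iff: "f \<in> hom C a b \<longleftrightarrow> f \<in> Arr C \<and> Dom C f = a \<and> Cod C f = b"
  by (simp add: hom_def)

lemma hom_D: "f \<in> hom C a b \<Longrightarrow> f \<in> Arr C" "f \<in> hom C a b \<Longrightarrow> Dom C f = a" "f \<in> hom C a b \<Longrightarrow> Cod C f = b"
  by (simp_all add: hom_def)

lemma cat_obj:
  assumes "category C" "f \<in> hom C a b"
  shows "a \<in> Obj C" "b \<in> Obj C"
  using assms unfolding category_def hom_def by auto

lemma cat_ide: "category C \<Longrightarrow> a \<in> Obj C \<Longrightarrow> Ide C a \<in> hom C a a"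
  unfolding category_def by blast

lemma cat_cmp: "category C \<Longrightarrow> f \<in> hom C a b \<Longrightarrow> g \<in> hom C b c \<Longrightarrow> Cmp C g f \<in> hom C a c"
  unfolding category_def by blast

lemma cat_idr: "category C \<Longrightarrow> f \<in> hom C a b \<Longrightarrow> Cmp C f (Ide C a) = f"
  unfolding category_def by blast

lemma cat_idl: "category C \<Longrightarrow> f \<in> hom C a b \<Longrightarrow> Cmp C (Ide C b) f = f"
  unfolding category_def by blast

lemma cat_assoc:
  "category C \<Longrightarrow> f \<in> hom C a b \<Longrightarrow> g \<in> hom C b c \<Longrightarrow> h \<in> hom C c d \<Longrightarrow>
    Cmp C h (Cmp C g f) = Cmp C (Cmp C h g) f"
  unfolding category_def by blast

section \<open>Full subcategories, functors and isomorphisms\<close>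

lemma full_sub_simps [simp]:
  "Obj (full_sub C D) = Obj C \<inter> D" "Dom (full_sub C D) = Dom C" "Cod (full_sub C D) = Cod C"
  "Ide (full_sub C D) = Ide C" "Cmp (full_sub C D) = Cmp C"
  by (simp_all add: full_sub_def)

lemma hom_full_sub: "hom (full_sub C D) a b = {f \<in> hom C a b. a \<in> D \<and> b \<in> D}"
  by (auto simp: hom_def full_sub_def)

lemma hom_full_subD: "f \<in> hom (full_sub C D) a b \<Longrightarrow> f \<in> hom C a b"
  by (simp add: hom_full_sub)

lemma Arr_full_sub: "f \<in> Arr (full_sub C D) \<longleftrightarrow> f \<in> Arr C \<and> Dom C f \<in> D \<and> Cod C f \<in> D"
  by (simp add: full_sub_def)

lemma category_full_sub:
  assumes "category C" shows "category (full_sub C D)"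
  unfolding category_def
proof (intro conjI ballI allI)
  fix f assume "f \<in> Arr (full_sub C D)"
  then show "Dom (full_sub C D) f \<in> Obj (full_sub C D)" "Cod (full_sub C D) f \<in> Obj (full_sub C D)"
    using assms by (auto simp: Arr_full_sub category_def)
next
  fix a assume "a \<in> Obj (full_sub C D)"
  then show "Ide (full_sub C D) a \<in> hom (full_sub C D) a a"
    using cat_ide[OF assms] by (auto simp: hom_full_sub)
next
  fix a b c f g assume "f \<in> hom (full_sub C D) a b" "g \<in> hom (full_sub C D) b c"
  then show "Cmp (full_sub C D) g f \<in> hom (full_sub C D) a c"
    using cat_cmp[OF assms] by (auto simp: hom_full_sub)
next
  fix a b f assume "f \<in> hom (full_sub C D) a b"
  then show "Cmp (full_sub C D) f (Ide (full_sub C D) a) = f"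
    "Cmp (full_sub C D) (Ide (full_sub C D) b) f = f"
    using cat_idl[OF assms] cat_idr[OF assms] by (auto simp: hom_full_sub)
next
  fix a b c d f g h
  assume "f \<in> hom (full_sub C D) a b" "g \<in> hom (full_sub C D) b c" "h \<in> hom (full_sub C D) c d"
  then show "Cmp (full_sub C D) h (Cmp (full_sub C D) g f) =
    Cmp (full_sub C D) (Cmp (full_sub C D) h g) f"
    using cat_assoc[OF assms] by (auto simp: hom_full_sub)
qed

lemma func_simps [simp]:
  "fob id_func a = a" "far id_func f = f"
  "fob (comp_func G F) a = fob G (fob F a)" "far (comp_func G F) f = far G (far F f)"
  by (simp_all add: id_func_def comp_func_def)

lemma comp_func_assoc: "comp_func (comp_func H G) F = comp_func H (comp_func G F)"
  by (simp add: comp_func_def)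

lemma fun_cat: "is_functor C D F \<Longrightarrow> category C" "is_functor C D F \<Longrightarrow> category D"
  unfolding is_functor_def by blast+

lemma fun_ob: "is_functor C D F \<Longrightarrow> a \<in> Obj C \<Longrightarrow> fob F a \<in> Obj D"
  unfolding is_functor_def by blast

lemma fun_ar: "is_functor C D F \<Longrightarrow> f \<in> hom C a b \<Longrightarrow> far F f \<in> hom D (fob F a) (fob F b)"
  unfolding is_functor_def hom_def by blast

lemma fun_id: "is_functor C D F \<Longrightarrow> a \<in> Obj C \<Longrightarrow> far F (Ide C a) = Ide D (fob F a)"
  unfolding is_functor_def by blast

lemma fun_cmp: "is_functor C D F \<Longrightarrow> f \<in> hom C a b \<Longrightarrow> g \<in> hom C b c \<Longrightarrow>
    far F (Cmp C g f) = Cmp D (far F g) (far F f)"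
  unfolding is_functor_def by blast

lemma is_functorI:
  assumes "category C" "category D"
    and "\<And>a. a \<in> Obj C \<Longrightarrow> fob F a \<in> Obj D"
    and "\<And>a b f. f \<in> hom C a b \<Longrightarrow> far F f \<in> hom D (fob F a) (fob F b)"
    and "\<And>a. a \<in> Obj C \<Longrightarrow> far F (Ide C a) = Ide D (fob F a)"
    and "\<And>a b c f g. f \<in> hom C a b \<Longrightarrow> g \<in> hom C b c \<Longrightarrow> far F (Cmp C g f) = Cmp D (far F g) (far F f)"
  shows "is_functor C D F"
  unfolding is_functor_def
proof (intro conjI ballI allI)
  fix f assume "f \<in> Arr C"
  then have "f \<in> hom C (Dom C f) (Cod C f)" by (simp add: hom_def)
  then show "far F f \<in> hom D (fob F (Dom C f)) (fob F (Cod C f))" by (rule assms(4))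
qed (use assms in blast)+

lemma is_functor_comp:
  assumes "is_functor C D F" "is_functor D E G"
  shows "is_functor C E (comp_func G F)"
  by (rule is_functorI)
    (simp_all add: fun_cat[OF assms(1)] fun_cat[OF assms(2)] fun_ob[OF assms(1)] fun_ob[OF assms(2)]
      fun_id[OF assms(1)] fun_id[OF assms(2)] fun_ar[OF assms(2) fun_ar[OF assms(1)]]
      fun_cmp[OF assms(1)] fun_cmp[OF assms(2) fun_ar[OF assms(1)] fun_ar[OF assms(1)]])

lemma is_functor_id: "category C \<Longrightarrow> is_functor C C id_func"
  by (rule is_functorI) auto

lemma is_functor_inclusion:
  assumes "category C" shows "is_functor (full_sub C D) C id_func"
  by (rule is_functorI) (use assms in \<open>auto simp: category_full_sub hom_full_sub\<close>)

lemma is_functor_into_full_sub: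
  assumes "is_functor E C G" "\<And>e. e \<in> Obj E \<Longrightarrow> fob G e \<in> D"
  shows "is_functor E (full_sub C D) G"
  by (rule is_functorI)
    (use assms fun_cat[OF assms(1)] cat_obj[OF fun_cat(1)[OF assms(1)]] in
      \<open>auto simp: category_full_sub hom_full_sub fun_ob fun_ar fun_id fun_cmp\<close>)

lemma is_isoI:
  assumes "f \<in> hom C a b" "g \<in> hom C b a" "Cmp C g f = Ide C a" "Cmp C f g = Ide C b"
  shows "is_iso C f"
  using assms unfolding is_iso_def by (auto simp: hom_D intro!: bexI[of _ g])

lemma is_isoE:
  assumes "is_iso C f" "f \<in> hom C a b"
  obtains g where "g \<in> hom C b a" "Cmp C g f = Ide C a" "Cmp C f g = Ide C b" "is_iso C g"
proof -
  obtain g where g: "g \<in> hom C b a" "Cmp C g f = Ide C a" "Cmp C f g = Ide C b"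
    using assms unfolding is_iso_def by (auto simp: hom_D)
  then show ?thesis using that is_isoI[OF g(1) assms(2)] by blast
qed

lemma iso_cancel_right:
  assumes C: "category C" and m: "is_iso C m" "m \<in> hom C a b"
    and "f \<in> hom C b c" "g \<in> hom C b c" "Cmp C f m = Cmp C g m"
  shows "f = g"
proof -
  obtain n where n: "n \<in> hom C b a" "Cmp C m n = Ide C b" using is_isoE[OF m] by metis
  have "f = Cmp C (Cmp C f m) n" "g = Cmp C (Cmp C g m) n"
    using cat_assoc[OF C n(1) m(2)] assms cat_idr[OF C] n by metis+
  then show ?thesis using assms by simp
qed

subsection \<open>Universal arrows\<close>

text \<open>An adjunction given by its unit. This form needs no family of bijections between
  hom-sets, and it makes the unit available as an arrow that can be composed and tested for
  invertibility.\<close>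

definition universal_unit where
  "universal_unit C D F G \<eta> \<longleftrightarrow> is_functor C D F \<and> is_functor D C G \<and>
     (\<forall>c\<in>Obj C. \<eta> c \<in> hom C c (fob G (fob F c))) \<and>
     (\<forall>c c'. \<forall>u\<in>hom C c c'. Cmp C (\<eta> c') u = Cmp C (far G (far F u)) (\<eta> c)) \<and>
     (\<forall>c\<in>Obj C. \<forall>d\<in>Obj D. \<forall>h\<in>hom C c (fob G d).
        \<exists>!k. k \<in> hom D (fob F c) d \<and> Cmp C (far G k) (\<eta> c) = h)"

lemma universal_unitD:
  assumes "universal_unit C D F G \<eta>"
  shows "is_functor C D F" "is_functor D C G"
    "c \<in> Obj C \<Longrightarrow> \<eta> c \<in> hom C c (fob G (fob F c))"
    "u \<in> hom C c c' \<Longrightarrow> Cmp C (\<eta> c') u = Cmp C (far G (far F u)) (\<eta> c)"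
    "c \<in> Obj C \<Longrightarrow> d \<in> Obj D \<Longrightarrow> h \<in> hom C c (fob G d) \<Longrightarrow>
      \<exists>!k. k \<in> hom D (fob F c) d \<and> Cmp C (far G k) (\<eta> c) = h"
  using assms unfolding universal_unit_def by blast+

lemma universal_unit_eq:
  assumes "universal_unit C D F G \<eta>" "c \<in> Obj C" "d \<in> Obj D"
    "k \<in> hom D (fob F c) d" "k' \<in> hom D (fob F c) d"
    "Cmp C (far G k) (\<eta> c) = Cmp C (far G k') (\<eta> c)"
  shows "k = k'"
proof -
  have "Cmp C (far G k) (\<eta> c) \<in> hom C c (fob G d)"
    using universal_unitD[OF assms(1)] assms(2,4) fun_ar cat_cmp fun_cat by metis
  from universal_unitD(5)[OF assms(1,2,3) this] show ?thesis using assms(4-6) by metis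
qed

text \<open>The Yoneda argument: a natural bijection \<phi> is determined by the images of
  identities, and these images form the unit.\<close>

lemma left_adjoint_imp_universal_unit:
  assumes "left_adjoint C D F G"
  obtains \<eta> where "universal_unit C D F G \<eta>"
proof -
  obtain \<phi> where F: "is_functor C D F" and G: "is_functor D C G"
    and bij: "\<And>c d. c \<in> Obj C \<Longrightarrow> d \<in> Obj D \<Longrightarrow> bij_betw (\<phi> c d) (hom D (fob F c) d) (hom C c (fob G d))"
    and nat: "\<And>c' c d d' u h v. c' \<in> Obj C \<Longrightarrow> c \<in> Obj C \<Longrightarrow> d \<in> Obj D \<Longrightarrow> d' \<in> Obj D \<Longrightarrow>
      u \<in> hom C c' c \<Longrightarrow> h \<in> hom D (fob F c) d \<Longrightarrow> v \<in> hom D d d' \<Longrightarrow>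
      \<phi> c' d' (Cmp D v (Cmp D h (far F u))) = Cmp C (far G v) (Cmp C (\<phi> c d h) u)"
    using assms unfolding left_adjoint_def by metis
  have C: "category C" and D: "category D" using fun_cat[OF F] by auto
  define \<eta> where "\<eta> c = \<phi> c (fob F c) (Ide D (fob F c))" for c
  have \<eta>: "\<eta> c \<in> hom C c (fob G (fob F c))" if "c \<in> Obj C" for c
    using bij_betwE[OF bij[OF that fun_ob[OF F that]]] cat_ide[OF D fun_ob[OF F that]]
    unfolding \<eta>_def by blast
  have \<phi>: "\<phi> c d k = Cmp C (far G k) (\<eta> c)" if c: "c \<in> Obj C" and d: "d \<in> Obj D"
    and k: "k \<in> hom D (fob F c) d" for c d k
  proof -
    have Fc: "fob F c \<in> Obj D" using fun_ob[OF F c] .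
    \<comment> \<open>Naturality at two identities, with only \<open>k\<close> varying, recovers
      \<phi> from \<eta>.\<close>
    have "\<phi> c d (Cmp D k (Cmp D (Ide D (fob F c)) (far F (Ide C c)))) =
        Cmp C (far G k) (Cmp C (\<eta> c) (Ide C c))"
      unfolding \<eta>_def by (rule nat[OF c c Fc d cat_ide[OF C c] cat_ide[OF D Fc] k])
    moreover have "Cmp D k (Cmp D (Ide D (fob F c)) (far F (Ide C c))) = k"
      using fun_id[OF F c] cat_idl[OF D cat_ide[OF D Fc]] cat_idr[OF D k] by simp
    ultimately show ?thesis using cat_idr[OF C \<eta>[OF c]] by simp
  qed
  have natu: "Cmp C (\<eta> c') u = Cmp C (far G (far F u)) (\<eta> c)" if u: "u \<in> hom C c c'" for c c' u
  proof -
    have c: "c \<in> Obj C" "c' \<in> Obj C" using cat_obj[OF C u] by auto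
    have Fc: "fob F c \<in> Obj D" "fob F c' \<in> Obj D" using c fun_ob[OF F] by auto
    note i = cat_ide[OF D Fc(2)]
    \<comment> \<open>The complementary instance: only the source varies, which expresses the
      transpose of \<open>far F u\<close> through the unit at \<open>c'\<close>.\<close>
    have "\<phi> c (fob F c') (Cmp D (Ide D (fob F c')) (Cmp D (Ide D (fob F c')) (far F u))) =
        Cmp C (far G (Ide D (fob F c'))) (Cmp C (\<eta> c') u)"
      unfolding \<eta>_def by (rule nat[OF c Fc(2) Fc(2) u i i])
    then have "\<phi> c (fob F c') (far F u) = Cmp C (\<eta> c') u"
      using cat_idl[OF D fun_ar[OF F u]] fun_id[OF G Fc(2)] cat_idl[OF C cat_cmp[OF C u \<eta>[OF c(2)]]]
      by simp
    then show ?thesis using \<phi>[OF c(1) Fc(2) fun_ar[OF F u]] by simp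
  qed
  have "\<exists>!k. k \<in> hom D (fob F c) d \<and> Cmp C (far G k) (\<eta> c) = h"
    if c: "c \<in> Obj C" and d: "d \<in> Obj D" and h: "h \<in> hom C c (fob G d)" for c d h
  proof -
    obtain k where "k \<in> hom D (fob F c) d" "\<phi> c d k = h"
      using bij_betw_imp_surj_on[OF bij[OF c d]] h by (metis imageE)
    then show ?thesis
      using \<phi>[OF c d] bij_betw_imp_inj_on[OF bij[OF c d]] by (metis inj_onD)
  qed
  then show ?thesis using F G \<eta> natu that[of \<eta>] unfolding universal_unit_def by blast
qed

lemma universal_unit_imp_left_adjoint:
  assumes u: "universal_unit C D F G \<eta>"
  shows "left_adjoint C D F G"
proof -
  note F = universal_unitD(1)[OF u] and G = universal_unitD(2)[OF u]
  have C: "category C" and D: "category D" using fun_cat[OF F] by auto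
  define \<phi> where "\<phi> c (d::'c) k = Cmp C (far G k) (\<eta> c)" for c d k
  have "bij_betw (\<phi> c d) (hom D (fob F c) d) (hom C c (fob G d))"
    if c: "c \<in> Obj C" and d: "d \<in> Obj D" for c d
    unfolding bij_betw_def
  proof
    show "inj_on (\<phi> c d) (hom D (fob F c) d)"
      unfolding inj_on_def \<phi>_def using universal_unit_eq[OF u c d] by blast
    show "\<phi> c d ` hom D (fob F c) d = hom C c (fob G d)"
    proof
      show "\<phi> c d ` hom D (fob F c) d \<subseteq> hom C c (fob G d)"
        unfolding \<phi>_def using cat_cmp[OF C universal_unitD(3)[OF u c] fun_ar[OF G]] by blast
      show "hom C c (fob G d) \<subseteq> \<phi> c d ` hom D (fob F c) d"
      proof
        fix h assume "h \<in> hom C c (fob G d)"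
        then obtain k where "k \<in> hom D (fob F c) d" "Cmp C (far G k) (\<eta> c) = h"
          using universal_unitD(5)[OF u c d] by blast
        then show "h \<in> \<phi> c d ` hom D (fob F c) d" unfolding \<phi>_def by blast
      qed
    qed
  qed
  moreover have "\<phi> c' d' (Cmp D v (Cmp D h (far F t))) = Cmp C (far G v) (Cmp C (\<phi> c d h) t)"
    if t: "t \<in> hom C c' c" and h: "h \<in> hom D (fob F c) d" and v: "v \<in> hom D d d'" for c' c d d' t h v
  proof -
    have c: "c' \<in> Obj C" "c \<in> Obj C" using cat_obj[OF C t] by auto
    note Ft = fun_ar[OF F t]
    note GFt = fun_ar[OF G Ft] and Gh = fun_ar[OF G h] and Gv = fun_ar[OF G v]
    note e = universal_unitD(3)[OF u c(2)] and e' = universal_unitD(3)[OF u c(1)]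
    have "Cmp C (far G (Cmp D v (Cmp D h (far F t)))) (\<eta> c') =
        Cmp C (Cmp C (far G v) (Cmp C (far G h) (far G (far F t)))) (\<eta> c')"
      using fun_cmp[OF G Ft h] fun_cmp[OF G cat_cmp[OF D Ft h] v] by simp
    also have "\<dots> = Cmp C (far G v) (Cmp C (far G h) (Cmp C (far G (far F t)) (\<eta> c')))"
      using cat_assoc[OF C e' cat_cmp[OF C GFt Gh] Gv] cat_assoc[OF C e' GFt Gh] by simp
    also have "\<dots> = Cmp C (far G v) (Cmp C (far G h) (Cmp C (\<eta> c) t))"
      using universal_unitD(4)[OF u t] by simp
    also have "\<dots> = Cmp C (far G v) (Cmp C (Cmp C (far G h) (\<eta> c)) t)"
      using cat_assoc[OF C t e Gh] by simp
    finally show ?thesis unfolding \<phi>_def .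
  qed
  ultimately show ?thesis using F G unfolding left_adjoint_def by blast
qed

subsection \<open>Orthogonality\<close>

text \<open>In the usual terms, \<open>x\<close> is local with respect to \<open>m\<close>: every
  arrow into \<open>x\<close> from the domain of \<open>m\<close> extends uniquely along
  \<open>m\<close>.\<close>

definition orthogonal where
  "orthogonal C m x \<longleftrightarrow> (\<forall>f\<in>hom C (Dom C m) x. \<exists>!g. g \<in> hom C (Cod C m) x \<and> Cmp C g m = f)"

lemma orthogonal_iff:
  "m \<in> hom C a b \<Longrightarrow> orthogonal C m x \<longleftrightarrow> (\<forall>f\<in>hom C a x. \<exists>!g. g \<in> hom C b x \<and> Cmp C g m = f)"
  by (simp add: orthogonal_def hom_D)

lemma orthogonal_eq:
  assumes "category C" "orthogonal C m x" "m \<in> hom C a b" "g \<in> hom C b x" "g' \<in> hom C b x"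
    "Cmp C g m = Cmp C g' m"
  shows "g = g'"
  using assms cat_cmp[OF assms(1,3,4)] unfolding orthogonal_iff[OF assms(3)] by metis

lemma orthogonal_isomorphic:
  assumes C: "category C" and m: "m \<in> hom C a b" and o: "orthogonal C m x" and i: "isomorphic C x y"
  shows "orthogonal C m y"
  unfolding orthogonal_iff[OF m]
proof
  obtain u where u: "u \<in> hom C x y" "is_iso C u" using i unfolding isomorphic_def by blast
  obtain v where v: "v \<in> hom C y x" "Cmp C v u = Ide C x" "Cmp C u v = Ide C y" "is_iso C v"
    using is_isoE[OF u(2,1)] by metis
  fix f assume f: "f \<in> hom C a y"
  obtain g where g: "g \<in> hom C b x" "Cmp C g m = Cmp C v f"
    using o cat_cmp[OF C f v(1)] unfolding orthogonal_iff[OF m] by metis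
  show "\<exists>!g. g \<in> hom C b y \<and> Cmp C g m = f"
  proof (rule ex1I[of _ "Cmp C u g"])
    have "Cmp C (Cmp C u g) m = Cmp C u (Cmp C v f)"
      using cat_assoc[OF C m g(1) u(1)] g(2) by simp
    also have "\<dots> = f" using cat_assoc[OF C f v(1) u(1)] v(3) cat_idl[OF C f] by simp
    finally show "Cmp C u g \<in> hom C b y \<and> Cmp C (Cmp C u g) m = f"
      using cat_cmp[OF C g(1) u(1)] by simp
  next
    fix g' assume g': "g' \<in> hom C b y \<and> Cmp C g' m = f"
    have "Cmp C (Cmp C v g') m = Cmp C g m"
      using g' cat_assoc[OF C m _ v(1), of g'] g(2) by simp
    then have "Cmp C v g' = g"
      using orthogonal_eq[OF C o m cat_cmp[OF C _ v(1)] g(1)] g' by blast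
    then have "Cmp C u g = Cmp C (Cmp C u v) g'" using cat_assoc[OF C conjunct1[OF g'] v(1) u(1)] by simp
    then show "g' = Cmp C u g" using v(3) cat_idl[OF C] g' by metis
  qed
qed

text \<open>Transposition turns extension along \<open>m\<close> into \<open>fob G e\<close> into
  extension along \<open>far F m\<close> into \<open>e\<close>, and the latter is composition with
  the inverse.\<close>

lemma orthogonal_of_iso:
  assumes u: "universal_unit C E F G \<eta>" and m: "m \<in> hom C a b" and i: "is_iso E (far F m)"
    and e: "e \<in> Obj E"
  shows "orthogonal C m (fob G e)"
  unfolding orthogonal_iff[OF m]
proof
  note F = universal_unitD(1)[OF u] and G = universal_unitD(2)[OF u]
  have C: "category C" and E: "category E" using fun_cat[OF F] by auto
  have a: "a \<in> Obj C" and b: "b \<in> Obj C" using cat_obj[OF C m] by auto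
  note Fm = fun_ar[OF F m]
  note ea = universal_unitD(3)[OF u a] and eb = universal_unitD(3)[OF u b]
  note nat = universal_unitD(4)[OF u m]
  obtain n where n: "n \<in> hom E (fob F b) (fob F a)" "Cmp E n (far F m) = Ide E (fob F a)"
    using is_isoE[OF i Fm] by metis
  fix f assume f: "f \<in> hom C a (fob G e)"
  obtain k where k: "k \<in> hom E (fob F a) e" "Cmp C (far G k) (\<eta> a) = f"
    using universal_unitD(5)[OF u a e f] by blast
  have kn: "Cmp E k n \<in> hom E (fob F b) e" using cat_cmp[OF E n(1) k(1)] .
  note Gkn = fun_ar[OF G kn]
  show "\<exists>!g. g \<in> hom C b (fob G e) \<and> Cmp C g m = f"
  proof (rule ex1I[of _ "Cmp C (far G (Cmp E k n)) (\<eta> b)"])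
    have "Cmp C (Cmp C (far G (Cmp E k n)) (\<eta> b)) m =
        Cmp C (Cmp C (far G (Cmp E k n)) (far G (far F m))) (\<eta> a)"
      using cat_assoc[OF C m eb Gkn] nat cat_assoc[OF C ea fun_ar[OF G Fm] Gkn] by simp
    also have "\<dots> = Cmp C (far G (Cmp E (Cmp E k n) (far F m))) (\<eta> a)"
      using fun_cmp[OF G Fm kn] by simp
    also have "\<dots> = f"
      using cat_assoc[OF E Fm n(1) k(1)] n(2) cat_idr[OF E k(1)] k(2) by simp
    finally show "Cmp C (far G (Cmp E k n)) (\<eta> b) \<in> hom C b (fob G e) \<and>
        Cmp C (Cmp C (far G (Cmp E k n)) (\<eta> b)) m = f"
      using cat_cmp[OF C eb Gkn] by blast
  next
    fix g assume g: "g \<in> hom C b (fob G e) \<and> Cmp C g m = f"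
    obtain l where l: "l \<in> hom E (fob F b) e" "Cmp C (far G l) (\<eta> b) = g"
      using universal_unitD(5)[OF u b e] g by blast
    have "Cmp C (far G (Cmp E l (far F m))) (\<eta> a) = Cmp C (far G l) (Cmp C (\<eta> b) m)"
      using fun_cmp[OF G Fm l(1)] cat_assoc[OF C ea fun_ar[OF G Fm] fun_ar[OF G l(1)]] nat by simp
    also have "\<dots> = f" using cat_assoc[OF C m eb fun_ar[OF G l(1)]] l(2) g by simp
    finally have "Cmp E l (far F m) = k"
      using universal_unit_eq[OF u a e cat_cmp[OF E Fm l(1)] k(1)] k(2) by simp
    moreover have "Cmp E (Cmp E k n) (far F m) = k"
      using cat_assoc[OF E Fm n(1) k(1)] n(2) cat_idr[OF E k(1)] by simp
    ultimately have "l = Cmp E k n" using iso_cancel_right[OF E i Fm l(1) kn] by simp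
    then show "g = Cmp C (far G (Cmp E k n)) (\<eta> b)" using l(2) by simp
  qed
qed

text \<open>The inverse of \<open>far F m\<close> is the transpose of the extension of the unit at
  \<open>a\<close> along \<open>m\<close>. Both equations follow from uniqueness, of transposes on
  one side and of extensions on the other.\<close>

lemma iso_of_orthogonal:
  assumes u: "universal_unit C E F G \<eta>" and m: "m \<in> hom C a b"
    and o: "\<And>e. e \<in> Obj E \<Longrightarrow> orthogonal C m (fob G e)"
  shows "is_iso E (far F m)"
proof -
  note F = universal_unitD(1)[OF u] and G = universal_unitD(2)[OF u]
  have C: "category C" and E: "category E" using fun_cat[OF F] by auto
  have a: "a \<in> Obj C" and b: "b \<in> Obj C" using cat_obj[OF C m] by auto
  note Fm = fun_ar[OF F m] and Fa = fun_ob[OF F a] and Fb = fun_ob[OF F b]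
  note GFm = fun_ar[OF G Fm]
  note ea = universal_unitD(3)[OF u a] and eb = universal_unitD(3)[OF u b]
  note nat = universal_unitD(4)[OF u m]
  obtain g where g: "g \<in> hom C b (fob G (fob F a))" "Cmp C g m = \<eta> a"
    using o[OF Fa] ea unfolding orthogonal_iff[OF m] by blast
  obtain n where n: "n \<in> hom E (fob F b) (fob F a)" "Cmp C (far G n) (\<eta> b) = g"
    using universal_unitD(5)[OF u b Fa g(1)] by blast
  note Gn = fun_ar[OF G n(1)]
  have "Cmp C (far G (Cmp E n (far F m))) (\<eta> a) = Cmp C (far G n) (Cmp C (\<eta> b) m)"
    using fun_cmp[OF G Fm n(1)] cat_assoc[OF C ea GFm Gn] nat by simp
  also have "\<dots> = \<eta> a" using cat_assoc[OF C m eb Gn] n(2) g(2) by simp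
  also have "\<dots> = Cmp C (far G (Ide E (fob F a))) (\<eta> a)"
    using fun_id[OF G Fa] cat_idl[OF C ea] by simp
  finally have 1: "Cmp E n (far F m) = Ide E (fob F a)"
    using universal_unit_eq[OF u a Fa cat_cmp[OF E Fm n(1)] cat_ide[OF E Fa]] by simp
  have "Cmp C (Cmp C (far G (far F m)) g) m = Cmp C (\<eta> b) m"
    using cat_assoc[OF C m g(1) GFm] g(2) nat by simp
  then have "Cmp C (far G (far F m)) g = \<eta> b"
    using orthogonal_eq[OF C o[OF Fb] m cat_cmp[OF C g(1) GFm] eb] by simp
  then have "Cmp C (far G (Cmp E (far F m) n)) (\<eta> b) = Cmp C (far G (Ide E (fob F b))) (\<eta> b)"
    using fun_cmp[OF G n(1) Fm] cat_assoc[OF C eb Gn GFm] n(2) fun_id[OF G Fb] cat_idl[OF C eb] by simp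
  then have 2: "Cmp E (far F m) n = Ide E (fob F b)"
    using universal_unit_eq[OF u b Fb cat_cmp[OF E n(1) Fm] cat_ide[OF E Fb]] by simp
  show ?thesis using is_isoI[OF Fm n(1) 1 2] .
qed

lemma functor_on_arr:
  assumes F: "is_functor C D F" and u: "u \<in> Arr C"
  shows "far F u \<in> hom D (fob F (Dom C u)) (fob F (Cod C u))" "Dom C u \<in> Obj C" "Cod C u \<in> Obj C"
proof -
  have h: "u \<in> hom C (Dom C u) (Cod C u)" using u by (simp add: hom_iff)
  show "far F u \<in> hom D (fob F (Dom C u)) (fob F (Cod C u))" using fun_ar[OF F h] .
  show "Dom C u \<in> Obj C" "Cod C u \<in> Obj C" using cat_obj[OF fun_cat(1)[OF F] h] .
qed

subsection \<open>Essential images of fully faithful functors\<close>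

definition ess_image where
  "ess_image E C G = {x \<in> Obj C. \<exists>e\<in>Obj E. isomorphic C (fob G e) x}"

lemma ff_inj:
  assumes "fully_faithful E C G" "a \<in> Obj E" "b \<in> Obj E" "k \<in> hom E a b" "k' \<in> hom E a b"
    "far G k = far G k'"
  shows "k = k'"
proof -
  have "inj_on (far G) (hom E a b)"
    using assms(1,2,3) unfolding fully_faithful_def by (blast dest: bij_betw_imp_inj_on)
  then show ?thesis using assms(4-6) by (blast dest: inj_onD)
qed

lemma ff_pre:
  assumes "fully_faithful E C G" "a \<in> Obj E" "b \<in> Obj E" "h \<in> hom C (fob G a) (fob G b)"
  obtains k where "k \<in> hom E a b" "far G k = h"
proof -
  have "far G ` hom E a b = hom C (fob G a) (fob G b)"
    using assms(1,2,3) unfolding fully_faithful_def by (blast dest: bij_betw_imp_surj_on)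
  with assms(4) have "h \<in> far G ` hom E a b" by simp
  then show ?thesis by (rule imageE) (auto intro: that)
qed

lemma ff_reflects_iso:
  assumes ff: "fully_faithful E C G" and G: "is_functor E C G" and k: "k \<in> hom E a b"
    and i: "is_iso C (far G k)"
  shows "is_iso E k"
proof -
  have E: "category E" using fun_cat[OF G] by blast
  have ab: "a \<in> Obj E" "b \<in> Obj E" using cat_obj[OF E k] by auto
  obtain g where g: "g \<in> hom C (fob G b) (fob G a)" "Cmp C g (far G k) = Ide C (fob G a)"
    "Cmp C (far G k) g = Ide C (fob G b)" using is_isoE[OF i fun_ar[OF G k]] by metis
  obtain l where l: "l \<in> hom E b a" "far G l = g" using ff_pre[OF ff ab(2,1) g(1)] .
  show ?thesis
  proof (rule is_isoI[OF k l(1)])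
    show "Cmp E l k = Ide E a"
      using ff_inj[OF ff ab(1) ab(1) cat_cmp[OF E k l(1)] cat_ide[OF E ab(1)]]
        fun_cmp[OF G k l(1)] fun_id[OF G ab(1)] g l by simp
    show "Cmp E k l = Ide E b"
      using ff_inj[OF ff ab(2) ab(2) cat_cmp[OF E l(1) k] cat_ide[OF E ab(2)]]
        fun_cmp[OF G l(1) k] fun_id[OF G ab(2)] g l by simp
  qed
qed

lemma fob_in_ess_image:
  assumes G: "is_functor E C G" and e: "e \<in> Obj E"
  shows "fob G e \<in> ess_image E C G"
proof -
  have C: "category C" using fun_cat[OF G] by blast
  note i = cat_ide[OF C fun_ob[OF G e]]
  have "is_iso C (Ide C (fob G e))" using is_isoI[OF i i] cat_idl[OF C i] by simp
  then show ?thesis using e i fun_ob[OF G e] unfolding ess_image_def isomorphic_def by blast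
qed

lemma ess_imageE:
  assumes "x \<in> ess_image E C G"
  obtains e i j where "e \<in> Obj E" "i \<in> hom C (fob G e) x" "j \<in> hom C x (fob G e)"
    "Cmp C j i = Ide C (fob G e)" "Cmp C i j = Ide C x"
proof -
  obtain e i where e: "e \<in> Obj E" "i \<in> hom C (fob G e) x" "is_iso C i"
    using assms unfolding ess_image_def isomorphic_def by blast
  then show ?thesis using that is_isoE[OF e(3,2)] by metis
qed

text \<open>A quasi-inverse chooses for every object of the image a preimage together with an
  isomorphism, and transports arrows by conjugating with these isomorphisms and lifting along the
  fully faithful functor.\<close>

lemma ff_equivalence_ess_image:
  assumes ff: "fully_faithful E C G" and G: "is_functor E C G"
  shows "is_equivalence E (full_sub C (ess_image E C G)) G"
proof -
  let ?D = "ess_image E C G"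
  let ?C = "full_sub C ?D"
  have E: "category E" and C: "category C" using fun_cat[OF G] by auto
  have C': "category ?C" using category_full_sub[OF C] .
  have G': "is_functor E ?C G" using is_functor_into_full_sub[OF G fob_in_ess_image[OF G]] .
  have "\<forall>x\<in>?D. \<exists>e i j. e \<in> Obj E \<and> i \<in> hom C (fob G e) x \<and> j \<in> hom C x (fob G e) \<and>
      Cmp C j i = Ide C (fob G e) \<and> Cmp C i j = Ide C x"
    using ess_imageE by metis
  then obtain e i j where eij: "\<forall>x\<in>?D. e x \<in> Obj E \<and> i x \<in> hom C (fob G (e x)) x \<and>
      j x \<in> hom C x (fob G (e x)) \<and> Cmp C (j x) (i x) = Ide C (fob G (e x)) \<and> Cmp C (i x) (j x) = Ide C x"
    by metis
  have e: "e x \<in> Obj E" and i: "i x \<in> hom C (fob G (e x)) x" and j: "j x \<in> hom C x (fob G (e x))"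
    and ji: "Cmp C (j x) (i x) = Ide C (fob G (e x))" and ij: "Cmp C (i x) (j x) = Ide C x"
    if "x \<in> ?D" for x using eij that by blast+
  define K where "K = \<lparr>fob = e, far = (\<lambda>f. SOME k. k \<in> hom E (e (Dom C f)) (e (Cod C f)) \<and>
      far G k = Cmp C (j (Cod C f)) (Cmp C f (i (Dom C f))))\<rparr>"
  have [simp]: "fob K x = e x" for x by (simp add: K_def)
  have K: "far K f \<in> hom E (e x) (e y)" "far G (far K f) = Cmp C (j y) (Cmp C f (i x))"
    if f: "f \<in> hom ?C x y" for f x y
  proof -
    have x: "x \<in> ?D" and y: "y \<in> ?D" and f': "f \<in> hom C x y" using f by (auto simp: hom_full_sub)
    have "Cmp C (j y) (Cmp C f (i x)) \<in> hom C (fob G (e x)) (fob G (e y))"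
      using cat_cmp[OF C cat_cmp[OF C i[OF x] f'] j[OF y]] .
    then obtain k where "k \<in> hom E (e x) (e y)" "far G k = Cmp C (j y) (Cmp C f (i x))"
      using ff_pre[OF ff e[OF x] e[OF y]] by metis
    then have "\<exists>k. k \<in> hom E (e x) (e y) \<and> far G k = Cmp C (j y) (Cmp C f (i x))" by blast
    from someI_ex[OF this] show "far K f \<in> hom E (e x) (e y)"
      "far G (far K f) = Cmp C (j y) (Cmp C f (i x))"
      using f' by (simp_all add: K_def hom_D)
  qed
  \<comment> \<open>The chosen isomorphisms and their inverses are natural by construction of
    \<open>K\<close>; functoriality of \<open>K\<close> and both natural isomorphisms are derived
    from these two facts.\<close>
  have inat: "Cmp C (i y) (far G (far K f)) = Cmp C f (i x)" if f: "f \<in> hom ?C x y" for f x y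
  proof -
    have x: "x \<in> ?D" and y: "y \<in> ?D" and f': "f \<in> hom C x y" using f by (auto simp: hom_full_sub)
    have fi: "Cmp C f (i x) \<in> hom C (fob G (e x)) y" using cat_cmp[OF C i[OF x] f'] .
    show ?thesis
      using K(2)[OF f] cat_assoc[OF C fi j[OF y] i[OF y]] ij[OF y] cat_idl[OF C fi] by simp
  qed
  have jnat: "Cmp C (far G (far K f)) (j x) = Cmp C (j y) f" if f: "f \<in> hom ?C x y" for f x y
  proof -
    have x: "x \<in> ?D" and y: "y \<in> ?D" and f': "f \<in> hom C x y" using f by (auto simp: hom_full_sub)
    have fi: "Cmp C f (i x) \<in> hom C (fob G (e x)) y" using cat_cmp[OF C i[OF x] f'] .
    have "Cmp C (far G (far K f)) (j x) = Cmp C (j y) (Cmp C (Cmp C f (i x)) (j x))"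
      using K(2)[OF f] cat_assoc[OF C j[OF x] fi j[OF y]] by simp
    also have "Cmp C (Cmp C f (i x)) (j x) = f"
      using cat_assoc[OF C j[OF x] i[OF x] f'] ij[OF x] cat_idr[OF C f'] by simp
    finally show ?thesis .
  qed
  have Kf: "is_functor ?C E K"
  proof (rule is_functorI[OF C' E])
    fix x assume "x \<in> Obj ?C" then show "fob K x \<in> Obj E" using e by simp
  next
    fix x y f assume "f \<in> hom ?C x y" then show "far K f \<in> hom E (fob K x) (fob K y)" using K by simp
  next
    fix x assume x: "x \<in> Obj ?C"
    then have x': "x \<in> ?D" by simp
    note I = cat_ide[OF C' x]
    have "far G (far K (Ide ?C x)) = far G (Ide E (e x))"
      using K(2)[OF I] cat_idl[OF C i[OF x']] ji[OF x'] fun_id[OF G e[OF x']] by simp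
    then show "far K (Ide ?C x) = Ide E (fob K x)"
      using ff_inj[OF ff e[OF x'] e[OF x'] K(1)[OF I] cat_ide[OF E e[OF x']]] by simp
  next
    fix x y z f g assume f: "f \<in> hom ?C x y" and g: "g \<in> hom ?C y z"
    have x: "x \<in> ?D" and y: "y \<in> ?D" and z: "z \<in> ?D" and f': "f \<in> hom C x y" and g': "g \<in> hom C y z"
      using f g by (auto simp: hom_full_sub)
    note gf = cat_cmp[OF C' f g]
    note Gf = fun_ar[OF G K(1)[OF f]] and Gg = fun_ar[OF G K(1)[OF g]]
    have fi: "Cmp C f (i x) \<in> hom C (fob G (e x)) y" using cat_cmp[OF C i[OF x] f'] .
    have "far G (Cmp E (far K g) (far K f)) = Cmp C (far G (far K g)) (Cmp C (j y) (Cmp C f (i x)))"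
      using fun_cmp[OF G K(1)[OF f] K(1)[OF g]] K(2)[OF f] by simp
    also have "\<dots> = Cmp C (Cmp C (j z) g) (Cmp C f (i x))"
      using cat_assoc[OF C fi j[OF y] Gg] jnat[OF g] by simp
    also have "\<dots> = Cmp C (j z) (Cmp C (Cmp C g f) (i x))"
      using cat_assoc[OF C fi g' j[OF z]] cat_assoc[OF C i[OF x] f' g'] by simp
    also have "\<dots> = far G (far K (Cmp ?C g f))" using K(2)[OF gf] by simp
    finally show "far K (Cmp ?C g f) = Cmp E (far K g) (far K f)"
      using ff_inj[OF ff e[OF x] e[OF z] K(1)[OF gf] cat_cmp[OF E K(1)[OF f] K(1)[OF g]]] by simp
  qed
  have 1: "nat_isomorphic ?C ?C (comp_func G K) id_func"
    unfolding nat_isomorphic_def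
  proof (intro exI[of _ i] conjI ballI)
    show "nat_trans ?C ?C (comp_func G K) id_func i"
      unfolding nat_trans_def
    proof (intro conjI ballI allI)
      show "is_functor ?C ?C (comp_func G K)" using is_functor_comp[OF Kf G'] .
      show "is_functor ?C ?C id_func" using is_functor_id[OF C'] .
      fix a assume "a \<in> Obj ?C"
      then show "i a \<in> hom ?C (fob (comp_func G K) a) (fob id_func a)"
        using i e fob_in_ess_image[OF G] by (simp add: hom_full_sub)
    next
      fix a b f assume "f \<in> hom ?C a b"
      then show "Cmp ?C (i b) (far (comp_func G K) f) = Cmp ?C (far id_func f) (i a)"
        using inat by simp
    qed
    fix a assume "a \<in> Obj ?C"
    then have a: "a \<in> ?D" by simp
    have "i a \<in> hom ?C (fob G (e a)) a" "j a \<in> hom ?C a (fob G (e a))"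
      using a i j e fob_in_ess_image[OF G] by (auto simp: hom_full_sub)
    then show "is_iso ?C (i a)" using is_isoI[of "i a" ?C] ij[OF a] ji[OF a] by fastforce
  qed
  have GE: "fob G a \<in> ?D" if "a \<in> Obj E" for a using fob_in_ess_image[OF G that] .
  \<comment> \<open>The component at \<open>a\<close> is the preimage of the chosen isomorphism at
    \<open>fob G a\<close>; it is invertible because full faithfulness reflects
    isomorphisms.\<close>
  have "\<forall>a\<in>Obj E. \<exists>t. t \<in> hom E a (e (fob G a)) \<and> far G t = j (fob G a)"
    using ff_pre[OF ff _ e j] GE by metis
  then obtain t where t: "\<And>a. a \<in> Obj E \<Longrightarrow> t a \<in> hom E a (e (fob G a))"
    "\<And>a. a \<in> Obj E \<Longrightarrow> far G (t a) = j (fob G a)" by metis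
  have 2: "nat_isomorphic E E id_func (comp_func K G)"
    unfolding nat_isomorphic_def
  proof (intro exI[of _ t] conjI ballI)
    show "nat_trans E E id_func (comp_func K G) t"
      unfolding nat_trans_def
    proof (intro conjI ballI allI)
      show "is_functor E E (comp_func K G)" using is_functor_comp[OF G' Kf] .
      show "is_functor E E id_func" using is_functor_id[OF E] .
      fix a assume "a \<in> Obj E"
      then show "t a \<in> hom E (fob id_func a) (fob (comp_func K G) a)" using t by simp
    next
      fix a b f assume f: "f \<in> hom E a b"
      have ab: "a \<in> Obj E" "b \<in> Obj E" using cat_obj[OF E f] by auto
      note Gf = fun_ar[OF G' f]
      have "far G (Cmp E (t b) f) = Cmp C (j (fob G b)) (far G f)"
        using fun_cmp[OF G f t(1)[OF ab(2)]] t(2)[OF ab(2)] by simp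
      also have "\<dots> = far G (Cmp E (far K (far G f)) (t a))"
        using jnat[OF Gf] fun_cmp[OF G t(1)[OF ab(1)] K(1)[OF Gf]] t(2)[OF ab(1)] by simp
      finally show "Cmp E (t b) (far id_func f) = Cmp E (far (comp_func K G) f) (t a)"
        using ff_inj[OF ff ab(1) e[OF GE[OF ab(2)]] cat_cmp[OF E f t(1)[OF ab(2)]]
            cat_cmp[OF E t(1)[OF ab(1)] K(1)[OF Gf]]] by simp
    qed
    fix a assume a: "a \<in> Obj E"
    note x = GE[OF a]
    have "is_iso C (far G (t a))" using is_isoI[OF j[OF x] i[OF x] ij[OF x] ji[OF x]] t(2)[OF a] by simp
    then show "is_iso E (t a)" using ff_reflects_iso[OF ff G t(1)[OF a]] by simp
  qed
  show ?thesis unfolding is_equivalence_def using G' Kf 1 2 by blast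
qed

text \<open>A cone with apex in the image can be moved along an isomorphism to an apex of the form
  \<open>fob G e\<close>; its legs then lift to a cone in \<open>E\<close>, where the limit is
  known.\<close>

lemma limit_in_ess_image:
  assumes ff: "fully_faithful E C G" and G: "is_functor E C G" and X: "is_functor I E X"
    and lim: "is_limit I E X l \<pi>"
  shows "is_limit I (full_sub C (ess_image E C G)) (comp_func G X) (fob G l) (\<lambda>i. far G (\<pi> i))"
proof -
  let ?D = "ess_image E C G"
  let ?C = "full_sub C ?D"
  have E: "category E" and C: "category C" and I: "category I" using fun_cat[OF G] fun_cat[OF X] by auto
  have l: "l \<in> Obj E" and \<pi>: "\<And>i. i \<in> Obj I \<Longrightarrow> \<pi> i \<in> hom E l (fob X i)"
    and comm: "\<And>u. u \<in> Arr I \<Longrightarrow> Cmp E (far X u) (\<pi> (Dom I u)) = \<pi> (Cod I u)"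
    using lim unfolding is_limit_def is_cone_def by blast+
  have X': "far X u \<in> hom E (fob X (Dom I u)) (fob X (Cod I u))" "Dom I u \<in> Obj I" "Cod I u \<in> Obj I"
    if "u \<in> Arr I" for u
    using functor_on_arr[OF X that] .
  have "is_cone I ?C (comp_func G X) (fob G l) (\<lambda>i. far G (\<pi> i))"
    unfolding is_cone_def
  proof (intro conjI ballI)
    show "fob G l \<in> Obj ?C" using fob_in_ess_image[OF G l] fun_ob[OF G l] by simp
    fix i assume "i \<in> Obj I"
    then show "far G (\<pi> i) \<in> hom ?C (fob G l) (fob (comp_func G X) i)"
      using fun_ar[OF G \<pi>] fob_in_ess_image[OF G] l fun_ob[OF X] by (simp add: hom_full_sub)
  next
    fix u assume u: "u \<in> Arr I"
    show "Cmp ?C (far (comp_func G X) u) (far G (\<pi> (Dom I u))) = far G (\<pi> (Cod I u))"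
      using fun_cmp[OF G \<pi>[OF X'(2)[OF u]] X'(1)[OF u]] comm[OF u] by simp
  qed
  moreover have "\<exists>!h. h \<in> hom ?C k (fob G l) \<and> (\<forall>i\<in>Obj I. Cmp ?C (far G (\<pi> i)) h = \<kappa> i)"
    if "is_cone I ?C (comp_func G X) k \<kappa>" for k \<kappa>
  proof -
    have k: "k \<in> ?D" and \<kappa>: "\<And>i. i \<in> Obj I \<Longrightarrow> \<kappa> i \<in> hom C k (fob G (fob X i))"
      and \<kappa>c: "\<And>u. u \<in> Arr I \<Longrightarrow> Cmp C (far G (far X u)) (\<kappa> (Dom I u)) = \<kappa> (Cod I u)"
      using that unfolding is_cone_def by (auto simp: hom_full_sub)
    obtain e i j where e: "e \<in> Obj E" and i: "i \<in> hom C (fob G e) k" and j: "j \<in> hom C k (fob G e)"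
      and ji: "Cmp C j i = Ide C (fob G e)" and ij: "Cmp C i j = Ide C k" using ess_imageE[OF k] .
    have "\<forall>n\<in>Obj I. \<exists>t. t \<in> hom E e (fob X n) \<and> far G t = Cmp C (\<kappa> n) i"
    proof
      fix n assume n: "n \<in> Obj I"
      show "\<exists>t. t \<in> hom E e (fob X n) \<and> far G t = Cmp C (\<kappa> n) i"
        using ff_pre[OF ff e fun_ob[OF X n] cat_cmp[OF C i \<kappa>[OF n]]] by metis
    qed
    then obtain t where t: "\<And>n. n \<in> Obj I \<Longrightarrow> t n \<in> hom E e (fob X n)"
      "\<And>n. n \<in> Obj I \<Longrightarrow> far G (t n) = Cmp C (\<kappa> n) i" by metis
    have "is_cone I E X e t"
      unfolding is_cone_def
    proof (intro conjI ballI e t(1))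
      fix u assume u: "u \<in> Arr I"
      note X'' = X'[OF u]
      note c = cat_cmp[OF E t(1)[OF X''(2)] X''(1)]
      have "far G (Cmp E (far X u) (t (Dom I u))) = Cmp C (far G (far X u)) (Cmp C (\<kappa> (Dom I u)) i)"
        using fun_cmp[OF G t(1)[OF X''(2)] X''(1)] t(2)[OF X''(2)] by simp
      also have "\<dots> = far G (t (Cod I u))"
        using cat_assoc[OF C i \<kappa>[OF X''(2)] fun_ar[OF G X''(1)]] \<kappa>c[OF u] t(2)[OF X''(3)] by simp
      finally show "Cmp E (far X u) (t (Dom I u)) = t (Cod I u)"
        using ff_inj[OF ff e fun_ob[OF X X''(3)] c t(1)[OF X''(3)]] by blast
    qed
    then obtain h where h: "h \<in> hom E e l" "\<And>n. n \<in> Obj I \<Longrightarrow> Cmp E (\<pi> n) h = t n"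
      and hu: "\<And>h'. h' \<in> hom E e l \<Longrightarrow> (\<And>n. n \<in> Obj I \<Longrightarrow> Cmp E (\<pi> n) h' = t n) \<Longrightarrow> h' = h"
      using lim unfolding is_limit_def by metis
    note Gh = fun_ar[OF G h(1)]
    show ?thesis
    proof (rule ex1I[of _ "Cmp C (far G h) j"], intro conjI ballI)
      show "Cmp C (far G h) j \<in> hom ?C k (fob G l)"
        using cat_cmp[OF C j Gh] k fob_in_ess_image[OF G l] by (simp add: hom_full_sub)
      fix n assume n: "n \<in> Obj I"
      have "Cmp C (far G (\<pi> n)) (Cmp C (far G h) j) = Cmp C (far G (t n)) j"
        using cat_assoc[OF C j Gh fun_ar[OF G \<pi>[OF n]]] fun_cmp[OF G h(1) \<pi>[OF n]] h(2)[OF n] by simp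
      also have "\<dots> = \<kappa> n"
        using t(2)[OF n] cat_assoc[OF C j i \<kappa>[OF n]] ij cat_idr[OF C \<kappa>[OF n]] by simp
      finally show "Cmp ?C (far G (\<pi> n)) (Cmp C (far G h) j) = \<kappa> n" by simp
    next
      fix h' assume h': "h' \<in> hom ?C k (fob G l) \<and> (\<forall>n\<in>Obj I. Cmp ?C (far G (\<pi> n)) h' = \<kappa> n)"
      have h'k: "h' \<in> hom C k (fob G l)" using h' by (simp add: hom_full_sub)
      obtain g where g: "g \<in> hom E e l" "far G g = Cmp C h' i"
        using ff_pre[OF ff e l cat_cmp[OF C i h'k]] .
      have "g = h"
      proof (rule hu[OF g(1)])
        fix n assume n: "n \<in> Obj I"
        have "far G (Cmp E (\<pi> n) g) = Cmp C (far G (\<pi> n)) (Cmp C h' i)"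
          using fun_cmp[OF G g(1) \<pi>[OF n]] g(2) by simp
        also have "\<dots> = far G (t n)"
          using cat_assoc[OF C i h'k fun_ar[OF G \<pi>[OF n]]] h' n t(2)[OF n] by simp
        finally show "Cmp E (\<pi> n) g = t n"
          using ff_inj[OF ff e fun_ob[OF X n] cat_cmp[OF E g(1) \<pi>[OF n]] t(1)[OF n]] by blast
      qed
      then show "h' = Cmp C (far G h) j"
        using g(2) cat_assoc[OF C j i h'k] ij cat_idr[OF C h'k] by simp
    qed
  qed
  ultimately show ?thesis unfolding is_limit_def by blast
qed

text \<open>Passes from an arbitrary embedding to the replete subcategory by which
  \<open>subtopos\<close> represents it. The reflector is the composite of inverse and direct image,
  and the unit is unchanged.\<close>

lemma geometric_embedding_ess_image:
  assumes "geometric_embedding E C F G"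
  shows "geometric_embedding (full_sub C (ess_image E C G)) C (comp_func G F) id_func"
proof -
  let ?D = "ess_image E C G"
  let ?C = "full_sub C ?D"
  have ff: "fully_faithful E C G" and pr: "preserves_finite_limits C E F"
    and adj: "left_adjoint C E F G" using assms unfolding geometric_embedding_def by auto
  obtain \<eta> where u: "universal_unit C E F G \<eta>" using left_adjoint_imp_universal_unit[OF adj] .
  note F = universal_unitD(1)[OF u] and G = universal_unitD(2)[OF u]
  have C: "category C" and E: "category E" using fun_cat[OF F] by auto
  have G': "is_functor E ?C G" using is_functor_into_full_sub[OF G fob_in_ess_image[OF G]] .
  have GF: "is_functor C ?C (comp_func G F)" using is_functor_comp[OF F G'] .
  have "universal_unit C ?C (comp_func G F) id_func \<eta>"
    unfolding universal_unit_def
  proof (intro conjI GF is_functor_inclusion[OF C] ballI allI)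
    fix c assume "c \<in> Obj C"
    then show "\<eta> c \<in> hom C c (fob id_func (fob (comp_func G F) c))"
      using universal_unitD(3)[OF u] by simp
  next
    fix c c' v assume "v \<in> hom C c c'"
    then show "Cmp C (\<eta> c') v = Cmp C (far id_func (far (comp_func G F) v)) (\<eta> c)"
      using universal_unitD(4)[OF u] by simp
  next
    fix c d h assume c: "c \<in> Obj C" and "d \<in> Obj ?C" and "h \<in> hom C c (fob id_func d)"
    then have d: "d \<in> ?D" and h: "h \<in> hom C c d" by auto
    obtain e i j where e: "e \<in> Obj E" and i: "i \<in> hom C (fob G e) d" and j: "j \<in> hom C d (fob G e)"
      and ji: "Cmp C j i = Ide C (fob G e)" and ij: "Cmp C i j = Ide C d" using ess_imageE[OF d] .
    note \<eta> = universal_unitD(3)[OF u c]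
    have GFc: "fob G (fob F c) \<in> ?D" using fob_in_ess_image[OF G fun_ob[OF F c]] .
    obtain k where k: "k \<in> hom E (fob F c) e" "Cmp C (far G k) (\<eta> c) = Cmp C j h"
      using universal_unitD(5)[OF u c e cat_cmp[OF C h j]] by blast
    note Gk = fun_ar[OF G k(1)]
    have "\<exists>!k. k \<in> hom ?C (fob G (fob F c)) d \<and> Cmp C k (\<eta> c) = h"
    proof (rule ex1I[of _ "Cmp C i (far G k)"])
      have "Cmp C (Cmp C i (far G k)) (\<eta> c) = h"
        using cat_assoc[OF C \<eta> Gk i] k(2) cat_assoc[OF C h j i] ij cat_idl[OF C h] by simp
      then show "Cmp C i (far G k) \<in> hom ?C (fob G (fob F c)) d \<and> Cmp C (Cmp C i (far G k)) (\<eta> c) = h"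
        using cat_cmp[OF C Gk i] d GFc by (simp add: hom_full_sub)
    next
      fix k' assume k': "k' \<in> hom ?C (fob G (fob F c)) d \<and> Cmp C k' (\<eta> c) = h"
      then have k'h: "k' \<in> hom C (fob G (fob F c)) d" by (simp add: hom_full_sub)
      obtain g where g: "g \<in> hom E (fob F c) e" "far G g = Cmp C j k'"
        using ff_pre[OF ff fun_ob[OF F c] e cat_cmp[OF C k'h j]] .
      have "Cmp C (far G g) (\<eta> c) = Cmp C j h"
        using g(2) cat_assoc[OF C \<eta> k'h j] k' by simp
      then have "g = k" using universal_unit_eq[OF u c e g(1) k(1)] k(2) by simp
      then show "k' = Cmp C i (far G k)"
        using g(2) cat_assoc[OF C k'h j i] ij cat_idl[OF C k'h] by simp
    qed
    then show "\<exists>!k. k \<in> hom ?C (fob (comp_func G F) c) d \<and> Cmp C (far id_func k) (\<eta> c) = h" by simp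
  qed
  then have "left_adjoint C ?C (comp_func G F) id_func" by (rule universal_unit_imp_left_adjoint)
  moreover have "preserves_finite_limits C ?C (comp_func G F)"
    unfolding preserves_finite_limits_def
  proof (intro allI impI)
    fix I :: "(nat, nat) cat" and X l \<pi>
    assume h: "finite (Arr I) \<and> is_functor I C X \<and> is_limit I C X l \<pi>"
    then have "is_limit I E (comp_func F X) (fob F l) (\<lambda>i. far F (\<pi> i))"
      using pr unfolding preserves_finite_limits_def by blast
    from limit_in_ess_image[OF ff G is_functor_comp[OF conjunct1[OF conjunct2[OF h]] F] this]
    show "is_limit I ?C (comp_func (comp_func G F) X) (fob (comp_func G F) l)
        (\<lambda>i. far (comp_func G F) (\<pi> i))"
      by (simp add: comp_func_assoc)
  qed
  moreover have "fully_faithful ?C C id_func"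
    unfolding fully_faithful_def by (auto simp: hom_full_sub bij_betw_def inj_on_def)
  ultimately show ?thesis unfolding geometric_embedding_def by blast
qed

lemma ess_image_replete:
  assumes "category C" "a \<in> ess_image E C G" "b \<in> Obj C" "isomorphic C a b"
  shows "b \<in> ess_image E C G"
proof -
  obtain e u where e: "e \<in> Obj E" and u: "u \<in> hom C (fob G e) a" "is_iso C u"
    using assms(2) unfolding ess_image_def isomorphic_def by blast
  obtain v where v: "v \<in> hom C a b" "is_iso C v" using assms(4) unfolding isomorphic_def by blast
  obtain u' where u': "u' \<in> hom C a (fob G e)" "Cmp C u' u = Ide C (fob G e)" "Cmp C u u' = Ide C a"
    using is_isoE[OF u(2,1)] by metis
  obtain v' where v': "v' \<in> hom C b a" "Cmp C v' v = Ide C a" "Cmp C v v' = Ide C b"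
    using is_isoE[OF v(2,1)] by metis
  note C = assms(1)
  have vu: "Cmp C v u \<in> hom C (fob G e) b" "Cmp C u' v' \<in> hom C b (fob G e)"
    using cat_cmp[OF C] u v u' v' by blast+
  have "is_iso C (Cmp C v u)"
  proof (rule is_isoI[OF vu])
    show "Cmp C (Cmp C u' v') (Cmp C v u) = Ide C (fob G e)"
      using cat_assoc[OF C vu(1) v'(1) u'(1)] cat_assoc[OF C u(1) v(1) v'(1)] v'(2) u'(2)
        cat_idl[OF C u(1)] by simp
    show "Cmp C (Cmp C v u) (Cmp C u' v') = Ide C b"
      using cat_assoc[OF C vu(2) u(1) v(1)] cat_assoc[OF C v'(1) u'(1) u(1)] u'(3) v'(3)
        cat_idl[OF C v'(1)] by simp
  qed
  then show ?thesis using e vu(1) assms(3) unfolding ess_image_def isomorphic_def by blast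
qed

lemma subtopos_ess_image:
  assumes "geometric_embedding E C F G"
  shows "subtopos C (ess_image E C G)"
proof -
  have "category C"
    using assms fun_cat unfolding geometric_embedding_def left_adjoint_def by metis
  then show ?thesis
    unfolding subtopos_def
    using geometric_embedding_ess_image[OF assms] ess_image_replete[of C _ E G]
    by (auto simp: ess_image_def)
qed

subsection \<open>Left exact reflections\<close>

text \<open>Two parallel arrows \<open>A \<rightarrow> w\<close> and an arrow \<open>B \<rightarrow> w\<close>: limits of this shape comprise both
  equalizers and pullbacks.\<close>

definition fork_shape :: "(nat, nat) cat" where
  "fork_shape = \<lparr>Obj = {0, 1, 2}, Arr = {0, 1, 2, 3, 4, 5},
     Dom = (\<lambda>n. if n < 3 then n else if n = 5 then 1 else 0),
     Cod = (\<lambda>n. if n < 3 then n else 2), Ide = (\<lambda>n. n),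
     Cmp = (\<lambda>g f. if f < 3 then g else f)\<rparr>"

definition fork_diagram where
  "fork_diagram C A B w a b c = \<lparr>fob = (\<lambda>n::nat. if n = 0 then A else if n = 1 then B else w),
     far = (\<lambda>n::nat. if n = 0 then Ide C A else if n = 1 then Ide C B else if n = 2 then Ide C w
        else if n = 3 then a else if n = 4 then b else c)\<rparr>"

lemma fork_shape_simps [simp]:
  "Obj fork_shape = {0, 1, 2}" "Arr fork_shape = {0, 1, 2, 3, 4, 5}"
  "Dom fork_shape n = (if n < 3 then n else if n = 5 then 1 else 0)"
  "Cod fork_shape n = (if n < 3 then n else 2)" "Ide fork_shape n = n"
  "Cmp fork_shape m n = (if n < 3 then m else n)"
  by (simp_all add: fork_shape_def)

lemma category_fork_shape: "category fork_shape"
  unfolding category_def hom_def by auto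

lemma fork_shape_hom_cases:
  assumes "f \<in> hom fork_shape x y"
  obtains "f = x" "x = y" "x \<in> {0, 1, 2}" | "f \<in> {3, 4}" "x = 0" "y = 2" | "f = 5" "x = 1" "y = 2"
  using assms unfolding hom_def by auto

lemma fork_diagram_simps [simp]:
  "fob (fork_diagram C A B w a b c) n = (if n = 0 then A else if n = 1 then B else w)"
  "far (fork_diagram C A B w a b c) n = (if n = 0 then Ide C A else if n = 1 then Ide C B else
     if n = 2 then Ide C w else if n = 3 then a else if n = 4 then b else c)"
  by (simp_all add: fork_diagram_def)

lemma is_functor_fork_diagram:
  assumes C: "category C" and abc: "a \<in> hom C A w" "b \<in> hom C A w" "c \<in> hom C B w"
  shows "is_functor fork_shape C (fork_diagram C A B w a b c)" (is "is_functor _ _ ?X")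
proof -
  have o: "A \<in> Obj C" "B \<in> Obj C" "w \<in> Obj C" using cat_obj[OF C] abc by blast+
  have ar: "far ?X f \<in> hom C (fob ?X x) (fob ?X y)" if "f \<in> hom fork_shape x y" for f x y
    using that by (cases rule: fork_shape_hom_cases) (use cat_ide[OF C] o abc in auto)
  show ?thesis
  proof (rule is_functorI[OF category_fork_shape C])
    fix x y f assume "f \<in> hom fork_shape x y"
    then show "far ?X f \<in> hom C (fob ?X x) (fob ?X y)" by (rule ar)
  next
    fix x y z f g assume f: "f \<in> hom fork_shape x y" and g: "g \<in> hom fork_shape y z"
    note gX = ar[OF g] and fX = ar[OF f]
    show "far ?X (Cmp fork_shape g f) = Cmp C (far ?X g) (far ?X f)"
    proof (cases "f < 3")
      case True
      with f have fx: "f = x" "x = y" "x \<in> {0, 1, 2}" by (auto elim!: fork_shape_hom_cases)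
      then have "far ?X f = Ide C (fob ?X y)" by auto
      then show ?thesis using True cat_idr[OF C gX] by simp
    next
      case False
      with f have "y = 2" by (auto elim!: fork_shape_hom_cases)
      with g have gz: "g = 2" "z = 2" by (auto elim!: fork_shape_hom_cases)
      then have "far ?X g = Ide C (fob ?X y)" using \<open>y = 2\<close> by simp
      then show ?thesis using False cat_idl[OF C fX] by simp
    qed
  qed (use o in auto)
qed

lemma preserves_finite_limitsD:
  fixes I :: "(nat, nat) cat"
  assumes "preserves_finite_limits C D F" "finite (Arr I)" "is_functor I C X" "is_limit I C X l \<pi>"
  shows "is_limit I D (comp_func F X) (fob F l) (\<lambda>i. far F (\<pi> i))"
  using assms unfolding preserves_finite_limits_def by blast

text \<open>Once \<open>far F a\<close> and \<open>far F b\<close> coincide and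
  \<open>far F c\<close> has an inverse, the identity of \<open>fob F A\<close> completes to a cone
  on the image diagram. The induced arrow into the limit is inverse to
  \<open>far F p\<close>.\<close>

lemma lex_inverts_pullback:
  assumes F: "is_functor C E F" and lex: "preserves_finite_limits C E F"
    and a: "a \<in> hom C A w" and b: "b \<in> hom C A w" and c: "c \<in> hom C B w"
    and p: "p \<in> hom C l A" and q: "q \<in> hom C l B"
    and comm: "Cmp C a p = Cmp C c q" "Cmp C b p = Cmp C c q"
    and univ: "\<And>k u v. u \<in> hom C k A \<Longrightarrow> v \<in> hom C k B \<Longrightarrow> Cmp C a u = Cmp C c v \<Longrightarrow>
      Cmp C b u = Cmp C c v \<Longrightarrow> \<exists>!h. h \<in> hom C k l \<and> Cmp C p h = u \<and> Cmp C q h = v"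
    and ab: "far F a = far F b" and i: "is_iso E (far F c)"
  shows "is_iso E (far F p)"
proof -
  let ?X = "fork_diagram C A B w a b c"
  let ?\<pi> = "\<lambda>n::nat. if n = 0 then p else if n = 1 then q else Cmp C a p"
  have C: "category C" and E: "category E" using fun_cat[OF F] by auto
  have X: "is_functor fork_shape C ?X" using is_functor_fork_diagram[OF C a b c] .
  have l: "l \<in> Obj C" using cat_obj[OF C p] by blast
  note ap = cat_cmp[OF C p a]
  have "is_limit fork_shape C ?X l ?\<pi>"
    unfolding is_limit_def
  proof (intro conjI allI impI)
    show "is_cone fork_shape C ?X l ?\<pi>"
      unfolding is_cone_def
      using l p q ap comm cat_idl[OF C p] cat_idl[OF C q] cat_idl[OF C ap] by auto
    fix k \<kappa> assume cone: "is_cone fork_shape C ?X k \<kappa>"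
    have \<kappa>: "\<kappa> 0 \<in> hom C k A" "\<kappa> 1 \<in> hom C k B" "\<kappa> 2 \<in> hom C k w"
      using cone unfolding is_cone_def by auto
    have "Cmp C (far ?X u) (\<kappa> (Dom fork_shape u)) = \<kappa> (Cod fork_shape u)" if "u \<in> Arr fork_shape" for u
      using cone that unfolding is_cone_def by blast
    from this[of 3] this[of 4] this[of 5]
    have \<kappa>c: "Cmp C a (\<kappa> 0) = \<kappa> 2" "Cmp C b (\<kappa> 0) = \<kappa> 2" "Cmp C c (\<kappa> 1) = \<kappa> 2" by simp_all
    obtain h where h: "h \<in> hom C k l" "Cmp C p h = \<kappa> 0" "Cmp C q h = \<kappa> 1"
      and hu: "\<And>h'. h' \<in> hom C k l \<Longrightarrow> Cmp C p h' = \<kappa> 0 \<Longrightarrow> Cmp C q h' = \<kappa> 1 \<Longrightarrow> h' = h"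
      using univ[OF \<kappa>(1,2)] \<kappa>c by metis
    have "Cmp C (Cmp C a p) h = \<kappa> 2" using cat_assoc[OF C h(1) p a] h(2) \<kappa>c(1) by simp
    then have 1: "h \<in> hom C k l \<and> (\<forall>i\<in>Obj fork_shape. Cmp C (?\<pi> i) h = \<kappa> i)" using h by simp
    have 2: "h' = h" if "h' \<in> hom C k l \<and> (\<forall>i\<in>Obj fork_shape. Cmp C (?\<pi> i) h' = \<kappa> i)" for h'
    proof (rule hu)
      show "h' \<in> hom C k l" using that by blast
      show "Cmp C p h' = \<kappa> 0" "Cmp C q h' = \<kappa> 1" using conjunct2[OF that] by simp_all
    qed
    from 1 2 show "\<exists>!h. h \<in> hom C k l \<and> (\<forall>i\<in>Obj fork_shape. Cmp C (?\<pi> i) h = \<kappa> i)"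
      by (rule ex1I)
  qed
  from preserves_finite_limitsD[OF lex _ X this]
  have lim: "is_limit fork_shape E (comp_func F ?X) (fob F l) (\<lambda>n. far F (?\<pi> n))"
    by simp
  note Fa = fun_ar[OF F a] and Fc = fun_ar[OF F c] and Fp = fun_ar[OF F p] and Fq = fun_ar[OF F q]
  have FA: "fob F A \<in> Obj E" using cat_obj[OF E Fa] by blast
  have o: "A \<in> Obj C" "B \<in> Obj C" "w \<in> Obj C" using cat_obj[OF C] a c by blast+
  obtain d where d: "d \<in> hom E (fob F w) (fob F B)" "Cmp E d (far F c) = Ide E (fob F B)"
    "Cmp E (far F c) d = Ide E (fob F w)" using is_isoE[OF i Fc] by metis
  note da = cat_cmp[OF E Fa d(1)]
  have cda: "Cmp E (far F c) (Cmp E d (far F a)) = far F a"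
    using cat_assoc[OF E Fa d(1) Fc] d(3) cat_idl[OF E Fa] by simp
  \<comment> \<open>The leg to \<open>fob F B\<close> is forced: it is \<open>far F a\<close>
    followed by the inverse \<open>d\<close> of \<open>far F c\<close>.\<close>
  let ?\<kappa> = "\<lambda>n::nat. if n = 0 then Ide E (fob F A) else if n = 1 then Cmp E d (far F a) else far F a"
  have "is_cone fork_shape E (comp_func F ?X) (fob F A) ?\<kappa>"
    unfolding is_cone_def
    using FA cat_ide[OF E FA] Fa da cda cat_idr[OF E Fa] ab cat_idl[OF E cat_ide[OF E FA]]
      cat_idl[OF E da] cat_idl[OF E Fa] fun_id[OF F] o by auto
  then obtain h where h: "h \<in> hom E (fob F A) (fob F l)"
    "\<forall>n\<in>Obj fork_shape. Cmp E (far F (?\<pi> n)) h = ?\<kappa> n"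
    using lim unfolding is_limit_def by blast
  have h0: "Cmp E (far F p) h = Ide E (fob F A)" and h1: "Cmp E (far F q) h = Cmp E d (far F a)"
    using h(2) by auto
  have cone: "is_cone fork_shape E (comp_func F ?X) (fob F l) (\<lambda>n. far F (?\<pi> n))"
    using lim unfolding is_limit_def by blast
  have uniq: "g = g'" if "g \<in> hom E (fob F l) (fob F l)" "g' \<in> hom E (fob F l) (fob F l)"
    "\<forall>n\<in>Obj fork_shape. Cmp E (far F (?\<pi> n)) g = far F (?\<pi> n)"
    "\<forall>n\<in>Obj fork_shape. Cmp E (far F (?\<pi> n)) g' = far F (?\<pi> n)" for g g'
    using lim cone that unfolding is_limit_def by blast
  have Fl: "fob F l \<in> Obj E" using fun_ob[OF F l] .
  note hp = cat_cmp[OF E Fp h(1)]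
  have php: "Cmp E (far F p) (Cmp E h (far F p)) = far F p"
    using cat_assoc[OF E Fp h(1) Fp] h0 cat_idl[OF E Fp] by simp
  have "Cmp E (far F q) (Cmp E h (far F p)) = Cmp E d (Cmp E (far F a) (far F p))"
    using cat_assoc[OF E Fp h(1) Fq] h1 cat_assoc[OF E Fp Fa d(1)] by simp
  also have "\<dots> = Cmp E d (Cmp E (far F c) (far F q))"
    using fun_cmp[OF F p a] fun_cmp[OF F q c] comm(1) by simp
  also have "\<dots> = far F q" using cat_assoc[OF E Fq Fc d(1)] d(2) cat_idl[OF E Fq] by simp
  finally have qhp: "Cmp E (far F q) (Cmp E h (far F p)) = far F q" .
  have aphp: "Cmp E (far F (Cmp C a p)) (Cmp E h (far F p)) = far F (Cmp C a p)"
    using fun_cmp[OF F p a] cat_assoc[OF E hp Fp Fa] php by simp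
  \<comment> \<open>Both sides induce the limit cone itself, so uniqueness of mediating arrows
    identifies them.\<close>
  have "Cmp E h (far F p) = Ide E (fob F l)"
  proof (rule uniq[OF hp cat_ide[OF E Fl]])
    show "\<forall>n\<in>Obj fork_shape. Cmp E (far F (?\<pi> n)) (Cmp E h (far F p)) = far F (?\<pi> n)"
      using php qhp aphp by auto
    show "\<forall>n\<in>Obj fork_shape. Cmp E (far F (?\<pi> n)) (Ide E (fob F l)) = far F (?\<pi> n)"
      using cat_idr[OF E Fp] cat_idr[OF E Fq] cat_idr[OF E fun_ar[OF F ap]] by auto
  qed
  then show ?thesis using is_isoI[OF Fp h(1) _ h0] by blast
qed

locale lex_reflection =
  fixes C :: "('o, 'm) cat" and D :: "'o set" and L :: "('o, 'm, 'o, 'm) func" and \<eta> :: "'o \<Rightarrow> 'm"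
  assumes D_Obj: "D \<subseteq> Obj C"
    and D_replete: "\<And>a b. a \<in> D \<Longrightarrow> b \<in> Obj C \<Longrightarrow> isomorphic C a b \<Longrightarrow> b \<in> D"
    and unit: "universal_unit C (full_sub C D) L id_func \<eta>"
    and lex: "preserves_finite_limits C (full_sub C D) L"

lemma subtopos_lex_reflection:
  assumes "subtopos C D"
  obtains L \<eta> where "lex_reflection C D L \<eta>"
  using assms left_adjoint_imp_universal_unit
  unfolding subtopos_def geometric_embedding_def lex_reflection_def by metis

context lex_reflection
begin

lemma L_functor: "is_functor C (full_sub C D) L" using universal_unitD(1)[OF unit] .

lemma cat: "category C" using fun_cat[OF L_functor] by blast

lemma L_ob: "c \<in> Obj C \<Longrightarrow> fob L c \<in> D" using fun_ob[OF L_functor] by auto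

lemma \<eta>_hom: "c \<in> Obj C \<Longrightarrow> \<eta> c \<in> hom C c (fob L c)" using universal_unitD(3)[OF unit] by simp

text \<open>This is the universal property of the unit, read in the ambient category. It makes the
  unit one of the arrows that may serve as the inverted leg \<open>c\<close> of
  \<open>orthogonal_pullback\<close>.\<close>

lemma unit_orthogonal:
  assumes "c \<in> Obj C" "d \<in> D" shows "orthogonal C (\<eta> c) d"
proof -
  have "d \<in> Obj (full_sub C D)" using assms(2) D_Obj by auto
  from universal_unitD(5)[OF unit assms(1) this] show ?thesis
    unfolding orthogonal_iff[OF \<eta>_hom[OF assms(1)]] using assms(2) L_ob[OF assms(1)]
    by (simp add: hom_full_sub)
qed

lemma unit_iso_imp_mem:
  assumes "c \<in> Obj C" "is_iso C (\<eta> c)" shows "c \<in> D"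
proof -
  obtain g where "g \<in> hom C (fob L c) c" "is_iso C g" using is_isoE[OF assms(2) \<eta>_hom[OF assms(1)]] by metis
  then show ?thesis using D_replete[OF L_ob[OF assms(1)] assms(1)] unfolding isomorphic_def by blast
qed

text \<open>The reflector identifies \<open>a\<close> with \<open>b\<close> and inverts \<open>c\<close>, hence it inverts \<open>p\<close>.\<close>

lemma orthogonal_pullback:
  assumes a: "a \<in> hom C A w" and b: "b \<in> hom C A w" and c: "c \<in> hom C B w"
    and p: "p \<in> hom C l A" and q: "q \<in> hom C l B"
    and comm: "Cmp C a p = Cmp C c q" "Cmp C b p = Cmp C c q"
    and univ: "\<And>k u v. u \<in> hom C k A \<Longrightarrow> v \<in> hom C k B \<Longrightarrow> Cmp C a u = Cmp C c v \<Longrightarrow>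
      Cmp C b u = Cmp C c v \<Longrightarrow> \<exists>!h. h \<in> hom C k l \<and> Cmp C p h = u \<and> Cmp C q h = v"
    and ab: "Cmp C (\<eta> w) a = Cmp C (\<eta> w) b" and c_orth: "\<And>d. d \<in> D \<Longrightarrow> orthogonal C c d"
    and d: "d \<in> D"
  shows "orthogonal C p d"
proof -
  have A: "A \<in> Obj C" using cat_obj[OF cat a] by blast
  have La: "far L a \<in> hom (full_sub C D) (fob L A) (fob L w)"
    "far L b \<in> hom (full_sub C D) (fob L A) (fob L w)" using fun_ar[OF L_functor] a b by blast+
  then have "fob L w \<in> Obj (full_sub C D)" using cat_obj[OF category_full_sub[OF cat]] by blast
  \<comment> \<open>By naturality of the unit, both reflected arrows precomposed with the unit at
    \<open>A\<close> give the same arrow, and arrows out of a reflection are determined by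
    that.\<close>
  then have ab': "far L a = far L b"
    using universal_unit_eq[OF unit A _ La] universal_unitD(4)[OF unit a] universal_unitD(4)[OF unit b] ab
    by simp
  have "is_iso (full_sub C D) (far L c)"
    by (rule iso_of_orthogonal[OF unit c]) (simp add: c_orth)
  then have "is_iso (full_sub C D) (far L p)"
    using lex_inverts_pullback[OF L_functor lex a b c p q comm univ ab'] by blast
  then show ?thesis using orthogonal_of_iso[OF unit p _, of d] d D_Obj by auto
qed

end

section \<open>Small sets\<close>

text \<open>Exactly the condition under which the choice in \<open>code\<close> has a
  witness.\<close>

definition small where "small U X \<longleftrightarrow> (\<exists>e. inj_on e X \<and> e ` X \<in> U)"

lemma small_code: "small U X \<Longrightarrow> inj_on (code U X) X" "small U X \<Longrightarrow> code U X ` X \<in> U"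
  using someI_ex[of "\<lambda>e. inj_on e X \<and> e ` X \<in> U"] unfolding small_def code_def by blast+

lemma small_set_in: "small U X \<Longrightarrow> small_set U X \<in> U"
  using small_code unfolding small_set_def by blast

lemma code_in: "x \<in> X \<Longrightarrow> code U X x \<in> small_set U X"
  unfolding small_set_def by blast

lemma code_eq_iff: "small U X \<Longrightarrow> x \<in> X \<Longrightarrow> y \<in> X \<Longrightarrow> code U X x = code U X y \<longleftrightarrow> x = y"
  using small_code(1) by (metis inj_onD)

lemma small_setE: 
  assumes "s \<in> small_set U X" obtains x where "x \<in> X" "s = code U X x"
  using assms unfolding small_set_def by blast

lemma bij_betw_code: "small U X \<Longrightarrow> bij_betw (code U X) X (small_set U X)"
  by (simp add: bij_betw_def small_code small_set_def)

lemma app_small_map: "small U X \<Longrightarrow> x \<in> X \<Longrightarrow> app (small_map U X Y h) (code U X x) = code U Y (h x)"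
  by (simp add: app_def small_map_def code_in inv_into_f_f small_code(1))

lemma Sets_simps [simp]:
  "Obj (Sets U) = U" "Dom (Sets U) (A, f, B) = A" "Cod (Sets U) (A, f, B) = B"
  "Ide (Sets U) A = (A, \<lambda>x\<in>A. x, A)" "Cmp (Sets U) (B', g, C) (A, f, B) = (A, compose A g f, C)"
  by (simp_all add: Sets_def)

lemma app_simp [simp]: "app (A, f, B) = f" by (simp add: app_def)

lemma hom_Sets: "m \<in> hom (Sets U) A B \<longleftrightarrow> A \<in> U \<and> B \<in> U \<and> (\<exists>f. m = (A, f, B) \<and> f \<in> A \<rightarrow>\<^sub>E B)"
  by (auto simp: hom_def Sets_def)

lemma hom_Sets_eqI:
  assumes "m \<in> hom (Sets U) A B" "n \<in> hom (Sets U) A B" "\<And>x. x \<in> A \<Longrightarrow> app m x = app n x"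
  shows "m = n"
proof -
  obtain f g where "m = (A, f, B)" "f \<in> A \<rightarrow>\<^sub>E B" "n = (A, g, B)" "g \<in> A \<rightarrow>\<^sub>E B"
    using assms(1,2) by (auto simp: hom_Sets)
  moreover from this have "f = g" using assms(3) by (intro PiE_ext) auto
  ultimately show ?thesis by simp
qed

lemma app_in: "m \<in> hom (Sets U) A B \<Longrightarrow> x \<in> A \<Longrightarrow> app m x \<in> B"
  by (auto simp: hom_Sets)

lemma app_Cmp: "m \<in> hom (Sets U) A B \<Longrightarrow> n \<in> hom (Sets U) B D \<Longrightarrow> x \<in> A \<Longrightarrow>
    app (Cmp (Sets U) n m) x = app n (app m x)"
  by (auto simp: hom_Sets compose_def)

lemma category_Sets: "category (Sets U)"
  unfolding category_def
proof (intro conjI ballI allI)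
  fix f assume "f \<in> Arr (Sets U)"
  then show "Dom (Sets U) f \<in> Obj (Sets U)" "Cod (Sets U) f \<in> Obj (Sets U)" by (auto simp: Sets_def)
next
  fix a assume "a \<in> Obj (Sets U)"
  then show "Ide (Sets U) a \<in> hom (Sets U) a a" by (auto simp: hom_Sets)
next
  fix a b c f g assume "f \<in> hom (Sets U) a b" "g \<in> hom (Sets U) b c"
  then show "Cmp (Sets U) g f \<in> hom (Sets U) a c" by (auto simp: hom_Sets compose_def PiE_iff)
next
  fix a b f assume "f \<in> hom (Sets U) a b"
  then show "Cmp (Sets U) f (Ide (Sets U) a) = f" "Cmp (Sets U) (Ide (Sets U) b) f = f"
    by (auto simp: hom_Sets compose_def fun_eq_iff PiE_iff extensional_def restrict_def)
next
  fix a b c d f g h assume "f \<in> hom (Sets U) a b" "g \<in> hom (Sets U) b c" "h \<in> hom (Sets U) c d"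
  then show "Cmp (Sets U) h (Cmp (Sets U) g f) = Cmp (Sets U) (Cmp (Sets U) h g) f"
    by (auto simp: hom_Sets compose_def fun_eq_iff)
qed

lemma is_iso_SetsI:
  assumes m: "m \<in> hom (Sets U) A B" and bij: "bij_betw (app m) A B"
  shows "is_iso (Sets U) m"
proof -
  let ?g = "inv_into A (app m)"
  have AB: "A \<in> U" "B \<in> U" using m by (auto simp: hom_Sets)
  have inv: "\<And>y. y \<in> B \<Longrightarrow> ?g y \<in> A" "\<And>y. y \<in> B \<Longrightarrow> app m (?g y) = y" "\<And>x. x \<in> A \<Longrightarrow> ?g (app m x) = x"
    using bij by (auto simp: bij_betw_def inv_into_into f_inv_into_f)
  let ?n = "(B, restrict ?g B, A)"
  have n: "?n \<in> hom (Sets U) B A" using AB inv by (auto simp: hom_Sets)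
  note C = category_Sets[of U]
  show ?thesis
  proof (rule is_isoI[OF m n])
    show "Cmp (Sets U) ?n m = Ide (Sets U) A"
      by (rule hom_Sets_eqI[OF cat_cmp[OF C m n] cat_ide[OF C]])
        (use AB m n inv app_in[OF m] in \<open>auto simp del: Sets_simps(5) simp: app_Cmp[OF m n]\<close>)
    show "Cmp (Sets U) m ?n = Ide (Sets U) B"
      by (rule hom_Sets_eqI[OF cat_cmp[OF C n m] cat_ide[OF C]])
        (use AB m n inv in \<open>auto simp del: Sets_simps(5) simp: app_Cmp[OF n m]\<close>)
  qed
qed

lemma small_map_hom:
  assumes "small U X" "small U Y" "\<And>x. x \<in> X \<Longrightarrow> h x \<in> Y"
  shows "small_map U X Y h \<in> hom (Sets U) (small_set U X) (small_set U Y)"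
  using assms by (auto simp: hom_Sets small_map_def small_set_in code_in small_code(1) elim!: small_setE)

lemma small_map_id:
  assumes "small U X" "\<And>x. x \<in> X \<Longrightarrow> h x = x" shows "small_map U X X h = Ide (Sets U) (small_set U X)"
proof (rule hom_Sets_eqI)
  show "small_map U X X h \<in> hom (Sets U) (small_set U X) (small_set U X)"
    using small_map_hom assms by metis
  show "Ide (Sets U) (small_set U X) \<in> hom (Sets U) (small_set U X) (small_set U X)"
    using cat_ide[OF category_Sets] small_set_in[OF assms(1)] by simp
  fix x assume "x \<in> small_set U X"
  then show "app (small_map U X X h) x = app (Ide (Sets U) (small_set U X)) x"
    using assms by (auto elim!: small_setE simp: app_small_map code_in)
qed

lemma small_map_Cmp:
  assumes "small U X" "small U Y" "small U Z" "\<And>x. x \<in> X \<Longrightarrow> h x \<in> Y" "\<And>y. y \<in> Y \<Longrightarrow> k y \<in> Z"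
    "\<And>x. x \<in> X \<Longrightarrow> r x = k (h x)"
  shows "Cmp (Sets U) (small_map U Y Z k) (small_map U X Y h) = small_map U X Z r"
proof (rule hom_Sets_eqI)
  have h: "small_map U X Y h \<in> hom (Sets U) (small_set U X) (small_set U Y)"
    and k: "small_map U Y Z k \<in> hom (Sets U) (small_set U Y) (small_set U Z)"
    using assms by (simp_all add: small_map_hom)
  show "Cmp (Sets U) (small_map U Y Z k) (small_map U X Y h) \<in> hom (Sets U) (small_set U X) (small_set U Z)"
    using cat_cmp[OF category_Sets h k] .
  show "small_map U X Z r \<in> hom (Sets U) (small_set U X) (small_set U Z)"
    using assms by (simp add: small_map_hom)
  fix x assume "x \<in> small_set U X"
  then show "app (Cmp (Sets U) (small_map U Y Z k) (small_map U X Y h)) x = app (small_map U X Z r) x"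
    using assms by (auto elim!: small_setE simp: app_Cmp[OF h k] app_small_map code_in)
qed

lemma is_functor_hom_func:
  assumes C: "category C" and sm: "\<And>b. b \<in> Obj C \<Longrightarrow> small U (hom C a b)"
  shows "is_functor C (Sets U) (hom_func U C a)"
proof (rule is_functorI[OF C category_Sets])
  fix b assume "b \<in> Obj C"
  then show "fob (hom_func U C a) b \<in> Obj (Sets U)" by (simp add: hom_func_def sm small_set_in)
next
  fix b c f assume f: "f \<in> hom C b c"
  then show "far (hom_func U C a) f \<in> hom (Sets U) (fob (hom_func U C a) b) (fob (hom_func U C a) c)"
    using cat_obj[OF C f] cat_cmp[OF C _ f] by (auto simp: hom_func_def hom_D[OF f] sm intro!: small_map_hom)
next
  fix b assume b: "b \<in> Obj C"
  note i = cat_ide[OF C b]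
  show "far (hom_func U C a) (Ide C b) = Ide (Sets U) (fob (hom_func U C a) b)"
    using small_map_id[OF sm[OF b], of "Cmp C (Ide C b)"] cat_idl[OF C]
    by (simp add: hom_func_def hom_D[OF i])
next
  fix b c d f g assume f: "f \<in> hom C b c" and g: "g \<in> hom C c d"
  have o: "b \<in> Obj C" "c \<in> Obj C" "d \<in> Obj C" using cat_obj[OF C] f g by blast+
  show "far (hom_func U C a) (Cmp C g f) = Cmp (Sets U) (far (hom_func U C a) g) (far (hom_func U C a) f)"
    using small_map_Cmp[OF sm[OF o(1)] sm[OF o(2)] sm[OF o(3)] cat_cmp[OF C _ f] cat_cmp[OF C _ g],
        of "\<lambda>x. x" "\<lambda>x. x" "Cmp C (Cmp C g f)"] cat_assoc[OF C _ f g]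
    by (simp add: hom_func_def hom_D[OF f] hom_D[OF g] hom_D[OF cat_cmp[OF C f g]])
qed

text \<open>An element of a cone over the hom-sets out of \<open>a\<close> is, after decoding, a
  cone with apex \<open>a\<close>. The mediating map sends it to the arrow that this cone induces
  into the limit.\<close>

lemma hom_func_preserves_finite_limits:
  assumes C: "category C" and sm: "\<And>b. b \<in> Obj C \<Longrightarrow> small U (hom C a b)" and aC: "a \<in> Obj C"
  shows "preserves_finite_limits C (Sets U) (hom_func U C a)" (is "preserves_finite_limits _ _ ?H")
  unfolding preserves_finite_limits_def
proof (intro allI impI)
  fix I :: "(nat, nat) cat" and X l \<pi>
  assume h: "finite (Arr I) \<and> is_functor I C X \<and> is_limit I C X l \<pi>"
  then have X: "is_functor I C X" and lim: "is_limit I C X l \<pi>" by auto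
  have I: "category I" using fun_cat[OF X] by blast
  have H: "is_functor C (Sets U) ?H" using is_functor_hom_func[OF C sm] .
  have l: "l \<in> Obj C" and \<pi>: "\<And>i. i \<in> Obj I \<Longrightarrow> \<pi> i \<in> hom C l (fob X i)"
    and comm: "\<And>u. u \<in> Arr I \<Longrightarrow> Cmp C (far X u) (\<pi> (Dom I u)) = \<pi> (Cod I u)"
    using lim unfolding is_limit_def is_cone_def by blast+
  have X': "far X u \<in> hom C (fob X (Dom I u)) (fob X (Cod I u))" "Dom I u \<in> Obj I" "Cod I u \<in> Obj I"
    if "u \<in> Arr I" for u
    using functor_on_arr[OF X that] .
  have sX: "small U (hom C a (fob X i))" if "i \<in> Obj I" for i using sm[OF fun_ob[OF X that]] .
  have Hob: "fob ?H b = small_set U (hom C a b)" for b by (simp add: hom_func_def)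
  have Happ: "app (far ?H f) (code U (hom C a b) t) = code U (hom C a c) (Cmp C f t)"
    if "f \<in> hom C b c" "t \<in> hom C a b" for f b c t
    using that sm cat_obj[OF C that(1)] by (simp add: hom_func_def hom_D[OF that(1)] app_small_map)
  show "is_limit I (Sets U) (comp_func ?H X) (fob ?H l) (\<lambda>i. far ?H (\<pi> i))"
    unfolding is_limit_def
  proof (intro conjI allI impI)
    show "is_cone I (Sets U) (comp_func ?H X) (fob ?H l) (\<lambda>i. far ?H (\<pi> i))"
      unfolding is_cone_def
    proof (intro conjI ballI)
      show "fob ?H l \<in> Obj (Sets U)" using fun_ob[OF H l] .
      fix i assume "i \<in> Obj I"
      then show "far ?H (\<pi> i) \<in> hom (Sets U) (fob ?H l) (fob (comp_func ?H X) i)"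
        using fun_ar[OF H \<pi>] by simp
    next
      fix u assume u: "u \<in> Arr I"
      show "Cmp (Sets U) (far (comp_func ?H X) u) (far ?H (\<pi> (Dom I u))) = far ?H (\<pi> (Cod I u))"
        using fun_cmp[OF H \<pi>[OF X'(2)[OF u]] X'(1)[OF u]] comm[OF u] by simp
    qed
    fix K \<kappa> assume cone: "is_cone I (Sets U) (comp_func ?H X) K \<kappa>"
    have K: "K \<in> U" and \<kappa>: "\<And>i. i \<in> Obj I \<Longrightarrow> \<kappa> i \<in> hom (Sets U) K (small_set U (hom C a (fob X i)))"
      and \<kappa>c: "\<And>u. u \<in> Arr I \<Longrightarrow> Cmp (Sets U) (far ?H (far X u)) (\<kappa> (Dom I u)) = \<kappa> (Cod I u)"
      using cone unfolding is_cone_def by (auto simp: Hob)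
    have "\<forall>x\<in>K. \<forall>i\<in>Obj I. \<exists>t. t \<in> hom C a (fob X i) \<and> app (\<kappa> i) x = code U (hom C a (fob X i)) t"
      using app_in[OF \<kappa>] by (metis small_setE)
    then obtain t where t: "\<And>x i. x \<in> K \<Longrightarrow> i \<in> Obj I \<Longrightarrow> t x i \<in> hom C a (fob X i)"
      "\<And>x i. x \<in> K \<Longrightarrow> i \<in> Obj I \<Longrightarrow> app (\<kappa> i) x = code U (hom C a (fob X i)) (t x i)" by metis
    have "is_cone I C X a (t x)" if x: "x \<in> K" for x
      unfolding is_cone_def
    proof (intro conjI ballI aC t(1)[OF x])
      fix u assume u: "u \<in> Arr I"
      note X'' = X'[OF u]
      have HX: "far ?H (far X u) \<in> hom (Sets U) (small_set U (hom C a (fob X (Dom I u))))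
          (small_set U (hom C a (fob X (Cod I u))))"
        using fun_ar[OF H X''(1)] by (simp add: Hob)
      have "code U (hom C a (fob X (Cod I u))) (Cmp C (far X u) (t x (Dom I u))) =
          app (far ?H (far X u)) (app (\<kappa> (Dom I u)) x)"
        using t(2)[OF x X''(2)] Happ[OF X''(1) t(1)[OF x X''(2)]] by simp
      also have "\<dots> = app (\<kappa> (Cod I u)) x"
        using \<kappa>c[OF u] app_Cmp[OF \<kappa>[OF X''(2)] HX x] by simp
      also have "\<dots> = code U (hom C a (fob X (Cod I u))) (t x (Cod I u))" using t(2)[OF x X''(3)] .
      finally show "Cmp C (far X u) (t x (Dom I u)) = t x (Cod I u)"
        using code_eq_iff[OF sX[OF X''(3)] cat_cmp[OF C t(1)[OF x X''(2)] X''(1)] t(1)[OF x X''(3)]] by simp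
    qed
    then have "\<forall>x\<in>K. \<exists>h. h \<in> hom C a l \<and> (\<forall>i\<in>Obj I. Cmp C (\<pi> i) h = t x i) \<and>
        (\<forall>h'. h' \<in> hom C a l \<and> (\<forall>i\<in>Obj I. Cmp C (\<pi> i) h' = t x i) \<longrightarrow> h' = h)"
      using lim unfolding is_limit_def by metis
    \<comment> \<open>The decoded mediating map: \<open>r x\<close> is the arrow induced by the cone
      \<open>t x\<close>, with its uniqueness kept as the third fact.\<close>
    then obtain r where r: "\<And>x. x \<in> K \<Longrightarrow> r x \<in> hom C a l"
      "\<And>x i. x \<in> K \<Longrightarrow> i \<in> Obj I \<Longrightarrow> Cmp C (\<pi> i) (r x) = t x i"
      "\<And>x h'. x \<in> K \<Longrightarrow> h' \<in> hom C a l \<Longrightarrow> (\<forall>i\<in>Obj I. Cmp C (\<pi> i) h' = t x i) \<Longrightarrow> h' = r x"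
      by metis
    let ?h = "(K, \<lambda>x\<in>K. code U (hom C a l) (r x), fob ?H l)"
    have hh: "?h \<in> hom (Sets U) K (fob ?H l)"
      using K r(1) sm[OF l] by (auto simp: hom_Sets Hob small_set_in code_in)
    have H\<pi>: "far ?H (\<pi> i) \<in> hom (Sets U) (fob ?H l) (small_set U (hom C a (fob X i)))" if "i \<in> Obj I" for i
      using fun_ar[OF H \<pi>[OF that]] by (simp add: Hob)
    show "\<exists>!h. h \<in> hom (Sets U) K (fob ?H l) \<and> (\<forall>i\<in>Obj I. Cmp (Sets U) (far ?H (\<pi> i)) h = \<kappa> i)"
    proof (rule ex1I[of _ ?h], intro conjI ballI hh)
      fix i assume i: "i \<in> Obj I"
      show "Cmp (Sets U) (far ?H (\<pi> i)) ?h = \<kappa> i"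
      proof (rule hom_Sets_eqI[OF cat_cmp[OF category_Sets hh H\<pi>[OF i]] \<kappa>[OF i]])
        fix x assume x: "x \<in> K"
        show "app (Cmp (Sets U) (far ?H (\<pi> i)) ?h) x = app (\<kappa> i) x"
          using app_Cmp[OF hh H\<pi>[OF i] x] Happ[OF \<pi>[OF i] r(1)[OF x]] r(2)[OF x i] t(2)[OF x i] x by simp
      qed
    next
      fix g assume g: "g \<in> hom (Sets U) K (fob ?H l) \<and> (\<forall>i\<in>Obj I. Cmp (Sets U) (far ?H (\<pi> i)) g = \<kappa> i)"
      then have gh: "g \<in> hom (Sets U) K (fob ?H l)" by blast
      show "g = ?h"
      proof (rule hom_Sets_eqI[OF gh hh])
        fix x assume x: "x \<in> K"
        obtain s where s: "s \<in> hom C a l" "app g x = code U (hom C a l) s"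
          using app_in[OF gh x] unfolding Hob by (rule small_setE)
        have "Cmp C (\<pi> i) s = t x i" if i: "i \<in> Obj I" for i
        proof -
          have "code U (hom C a (fob X i)) (Cmp C (\<pi> i) s) = app (\<kappa> i) x"
            using g i app_Cmp[OF gh H\<pi>[OF i] x] s(2) Happ[OF \<pi>[OF i] s(1)] by simp
          then show ?thesis
            using t[OF x i] code_eq_iff[OF sX[OF i] cat_cmp[OF C s(1) \<pi>[OF i]] t(1)[OF x i]] by simp
        qed
        then show "app g x = app ?h x" using r(3)[OF x s(1)] s(2) x by simp
      qed
    qed
  qed
qed

section \<open>Closure properties of small sets\<close>

lemma small_lepoll: "set_universe U \<Longrightarrow> small U X \<longleftrightarrow> (\<exists>A\<in>U. X \<lesssim> A)"
proof
  assume "small U X" then show "\<exists>A\<in>U. X \<lesssim> A" unfolding small_def lepoll_def by blast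
next
  assume U: "set_universe U" and "\<exists>A\<in>U. X \<lesssim> A"
  then obtain A e where A: "A \<in> U" "inj_on e X" "e ` X \<subseteq> A" unfolding lepoll_def by blast
  then have "e ` X \<in> U" using U subset_imp_lepoll unfolding set_universe_def by metis
  then show "small U X" using A unfolding small_def by blast
qed

lemma small_mem: "A \<in> U \<Longrightarrow> small U A" unfolding small_def by (intro exI[of _ "\<lambda>x. x"]) simp

lemma small_inj: 
  assumes "set_universe U" "small U Y" "inj_on f X" "f ` X \<subseteq> Y" shows "small U X"
  using assms lepoll_trans[of X Y] unfolding small_lepoll[OF assms(1)] lepoll_def by meson

lemma small_times:
  assumes U: "set_universe U" and "small U X" "small U Y" shows "small U (X \<times> Y)"
proof -
  obtain A B where "A \<in> U" "B \<in> U" "X \<lesssim> A" "Y \<lesssim> B" using assms small_lepoll by metis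
  moreover from this obtain C where "C \<in> U" "A \<times> B \<lesssim> C" using U unfolding set_universe_def by meson
  ultimately show ?thesis using times_lepoll_mono lepoll_trans small_lepoll[OF U] by metis
qed

text \<open>A function on \<open>insert a F\<close> is coded injectively by its value at
  \<open>a\<close> and its restriction to \<open>F\<close>, so closure under binary products
  suffices for an induction over the finite domain.\<close>

lemma small_PiE:
  assumes U: "set_universe U" and "small U Y" "finite F" shows "small U (F \<rightarrow>\<^sub>E Y)"
  using assms(3)
proof induction
  case empty
  obtain x y where "{x, y} \<in> U" using U unfolding set_universe_def by blast
  then show ?case
    by (intro small_inj[OF U small_mem, of "{x, y}" "\<lambda>_. x"]) auto
next
  case (insert a F)
  show ?case
  proof (rule small_inj[OF U small_times[OF U assms(2) insert.IH]])
    show "inj_on (\<lambda>f. (f a, restrict f F)) (insert a F \<rightarrow>\<^sub>E Y)"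
    proof (rule inj_onI)
      fix f g assume fg: "f \<in> insert a F \<rightarrow>\<^sub>E Y" "g \<in> insert a F \<rightarrow>\<^sub>E Y"
        and eq: "(f a, restrict f F) = (g a, restrict g F)"
      have "f a = g a" using eq by simp
      moreover have "f x = g x" if "x \<in> F" for x
        using arg_cong[OF conjunct2[OF eq[unfolded prod.inject]], of "\<lambda>h. h x"] that by simp
      ultimately have "\<And>x. x \<in> insert a F \<Longrightarrow> f x = g x" by blast
      then show "f = g" using fg PiE_ext by metis
    qed
    show "(\<lambda>f. (f a, restrict f F)) ` (insert a F \<rightarrow>\<^sub>E Y) \<subseteq> Y \<times> (F \<rightarrow>\<^sub>E Y)" by auto
  qed
qed

text \<open>\<open>X\<close> embeds in the functions from \<open>X\<close> to a two element set of
  the universe by characteristic functions of singletons; this is where the two elements required of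
  a universe are needed.\<close>

lemma small_finite:
  assumes U: "set_universe U" and "finite X" shows "small U X"
proof -
  obtain x y where xy: "x \<noteq> y" "{x, y} \<in> U" using U unfolding set_universe_def by blast
  show ?thesis
  proof (rule small_inj[OF U small_PiE[OF U small_mem[OF xy(2)] assms(2)]])
    show "inj_on (\<lambda>a. \<lambda>b\<in>X. if b = a then x else y) X"
    proof (rule inj_onI)
      fix a a' assume a: "a \<in> X" "a' \<in> X" and "(\<lambda>b\<in>X. if b = a then x else y) = (\<lambda>b\<in>X. if b = a' then x else y)"
      then have "(\<lambda>b\<in>X. if b = a then x else y) a = (\<lambda>b\<in>X. if b = a' then x else y) a" by simp
      then show "a = a'" using a xy(1) by (simp split: if_splits)
    qed
    show "(\<lambda>a. \<lambda>b\<in>X. if b = a then x else y) ` X \<subseteq> X \<rightarrow>\<^sub>E {x, y}" by auto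
  qed
qed

section \<open>Finite posets and open maps\<close>

lemma fp_carrier: "finite_poset P \<Longrightarrow> (p, q) \<in> snd P \<Longrightarrow> p \<in> fst P" "finite_poset P \<Longrightarrow> (p, q) \<in> snd P \<Longrightarrow> q \<in> fst P"
  unfolding finite_poset_def partial_order_on_def preorder_on_def refl_on_def by auto

lemma fp_refl: "finite_poset P \<Longrightarrow> p \<in> fst P \<Longrightarrow> (p, p) \<in> snd P"
  unfolding finite_poset_def partial_order_on_def preorder_on_def refl_on_def by auto

lemma fp_trans: "finite_poset P \<Longrightarrow> (p, q) \<in> snd P \<Longrightarrow> (q, r) \<in> snd P \<Longrightarrow> (p, r) \<in> snd P"
  unfolding finite_poset_def partial_order_on_def preorder_on_def by (meson transD)

lemma fp_antisym: "finite_poset P \<Longrightarrow> (p, q) \<in> snd P \<Longrightarrow> (q, p) \<in> snd P \<Longrightarrow> p = q"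
  unfolding finite_poset_def partial_order_on_def by (meson antisymD)

lemma fp_finite: "finite_poset P \<Longrightarrow> finite (fst P)"
  unfolding finite_poset_def by blast

lemma finite_posetI:
  assumes "finite A" "\<And>p q. (p, q) \<in> r \<Longrightarrow> p \<in> A \<and> q \<in> A" "\<And>p. p \<in> A \<Longrightarrow> (p, p) \<in> r"
    "\<And>p q s. (p, q) \<in> r \<Longrightarrow> (q, s) \<in> r \<Longrightarrow> (p, s) \<in> r" "\<And>p q. (p, q) \<in> r \<Longrightarrow> (q, p) \<in> r \<Longrightarrow> p = q"
  shows "finite_poset (A, r)"
  unfolding finite_poset_def partial_order_on_def preorder_on_def refl_on_def trans_def antisym_def
  using assms by auto

lemma Kp_simps [simp]:
  "P \<in> Obj Kp \<longleftrightarrow> finite_poset P" "Dom Kp (P, f, Q) = P" "Cod Kp (P, f, Q) = Q"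
  "Ide Kp P = (P, \<lambda>p\<in>fst P. p, P)" "Cmp Kp (Q', g, R) (P, f, Q) = (P, compose (fst P) g f, R)"
  by (simp_all add: Kp_def)

definition pap :: "posetarr \<Rightarrow> nat \<Rightarrow> nat" where "pap m = fst (snd m)"

text \<open>The restriction makes the underlying function extensional, so that arrows agreeing on
  the carrier are equal.\<close>

definition kar :: "poset \<Rightarrow> (nat \<Rightarrow> nat) \<Rightarrow> poset \<Rightarrow> posetarr" where
  "kar P f Q = (P, restrict f (fst P), Q)"

lemma hom_Kp: "m \<in> hom Kp P Q \<longleftrightarrow> finite_poset P \<and> finite_poset Q \<and> (\<exists>f. m = (P, f, Q) \<and> open_map P Q f)"
  by (auto simp: hom_def Kp_def)

lemma hom_Kp_fp: "m \<in> hom Kp P Q \<Longrightarrow> finite_poset P" "m \<in> hom Kp P Q \<Longrightarrow> finite_poset Q"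
  by (simp_all add: hom_Kp)

lemma Kp_in: "m \<in> hom Kp P Q \<Longrightarrow> p \<in> fst P \<Longrightarrow> pap m p \<in> fst Q"
  by (auto simp: hom_Kp pap_def open_map_def)

lemma Kp_mono: "m \<in> hom Kp P Q \<Longrightarrow> (p, p') \<in> snd P \<Longrightarrow> (pap m p, pap m p') \<in> snd Q"
  by (auto simp: hom_Kp pap_def open_map_def)

lemma Kp_lift:
  assumes "m \<in> hom Kp P Q" "p \<in> fst P" "(pap m p, q) \<in> snd Q"
  obtains p' where "(p, p') \<in> snd P" "pap m p' = q"
proof -
  have "\<forall>p\<in>fst P. \<forall>q. (pap m p, q) \<in> snd Q \<longrightarrow> (\<exists>p'. (p, p') \<in> snd P \<and> pap m p' = q)"
    using assms(1) by (auto simp: hom_Kp pap_def open_map_def)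
  then show ?thesis using assms(2,3) that by blast
qed

lemma hom_Kp_eqI:
  assumes "m \<in> hom Kp P Q" "n \<in> hom Kp P Q" "\<And>p. p \<in> fst P \<Longrightarrow> pap m p = pap n p"
  shows "m = n"
proof -
  obtain f g where "m = (P, f, Q)" "f \<in> fst P \<rightarrow>\<^sub>E fst Q" "n = (P, g, Q)" "g \<in> fst P \<rightarrow>\<^sub>E fst Q"
    using assms(1,2) by (auto simp: hom_Kp open_map_def)
  moreover from this have "f = g" using assms(3) by (intro PiE_ext) (auto simp: pap_def)
  ultimately show ?thesis by simp
qed

lemma pap_kar [simp]: "p \<in> fst P \<Longrightarrow> pap (kar P f Q) p = f p" by (simp add: pap_def kar_def)

lemma kar_simps [simp]: "Dom Kp (kar P f Q) = P" "Cod Kp (kar P f Q) = Q" by (simp_all add: kar_def)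

lemma kar_hom:
  assumes "finite_poset P" "finite_poset Q" "\<And>p. p \<in> fst P \<Longrightarrow> f p \<in> fst Q"
    "\<And>p p'. (p, p') \<in> snd P \<Longrightarrow> p \<in> fst P \<Longrightarrow> p' \<in> fst P \<Longrightarrow> (f p, f p') \<in> snd Q"
    "\<And>p q. p \<in> fst P \<Longrightarrow> (f p, q) \<in> snd Q \<Longrightarrow> \<exists>p'. (p, p') \<in> snd P \<and> f p' = q"
  shows "kar P f Q \<in> hom Kp P Q"
proof -
  have "open_map P Q (restrict f (fst P))"
    unfolding open_map_def
  proof (intro conjI allI ballI impI)
    show "restrict f (fst P) \<in> fst P \<rightarrow>\<^sub>E fst Q" using assms(3) by auto
    fix p p' assume "(p, p') \<in> snd P"
    then show "(restrict f (fst P) p, restrict f (fst P) p') \<in> snd Q"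
      using assms(4) fp_carrier[OF assms(1)] by simp
  next
    fix p q assume p: "p \<in> fst P" and "(restrict f (fst P) p, q) \<in> snd Q"
    then obtain p' where "(p, p') \<in> snd P" "f p' = q" using assms(5) by fastforce
    then show "\<exists>p'. (p, p') \<in> snd P \<and> restrict f (fst P) p' = q"
      using fp_carrier[OF assms(1)] by (intro exI[of _ p']) simp
  qed
  then show ?thesis using assms(1,2) by (simp add: hom_Kp kar_def)
qed

lemma pap_Cmp: "f \<in> hom Kp P Q \<Longrightarrow> g \<in> hom Kp Q R \<Longrightarrow> p \<in> fst P \<Longrightarrow> pap (Cmp Kp g f) p = pap g (pap f p)"
  by (auto simp: hom_Kp pap_def compose_def)

lemma pap_Ide: "p \<in> fst P \<Longrightarrow> pap (Ide Kp P) p = p" by (simp add: pap_def)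

lemma category_Kp: "category Kp"
  unfolding category_def
proof (intro conjI ballI allI)
  fix f assume "f \<in> Arr Kp"
  then show "Dom Kp f \<in> Obj Kp" "Cod Kp f \<in> Obj Kp" by (auto simp: Kp_def)
next
  fix P assume "P \<in> Obj Kp"
  then have "kar P (\<lambda>p. p) P \<in> hom Kp P P" by (intro kar_hom) auto
  then show "Ide Kp P \<in> hom Kp P P" by (simp add: kar_def)
next
  fix P Q R f g assume f: "f \<in> hom Kp P Q" and g: "g \<in> hom Kp Q R"
  have "kar P (\<lambda>p. pap g (pap f p)) R \<in> hom Kp P R"
  proof (rule kar_hom[OF hom_Kp_fp(1)[OF f] hom_Kp_fp(2)[OF g]])
    fix p r assume p: "p \<in> fst P" and r: "(pap g (pap f p), r) \<in> snd R"
    obtain q where q: "(pap f p, q) \<in> snd Q" "pap g q = r" using Kp_lift[OF g Kp_in[OF f p] r] .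
    obtain p' where "(p, p') \<in> snd P" "pap f p' = q" using Kp_lift[OF f p q(1)] .
    then show "\<exists>p'. (p, p') \<in> snd P \<and> pap g (pap f p') = r" using q(2) by blast
  qed (use Kp_in[OF f] Kp_in[OF g] Kp_mono[OF f] Kp_mono[OF g] in blast)+
  moreover have "kar P (\<lambda>p. pap g (pap f p)) R = Cmp Kp g f"
    using f g by (auto simp: kar_def hom_Kp pap_def compose_def)
  ultimately show "Cmp Kp g f \<in> hom Kp P R" by simp
next
  fix P Q f assume "f \<in> hom Kp P Q"
  then show "Cmp Kp f (Ide Kp P) = f" "Cmp Kp (Ide Kp Q) f = f"
    by (auto simp: hom_Kp compose_def fun_eq_iff PiE_iff extensional_def open_map_def restrict_def)
next
  fix P Q R S f g h assume "f \<in> hom Kp P Q" "g \<in> hom Kp Q R" "h \<in> hom Kp R S"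
  then show "Cmp Kp h (Cmp Kp g f) = Cmp Kp (Cmp Kp h g) f"
    by (auto simp: hom_Kp compose_def fun_eq_iff open_map_def)
qed

section \<open>Upsets, which are the subsets with open inclusion, and principal upsets\<close>

definition upset where "upset V P \<longleftrightarrow> V \<subseteq> fst P \<and> (\<forall>p\<in>V. \<forall>q. (p, q) \<in> snd P \<longrightarrow> q \<in> V)"

definition sub :: "poset \<Rightarrow> nat set \<Rightarrow> poset" where "sub P V = (V, snd P \<inter> V \<times> V)"

definition inc :: "poset \<Rightarrow> nat set \<Rightarrow> posetarr" where "inc P V = kar (sub P V) (\<lambda>p. p) P"

definition up :: "poset \<Rightarrow> nat \<Rightarrow> nat set" where "up P p = {q. (p, q) \<in> snd P}"

lemma sub_simps [simp]: "fst (sub P V) = V" "snd (sub P V) = snd P \<inter> V \<times> V" by (simp_all add: sub_def)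

lemma fp_sub:
  assumes P: "finite_poset P" and V: "V \<subseteq> fst P" shows "finite_poset (sub P V)"
  unfolding sub_def
proof (rule finite_posetI)
  show "finite V" using fp_finite[OF P] V finite_subset by blast
  show "\<And>p. p \<in> V \<Longrightarrow> (p, p) \<in> snd P \<inter> V \<times> V" using fp_refl[OF P] V by blast
  show "\<And>p q s. (p, q) \<in> snd P \<inter> V \<times> V \<Longrightarrow> (q, s) \<in> snd P \<inter> V \<times> V \<Longrightarrow> (p, s) \<in> snd P \<inter> V \<times> V"
    using fp_trans[OF P] by blast
  show "\<And>p q. (p, q) \<in> snd P \<inter> V \<times> V \<Longrightarrow> (q, p) \<in> snd P \<inter> V \<times> V \<Longrightarrow> p = q" using fp_antisym[OF P] by blast
qed auto

lemma upsetD: "upset V P \<Longrightarrow> V \<subseteq> fst P" "upset V P \<Longrightarrow> p \<in> V \<Longrightarrow> (p, q) \<in> snd P \<Longrightarrow> q \<in> V"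
  unfolding upset_def by blast+

lemma fp_sub_upset: "finite_poset P \<Longrightarrow> upset V P \<Longrightarrow> finite_poset (sub P V)"
  using fp_sub upsetD(1) by blast

lemma inc_hom: 
  assumes "finite_poset P" "upset V P" shows "inc P V \<in> hom Kp (sub P V) P"
  unfolding inc_def
proof (rule kar_hom[OF fp_sub_upset[OF assms] assms(1)])
  fix p q assume "p \<in> fst (sub P V)" "(p, q) \<in> snd P"
  then show "\<exists>p'. (p, p') \<in> snd (sub P V) \<and> p' = q" using upsetD(2)[OF assms(2)] by simp
qed (use upsetD(1)[OF assms(2)] in auto)

lemma pap_inc [simp]: "p \<in> V \<Longrightarrow> pap (inc P V) p = p" by (simp add: inc_def)

lemma upset_up: "finite_poset P \<Longrightarrow> upset (up P p) P"
  unfolding upset_def up_def using fp_carrier fp_trans by blast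

lemma in_up: "finite_poset P \<Longrightarrow> p \<in> fst P \<Longrightarrow> p \<in> up P p" unfolding up_def using fp_refl by simp

text \<open>Lifts are taken in the source \<open>Q\<close>, so an open map that lands in an upset is
  still open as a map into it.\<close>

lemma corestrict:
  assumes m: "m \<in> hom Kp Q P" and V: "upset V P" and im: "\<And>q. q \<in> fst Q \<Longrightarrow> pap m q \<in> V"
  shows "kar Q (pap m) (sub P V) \<in> hom Kp Q (sub P V)" "Cmp Kp (inc P V) (kar Q (pap m) (sub P V)) = m"
proof -
  note P = hom_Kp_fp(2)[OF m] and Q = hom_Kp_fp(1)[OF m]
  show h: "kar Q (pap m) (sub P V) \<in> hom Kp Q (sub P V)"
  proof (rule kar_hom[OF Q fp_sub_upset[OF P V]])
    fix p q assume "p \<in> fst Q" "(pap m p, q) \<in> snd (sub P V)"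
    then have "(pap m p, q) \<in> snd P" by simp
    then show "\<exists>p'. (p, p') \<in> snd Q \<and> pap m p' = q" using Kp_lift[OF m \<open>p \<in> fst Q\<close>] by metis
  qed (use im Kp_mono[OF m] in auto)
  show "Cmp Kp (inc P V) (kar Q (pap m) (sub P V)) = m"
    using im by (intro hom_Kp_eqI[OF cat_cmp[OF category_Kp h inc_hom[OF P V]] m])
      (simp add: pap_Cmp[OF h inc_hom[OF P V]])
qed

definition vimg :: "posetarr \<Rightarrow> nat set \<Rightarrow> nat set" where "vimg m V = {q \<in> fst (Dom Kp m). pap m q \<in> V}"

lemma vimg_iff: "m \<in> hom Kp Q P \<Longrightarrow> q \<in> vimg m V \<longleftrightarrow> q \<in> fst Q \<and> pap m q \<in> V"
  by (simp add: vimg_def hom_D)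

lemma upset_vimg: 
  assumes m: "m \<in> hom Kp Q P" and V: "upset V P" shows "upset (vimg m V) Q"
  unfolding upset_def Ball_def subset_iff vimg_iff[OF m]
  using upsetD(2)[OF V] Kp_mono[OF m] fp_carrier[OF hom_Kp_fp(1)[OF m]] by blast

text \<open>The preimage of an upset inclusion along an open map is again an upset inclusion; the
  restricted map completes the square.\<close>

lemma vimg_square:
  assumes m: "m \<in> hom Kp Q P" and V: "upset V P"
  obtains m' where "m' \<in> hom Kp (sub Q (vimg m V)) (sub P V)"
    "Cmp Kp (inc P V) m' = Cmp Kp m (inc Q (vimg m V))"
proof -
  note i = inc_hom[OF hom_Kp_fp(1)[OF m] upset_vimg[OF m V]]
  have "pap (Cmp Kp m (inc Q (vimg m V))) q \<in> V" if "q \<in> fst (sub Q (vimg m V))" for q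
    using pap_Cmp[OF i m that] that vimg_iff[OF m] by simp
  from corestrict[OF cat_cmp[OF category_Kp i m] V this] show ?thesis by (rule that)
qed

section \<open>The one element poset, its maps into posets, and maximal elements\<close>

definition pt :: poset where "pt = ({0}, {(0, 0)})"

lemma pt_simps [simp]: "fst pt = {0}" "snd pt = {(0, 0)}" by (simp_all add: pt_def)

lemma fp_pt: "finite_poset pt" unfolding pt_def by (rule finite_posetI) auto

definition toPt where "toPt P = kar P (\<lambda>_. 0) pt"

lemma toPt_hom: "finite_poset P \<Longrightarrow> toPt P \<in> hom Kp P pt"
  unfolding toPt_def by (rule kar_hom[OF _ fp_pt]) (auto intro: fp_refl)

lemma toPt_unique: "m \<in> hom Kp P pt \<Longrightarrow> m = toPt P"
  by (rule hom_Kp_eqI[OF _ toPt_hom[OF hom_Kp_fp(1)]]) (auto dest: Kp_in simp: toPt_def)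

definition ptm where "ptm P p = kar pt (\<lambda>_. p) P"

lemma max_elemsD: "p \<in> max_elems P \<Longrightarrow> p \<in> fst P" "p \<in> max_elems P \<Longrightarrow> (p, q) \<in> snd P \<Longrightarrow> q = p"
  unfolding max_elems_def by blast+

lemma ptm_hom: "finite_poset P \<Longrightarrow> p \<in> max_elems P \<Longrightarrow> ptm P p \<in> hom Kp pt P"
  unfolding ptm_def by (rule kar_hom[OF fp_pt]) (auto dest: max_elemsD intro: fp_refl)

lemma pap_ptm [simp]: "pap (ptm P p) 0 = p" by (simp add: ptm_def)

text \<open>Everything above the image of \<open>0\<close> would have to be the image of something
  above \<open>0\<close>, and there is only \<open>0\<close> itself. So the points of a poset are
  its maximal elements.\<close>

lemma ptm_unique:
  assumes m: "m \<in> hom Kp pt P" shows "pap m 0 \<in> max_elems P" "m = ptm P (pap m 0)"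
proof -
  have in0: "pap m 0 \<in> fst P" using Kp_in[OF m] by simp
  show mx: "pap m 0 \<in> max_elems P"
    unfolding max_elems_def
  proof (clarify, intro conjI allI impI in0)
    fix q assume "(pap m 0, q) \<in> snd P"
    then obtain p' where "(0, p') \<in> snd pt" "pap m p' = q" using Kp_lift[OF m] by (metis insertI1 pt_simps(1))
    then show "q = pap m 0" by simp
  qed
  show "m = ptm P (pap m 0)"
    by (rule hom_Kp_eqI[OF m ptm_hom[OF hom_Kp_fp(2)[OF m] mx]]) simp
qed

text \<open>A point of \<open>Q\<close> composed with \<open>m\<close> is a point of
  \<open>P\<close>, hence given by a maximal element.\<close>

lemma Kp_max:
  assumes m: "m \<in> hom Kp Q P" and q: "q \<in> max_elems Q"
  shows "pap m q \<in> max_elems P" "Cmp Kp m (ptm Q q) = ptm P (pap m q)"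
proof -
  note c = cat_cmp[OF category_Kp ptm_hom[OF hom_Kp_fp(1)[OF m] q] m]
  have "pap (Cmp Kp m (ptm Q q)) 0 = pap m q"
    using pap_Cmp[OF ptm_hom[OF hom_Kp_fp(1)[OF m] q] m, of 0] by simp
  then show "pap m q \<in> max_elems P" "Cmp Kp m (ptm Q q) = ptm P (pap m q)"
    using ptm_unique[OF c] by simp_all
qed

lemma ex_maximal_in:
  assumes P: "finite_poset P" and A: "A \<subseteq> fst P" and p: "p \<in> A"
  obtains q where "q \<in> A" "(p, q) \<in> snd P" "\<forall>r\<in>A. (q, r) \<in> snd P \<longrightarrow> r = q"
proof -
  let ?S = "\<lambda>a. {r \<in> A. (a, r) \<in> snd P}"
  have fin: "finite (?S a)" for a using finite_subset[OF A fp_finite[OF P]] by simp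
  have "\<exists>q\<in>A. (p, q) \<in> snd P \<and> (\<forall>r\<in>A. (q, r) \<in> snd P \<longrightarrow> r = q)"
    using p
  proof (induction "card (?S p)" arbitrary: p rule: less_induct)
    case less
    show ?case
    proof (cases "\<forall>r\<in>A. (p, r) \<in> snd P \<longrightarrow> r = p")
      case True then show ?thesis using less.prems fp_refl[OF P] A by blast
    next
      case False
      then obtain r where r: "r \<in> A" "(p, r) \<in> snd P" "r \<noteq> p" by blast
      have "?S r \<subseteq> ?S p" using fp_trans[OF P r(2)] by blast
      moreover have "p \<in> ?S p" using less.prems fp_refl[OF P] A by blast
      moreover have "p \<notin> ?S r" using fp_antisym[OF P r(2)] r(3) by blast
      ultimately have "card (?S r) < card (?S p)" by (intro psubset_card_mono[OF fin]) blast
      then obtain q where "q \<in> A" "(r, q) \<in> snd P" "\<forall>s\<in>A. (q, s) \<in> snd P \<longrightarrow> s = q"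
        using less.hyps r(1) by blast
      then show ?thesis using fp_trans[OF P r(2)] by blast
    qed
  qed
  then show ?thesis using that by blast
qed

lemma ex_max_above:
  assumes P: "finite_poset P" and p: "p \<in> fst P"
  obtains q where "q \<in> max_elems P" "(p, q) \<in> snd P"
proof -
  obtain q where q: "q \<in> fst P" "(p, q) \<in> snd P" "\<forall>r\<in>fst P. (q, r) \<in> snd P \<longrightarrow> r = q"
    by (rule ex_maximal_in[OF P order_refl p])
  then have "q \<in> max_elems P" using fp_carrier(2)[OF P] unfolding max_elems_def by blast
  then show ?thesis using q(2) that by simp
qed

lemma upset_max: "upset (max_elems P) P" unfolding upset_def using max_elemsD by blast

text \<open>Moving up from \<open>q\<close> to a maximal element cannot change an image that is
  already maximal.\<close>

lemma Kp_max_surj: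
  assumes m: "m \<in> hom Kp Q P" and q: "q \<in> fst Q" and "pap m q \<in> max_elems P"
  obtains q' where "q' \<in> max_elems Q" "pap m q' = pap m q"
proof -
  obtain q' where q': "q' \<in> max_elems Q" "(q, q') \<in> snd Q" using ex_max_above[OF hom_Kp_fp(1)[OF m] q] .
  then have "pap m q' = pap m q" using Kp_mono[OF m q'(2)] max_elemsD(2)[OF assms(3)] by simp
  then show ?thesis using q'(1) that by simp
qed

text \<open>Open maps are stable under pullback; the pullback is encoded on natural numbers.\<close>

lemma Kp_amalgam:
  assumes f: "f \<in> hom Kp Q P" and g: "g \<in> hom Kp R P" and q: "q \<in> fst Q" and r: "r \<in> fst R"
    and eq: "pap f q = pap g r"
  obtains W u v w where "u \<in> hom Kp W Q" "v \<in> hom Kp W R" "Cmp Kp f u = Cmp Kp g v" "w \<in> fst W"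
    "pap u w = q" "pap v w = r"
proof -
  note Q = hom_Kp_fp(1)[OF f] and R = hom_Kp_fp(1)[OF g] and P = hom_Kp_fp(2)[OF f]
  define A where "A = {(a, b). a \<in> fst Q \<and> b \<in> fst R \<and> pap f a = pap g b}"
  define r0 where "r0 = {((a, b), (a', b')). (a, b) \<in> A \<and> (a', b') \<in> A \<and> (a, a') \<in> snd Q \<and> (b, b') \<in> snd R}"
  define e :: "nat \<times> nat \<Rightarrow> nat" where "e = (SOME e. inj_on e A)"
  have "A \<subseteq> fst Q \<times> fst R" unfolding A_def by auto
  then have finA: "finite A" using fp_finite[OF Q] fp_finite[OF R] finite_subset by blast
  then have "\<exists>e :: nat \<times> nat \<Rightarrow> nat. inj_on e A" using finite_imp_inj_to_nat_seg by blast
  then have e: "inj_on e A" unfolding e_def by (rule someI_ex)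
  define d where "d = inv_into A e"
  have de: "d (e x) = x" if "x \<in> A" for x using e that by (simp add: d_def)
  define W where "W = (e ` A, {(e x, e y) | x y. (x, y) \<in> r0})"
  have r0A: "x \<in> A \<and> y \<in> A" if "(x, y) \<in> r0" for x y using that unfolding r0_def by auto
  have W: "finite_poset W"
    unfolding W_def
  proof (rule finite_posetI)
    show "finite (e ` A)" using finA by simp
    fix p assume "p \<in> e ` A"
    then obtain x where x: "x \<in> A" "p = e x" by blast
    have "(x, x) \<in> r0" using x(1) fp_refl[OF Q] fp_refl[OF R] unfolding r0_def A_def by auto
    then show "(p, p) \<in> {(e x, e y) | x y. (x, y) \<in> r0}" using x by blast
  next
    fix p q assume "(p, q) \<in> {(e x, e y) | x y. (x, y) \<in> r0}"
    then show "p \<in> e ` A \<and> q \<in> e ` A" using r0A by blast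
  next
    fix p q s assume "(p, q) \<in> {(e x, e y) | x y. (x, y) \<in> r0}" "(q, s) \<in> {(e x, e y) | x y. (x, y) \<in> r0}"
    then obtain x y y' z where h: "p = e x" "q = e y" "(x, y) \<in> r0" "q = e y'" "s = e z" "(y', z) \<in> r0" by blast
    then have "y = y'" using r0A de by metis
    then have "(x, z) \<in> r0" using h(3,6) fp_trans[OF Q] fp_trans[OF R] unfolding r0_def by blast
    then show "(p, s) \<in> {(e x, e y) | x y. (x, y) \<in> r0}" using h by blast
  next
    fix p q assume "(p, q) \<in> {(e x, e y) | x y. (x, y) \<in> r0}" "(q, p) \<in> {(e x, e y) | x y. (x, y) \<in> r0}"
    then obtain x y y' x' where h: "p = e x" "q = e y" "(x, y) \<in> r0" "q = e y'" "p = e x'" "(y', x') \<in> r0" by blast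
    then have "y = y'" "x = x'" using r0A de by metis+
    then have "x = y" using h(3,6) fp_antisym[OF Q] fp_antisym[OF R] unfolding r0_def by blast
    then show "p = q" using h by simp
  qed
  have Wle: "(e (a, b), e (a', b')) \<in> snd W" if "(a, b) \<in> A" "(a', b') \<in> A" "(a, a') \<in> snd Q" "(b, b') \<in> snd R" for a b a' b'
    using that unfolding W_def r0_def by auto
  have Wle': "(fst (d p), fst (d q)) \<in> snd Q" "(snd (d p), snd (d q)) \<in> snd R" if pq: "(p, q) \<in> snd W" for p q
  proof -
    obtain x y where h: "p = e x" "q = e y" "(x, y) \<in> r0" using pq unfolding W_def by auto
    then have "d p = x" "d q = y" using r0A de by auto
    then show "(fst (d p), fst (d q)) \<in> snd Q" "(snd (d p), snd (d q)) \<in> snd R"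
      using h(3) unfolding r0_def by auto
  qed
  have Wc: "\<exists>a b. p = e (a, b) \<and> (a, b) \<in> A" if "p \<in> fst W" for p using that unfolding W_def by auto
  have u: "kar W (\<lambda>p. fst (d p)) Q \<in> hom Kp W Q"
  proof (rule kar_hom[OF W Q])
    fix p a' assume "p \<in> fst W" and a': "(fst (d p), a') \<in> snd Q"
    then obtain a b where ab: "p = e (a, b)" "(a, b) \<in> A" using Wc by blast
    then have aa': "(a, a') \<in> snd Q" and b: "b \<in> fst R" "pap f a = pap g b" using a' de unfolding A_def by auto
    \<comment> \<open>Openness of the first projection: a step up in \<open>Q\<close> is matched in
      \<open>R\<close> by lifting its image in \<open>P\<close> along \<open>g\<close>.\<close>
    obtain b' where b': "(b, b') \<in> snd R" "pap g b' = pap f a'"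
      using Kp_lift[OF g b(1)] Kp_mono[OF f aa'] b(2) by metis
    then have A': "(a', b') \<in> A" using aa' fp_carrier[OF Q] fp_carrier[OF R] unfolding A_def by auto
    then show "\<exists>p'. (p, p') \<in> snd W \<and> fst (d p') = a'"
      using Wle[OF ab(2) A' aa' b'(1)] de[OF A'] ab(1) by (intro exI[of _ "e (a', b')"]) simp
  next
    fix p assume "p \<in> fst W" then show "fst (d p) \<in> fst Q" using Wc de unfolding A_def by fastforce
  qed (use Wle' in blast)
  have v: "kar W (\<lambda>p. snd (d p)) R \<in> hom Kp W R"
  proof (rule kar_hom[OF W R])
    fix p b' assume "p \<in> fst W" and b': "(snd (d p), b') \<in> snd R"
    then obtain a b where ab: "p = e (a, b)" "(a, b) \<in> A" using Wc by blast
    then have bb': "(b, b') \<in> snd R" and a: "a \<in> fst Q" "pap f a = pap g b" using b' de unfolding A_def by auto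
    obtain a' where a': "(a, a') \<in> snd Q" "pap f a' = pap g b'"
      using Kp_lift[OF f a(1)] Kp_mono[OF g bb'] a(2) by metis
    then have A': "(a', b') \<in> A" using bb' fp_carrier[OF Q] fp_carrier[OF R] unfolding A_def by auto
    then show "\<exists>p'. (p, p') \<in> snd W \<and> snd (d p') = b'"
      using Wle[OF ab(2) A' a'(1) bb'] de[OF A'] ab(1) by (intro exI[of _ "e (a', b')"]) simp
  next
    fix p assume "p \<in> fst W" then show "snd (d p) \<in> fst R" using Wc de unfolding A_def by fastforce
  qed (use Wle' in blast)
  have c: "Cmp Kp f (kar W (\<lambda>p. fst (d p)) Q) = Cmp Kp g (kar W (\<lambda>p. snd (d p)) R)"
  proof (rule hom_Kp_eqI[OF cat_cmp[OF category_Kp u f] cat_cmp[OF category_Kp v g]])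
    fix p assume p: "p \<in> fst W"
    then obtain a b where ab: "p = e (a, b)" "(a, b) \<in> A" using Wc by blast
    then show "pap (Cmp Kp f (kar W (\<lambda>p. fst (d p)) Q)) p = pap (Cmp Kp g (kar W (\<lambda>p. snd (d p)) R)) p"
      using pap_Cmp[OF u f p] pap_Cmp[OF v g p] p de[OF ab(2)] unfolding A_def by simp
  qed
  have qr: "(q, r) \<in> A" using q r eq unfolding A_def by simp
  then have w: "e (q, r) \<in> fst W" unfolding W_def by simp
  show ?thesis using that[OF u v c w] w de[OF qr] by simp
qed

section \<open>Sheaves on finite posets\<close>

lemma op_cat_simps [simp]:
  "Obj (op_cat C) = Obj C" "Arr (op_cat C) = Arr C" "Dom (op_cat C) = Cod C" "Cod (op_cat C) = Dom C"
  "Ide (op_cat C) = Ide C" "Cmp (op_cat C) g f = Cmp C f g"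
  by (simp_all add: op_cat_def)

lemma hom_op_cat: "hom (op_cat C) a b = hom C b a"
  unfolding hom_def by auto

lemma category_op_cat:
  assumes C: "category C" shows "category (op_cat C)"
  unfolding category_def hom_op_cat op_cat_simps
proof (intro conjI ballI allI)
  fix f assume "f \<in> Arr C"
  then have "f \<in> hom C (Dom C f) (Cod C f)" by (simp add: hom_iff)
  from cat_obj[OF C this] show "Cod C f \<in> Obj C" "Dom C f \<in> Obj C" by simp_all
next
  fix a b c d f g h assume "f \<in> hom C b a" "g \<in> hom C c b" "h \<in> hom C d c"
  then show "Cmp C (Cmp C f g) h = Cmp C f (Cmp C g h)" using cat_assoc[OF C] by simp
qed (use cat_ide[OF C] cat_cmp[OF C] cat_idl[OF C] cat_idr[OF C] in auto)

lemma functor_cat_simps [simp]: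
  "Obj (functor_cat C D) = {F. is_functor C D F}"
  "Dom (functor_cat C D) (F, \<eta>, G) = F" "Cod (functor_cat C D) (F, \<eta>, G) = G"
  "Ide (functor_cat C D) F = (F, \<lambda>a\<in>Obj C. Ide D (fob F a), F)"
  "Cmp (functor_cat C D) (G', \<theta>, H) (F, \<eta>, G) = (F, \<lambda>a\<in>Obj C. Cmp D (\<theta> a) (\<eta> a), H)"
  by (simp_all add: functor_cat_def)

lemma hom_functor_cat:
  "m \<in> hom (functor_cat C D) F G \<longleftrightarrow> (\<exists>\<eta>. m = (F, \<eta>, G) \<and> nat_trans C D F G \<eta> \<and> \<eta> \<in> extensional (Obj C))"
  by (auto simp: hom_def functor_cat_def)

lemma nat_transD:
  assumes "nat_trans C D F G \<eta>"
  shows "is_functor C D F" "is_functor C D G" "a \<in> Obj C \<Longrightarrow> \<eta> a \<in> hom D (fob F a) (fob G a)"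
    "f \<in> hom C a b \<Longrightarrow> Cmp D (\<eta> b) (far F f) = Cmp D (far G f) (\<eta> a)"
  using assms unfolding nat_trans_def by blast+

lemma category_functor_cat: "category (functor_cat C D)"
  unfolding category_def
proof (intro conjI ballI allI)
  fix f assume "f \<in> Arr (functor_cat C D)"
  then show "Dom (functor_cat C D) f \<in> Obj (functor_cat C D)" "Cod (functor_cat C D) f \<in> Obj (functor_cat C D)"
    by (auto simp: functor_cat_def dest: nat_transD)
next
  fix F assume "F \<in> Obj (functor_cat C D)"
  then have F: "is_functor C D F" by simp
  have C: "category C" and D: "category D" using fun_cat[OF F] by auto
  have "nat_trans C D F F (\<lambda>a\<in>Obj C. Ide D (fob F a))"
    unfolding nat_trans_def
  proof (intro conjI ballI allI F)
    fix a assume "a \<in> Obj C"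
    then show "(\<lambda>a\<in>Obj C. Ide D (fob F a)) a \<in> hom D (fob F a) (fob F a)"
      using cat_ide[OF D fun_ob[OF F]] by simp
  next
    fix a b f assume f: "f \<in> hom C a b"
    show "Cmp D ((\<lambda>a\<in>Obj C. Ide D (fob F a)) b) (far F f) = Cmp D (far F f) ((\<lambda>a\<in>Obj C. Ide D (fob F a)) a)"
      using cat_obj[OF C f] cat_idl[OF D fun_ar[OF F f]] cat_idr[OF D fun_ar[OF F f]] by simp
  qed
  then show "Ide (functor_cat C D) F \<in> hom (functor_cat C D) F F" by (simp add: hom_functor_cat)
next
  fix F G H m n assume "m \<in> hom (functor_cat C D) F G" "n \<in> hom (functor_cat C D) G H"
  then obtain \<eta> \<theta> where m: "m = (F, \<eta>, G)" and n: "n = (G, \<theta>, H)"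
    and \<eta>: "nat_trans C D F G \<eta>" and \<theta>: "nat_trans C D G H \<theta>" by (auto simp: hom_functor_cat)
  note F = nat_transD(1)[OF \<eta>] and G = nat_transD(2)[OF \<eta>] and H = nat_transD(2)[OF \<theta>]
  have C: "category C" and D: "category D" using fun_cat[OF F] by auto
  have "nat_trans C D F H (\<lambda>a\<in>Obj C. Cmp D (\<theta> a) (\<eta> a))"
    unfolding nat_trans_def
  proof (intro conjI ballI allI F H)
    fix a assume "a \<in> Obj C"
    then show "(\<lambda>a\<in>Obj C. Cmp D (\<theta> a) (\<eta> a)) a \<in> hom D (fob F a) (fob H a)"
      using cat_cmp[OF D nat_transD(3)[OF \<eta>] nat_transD(3)[OF \<theta>]] by simp
  next
    fix a b f assume f: "f \<in> hom C a b"
    have a: "a \<in> Obj C" and b: "b \<in> Obj C" using cat_obj[OF C f] by auto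
    note Ff = fun_ar[OF F f] and Gf = fun_ar[OF G f] and Hf = fun_ar[OF H f]
    have "Cmp D (Cmp D (\<theta> b) (\<eta> b)) (far F f) = Cmp D (\<theta> b) (Cmp D (far G f) (\<eta> a))"
      using cat_assoc[OF D Ff nat_transD(3)[OF \<eta> b] nat_transD(3)[OF \<theta> b]] nat_transD(4)[OF \<eta> f] by simp
    also have "\<dots> = Cmp D (far H f) (Cmp D (\<theta> a) (\<eta> a))"
      using cat_assoc[OF D nat_transD(3)[OF \<eta> a] Gf nat_transD(3)[OF \<theta> b]] nat_transD(4)[OF \<theta> f]
        cat_assoc[OF D nat_transD(3)[OF \<eta> a] nat_transD(3)[OF \<theta> a] Hf] by simp
    finally show "Cmp D ((\<lambda>a\<in>Obj C. Cmp D (\<theta> a) (\<eta> a)) b) (far F f) =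
        Cmp D (far H f) ((\<lambda>a\<in>Obj C. Cmp D (\<theta> a) (\<eta> a)) a)" using a b by simp
  qed
  then show "Cmp (functor_cat C D) n m \<in> hom (functor_cat C D) F H" by (simp add: hom_functor_cat m n)
next
  fix F G m assume "m \<in> hom (functor_cat C D) F G"
  then obtain \<eta> where m: "m = (F, \<eta>, G)" and \<eta>: "nat_trans C D F G \<eta>" and e: "\<eta> \<in> extensional (Obj C)"
    by (auto simp: hom_functor_cat)
  have D: "category D" using fun_cat[OF nat_transD(1)[OF \<eta>]] by auto
  show "Cmp (functor_cat C D) m (Ide (functor_cat C D) F) = m"
    using cat_idr[OF D nat_transD(3)[OF \<eta>]] e by (auto simp: m intro!: extensionalityI[of _ "Obj C"])
  show "Cmp (functor_cat C D) (Ide (functor_cat C D) G) m = m"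
    using cat_idl[OF D nat_transD(3)[OF \<eta>]] e by (auto simp: m intro!: extensionalityI[of _ "Obj C"])
next
  fix F G H K m n k
  assume "m \<in> hom (functor_cat C D) F G" "n \<in> hom (functor_cat C D) G H" "k \<in> hom (functor_cat C D) H K"
  then obtain \<eta> \<theta> \<zeta> where m: "m = (F, \<eta>, G)" "n = (G, \<theta>, H)" "k = (H, \<zeta>, K)"
    and \<eta>: "nat_trans C D F G \<eta>" "nat_trans C D G H \<theta>" "nat_trans C D H K \<zeta>" by (auto simp: hom_functor_cat)
  have D: "category D" using fun_cat[OF nat_transD(1)[OF \<eta>(1)]] by auto
  show "Cmp (functor_cat C D) k (Cmp (functor_cat C D) n m) = Cmp (functor_cat C D) (Cmp (functor_cat C D) k n) m"
    using cat_assoc[OF D nat_transD(3)[OF \<eta>(1)] nat_transD(3)[OF \<eta>(2)] nat_transD(3)[OF \<eta>(3)]]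
    by (auto simp: m intro!: restrict_ext)
qed

lemma category_KK: "category (KK U)"
  unfolding KK_def Sh_def using category_full_sub[OF category_functor_cat] .

lemma Obj_KK: "x \<in> Obj (KK U) \<longleftrightarrow> is_sheaf U Kp J_surj x"
  by (auto simp: KK_def Sh_def is_sheaf_def)

lemma KK_functor: "x \<in> Obj (KK U) \<Longrightarrow> is_functor (op_cat Kp) (Sets U) x"
  by (simp add: Obj_KK is_sheaf_def)

definition rs where "rs x f a = app (far x f) a"

lemma far_hom: "x \<in> Obj (KK U) \<Longrightarrow> f \<in> hom Kp Q P \<Longrightarrow> far x f \<in> hom (Sets U) (fob x P) (fob x Q)"
  using fun_ar[OF KK_functor] by (metis hom_op_cat)

lemma rs_in: "x \<in> Obj (KK U) \<Longrightarrow> f \<in> hom Kp Q P \<Longrightarrow> a \<in> fob x P \<Longrightarrow> rs x f a \<in> fob x Q"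
  unfolding rs_def using app_in[OF far_hom] .

lemma rs_id: "x \<in> Obj (KK U) \<Longrightarrow> finite_poset P \<Longrightarrow> a \<in> fob x P \<Longrightarrow> rs x (Ide Kp P) a = a"
  using fun_id[OF KK_functor, of x U P] by (simp add: rs_def)

lemma rs_cmp:
  assumes x: "x \<in> Obj (KK U)" and f: "f \<in> hom Kp Q P" and g: "g \<in> hom Kp R Q" and a: "a \<in> fob x P"
  shows "rs x g (rs x f a) = rs x (Cmp Kp f g) a"
proof -
  have "far x (Cmp Kp f g) = Cmp (Sets U) (far x g) (far x f)"
    using fun_cmp[OF KK_functor[OF x], of f P Q g R] f g by (simp add: hom_op_cat)
  then show ?thesis using app_Cmp[OF far_hom[OF x f] far_hom[OF x g] a] by (simp add: rs_def)
qed

lemma fob_in_U: "x \<in> Obj (KK U) \<Longrightarrow> finite_poset P \<Longrightarrow> fob x P \<in> U"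
  using fun_ob[OF KK_functor, of x U P] by simp

text \<open>Gluing is checked on jointly surjective families rather than on sieves; the sieve
  \<open>gen\<close> generated by such a family is covering.\<close>

definition cov where
  "cov P G \<longleftrightarrow> (\<forall>g\<in>G. g \<in> hom Kp (Dom Kp g) P) \<and> (\<forall>p\<in>fst P. \<exists>g\<in>G. \<exists>q\<in>fst (Dom Kp g). pap g q = p)"

definition gen where
  "gen G = {h. \<exists>g\<in>G. \<exists>R. \<exists>u\<in>hom Kp R (Dom Kp g). h = Cmp Kp g u}"

lemma covD: "cov P G \<Longrightarrow> g \<in> G \<Longrightarrow> g \<in> hom Kp (Dom Kp g) P" unfolding cov_def by blast

lemma gen_J:
  assumes G: "cov P G" shows "gen G \<in> J_surj P"
  unfolding J_surj_def sieve_def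
proof (clarify, intro conjI ballI impI)
  show "gen G \<subseteq> {f \<in> Arr Kp. Cod Kp f = P}"
    using cat_cmp[OF category_Kp _ covD[OF G]] unfolding gen_def by (force simp: hom_iff)
next
  fix f h assume "f \<in> gen G" and h: "h \<in> Arr Kp" "Cod Kp h = Dom Kp f"
  then obtain g R u where g: "g \<in> G" "u \<in> hom Kp R (Dom Kp g)" "f = Cmp Kp g u" unfolding gen_def by blast
  have "Dom Kp f = R" using hom_D(2)[OF cat_cmp[OF category_Kp g(2) covD[OF G g(1)]]] g(3) by simp
  then have hh: "h \<in> hom Kp (Dom Kp h) R" using h by (simp add: hom_iff)
  have "Cmp Kp f h = Cmp Kp g (Cmp Kp u h)"
    using cat_assoc[OF category_Kp hh g(2) covD[OF G g(1)]] g(3) by simp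
  then show "Cmp Kp f h \<in> gen G" using cat_cmp[OF category_Kp hh g(2)] g(1) unfolding gen_def by blast
next
  fix p assume "p \<in> fst P"
  then obtain g q where g: "g \<in> G" "q \<in> fst (Dom Kp g)" "pap g q = p" using G unfolding cov_def by blast
  note gh = covD[OF G g(1)]
  have "g = Cmp Kp g (Ide Kp (Dom Kp g))" using cat_idr[OF category_Kp gh] by simp
  then have "g \<in> gen G" using g(1) cat_ide[OF category_Kp cat_obj(1)[OF category_Kp gh]] unfolding gen_def by blast
  moreover obtain f where "g = (Dom Kp g, f, P)" using gh by (auto simp: hom_Kp)
  ultimately show "\<exists>(Q, f, P')\<in>gen G. p \<in> f ` fst Q" using g(2,3)
    by (intro bexI[of _ g]) (auto simp: pap_def split: prod.splits)
qed

lemma sheafD: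
  assumes "x \<in> Obj (KK U)" "finite_poset P" "S \<in> J_surj P" "matching_family Kp x S y"
  shows "\<exists>!a. a \<in> fob x P \<and> (\<forall>f\<in>S. rs x f a = y f)"
  using assms unfolding Obj_KK is_sheaf_def rs_def by simp

text \<open>The sheaf condition for a covering family, with compatibility over every common
  refinement \<open>R\<close>. A family on generators extends to the generated sieve, because the
  value along a factorization does not depend on the factorization.\<close>

lemma glue_ex1:
  assumes x: "x \<in> Obj (KK U)" and P: "finite_poset P" and G: "cov P G"
    and t: "\<And>g. g \<in> G \<Longrightarrow> t g \<in> fob x (Dom Kp g)"
    and compat: "\<And>g g' R u u'. g \<in> G \<Longrightarrow> g' \<in> G \<Longrightarrow> u \<in> hom Kp R (Dom Kp g) \<Longrightarrow> u' \<in> hom Kp R (Dom Kp g') \<Longrightarrow>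
      Cmp Kp g u = Cmp Kp g' u' \<Longrightarrow> rs x u (t g) = rs x u' (t g')"
  shows "\<exists>!a. a \<in> fob x P \<and> (\<forall>g\<in>G. rs x g a = t g)"
proof -
  define y where "y f = (SOME a. \<exists>g\<in>G. \<exists>R. \<exists>u\<in>hom Kp R (Dom Kp g). f = Cmp Kp g u \<and> a = rs x u (t g))" for f
  have y: "y (Cmp Kp g u) = rs x u (t g)" if g: "g \<in> G" and u: "u \<in> hom Kp R (Dom Kp g)" for g R u
  proof -
    have "\<exists>a. \<exists>g'\<in>G. \<exists>R. \<exists>u'\<in>hom Kp R (Dom Kp g'). Cmp Kp g u = Cmp Kp g' u' \<and> a = rs x u' (t g')"
      using g u by blast
    from someI_ex[OF this] obtain g' R' u' where h: "g' \<in> G" "u' \<in> hom Kp R' (Dom Kp g')"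
      "Cmp Kp g u = Cmp Kp g' u'" "y (Cmp Kp g u) = rs x u' (t g')" unfolding y_def by blast
    have "R' = R"
      using hom_D(2)[OF cat_cmp[OF category_Kp u covD[OF G g]]] hom_D(2)[OF cat_cmp[OF category_Kp h(2) covD[OF G h(1)]]] h(3)
      by simp
    then show ?thesis using compat[OF g h(1) u] h by simp
  qed
  have m: "matching_family Kp x (gen G) y"
    unfolding matching_family_def
  proof (intro conjI ballI impI)
    fix f assume "f \<in> gen G"
    then obtain g R u where g: "g \<in> G" "u \<in> hom Kp R (Dom Kp g)" "f = Cmp Kp g u" unfolding gen_def by blast
    have "Dom Kp f = R" using hom_D(2)[OF cat_cmp[OF category_Kp g(2) covD[OF G g(1)]]] g(3) by simp
    then show "y f \<in> fob x (Dom Kp f)" using y[OF g(1,2)] rs_in[OF x g(2) t[OF g(1)]] g(3) by simp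
    fix h assume h: "h \<in> Arr Kp" "Cod Kp h = Dom Kp f"
    then have hh: "h \<in> hom Kp (Dom Kp h) R" using \<open>Dom Kp f = R\<close> by (simp add: hom_iff)
    have "Cmp Kp f h = Cmp Kp g (Cmp Kp u h)"
      using cat_assoc[OF category_Kp hh g(2) covD[OF G g(1)]] g(3) by simp
    then have "y (Cmp Kp f h) = rs x (Cmp Kp u h) (t g)"
      using y[OF g(1) cat_cmp[OF category_Kp hh g(2)]] by simp
    then show "app (far x h) (y f) = y (Cmp Kp f h)"
      using rs_cmp[OF x g(2) hh t[OF g(1)]] y[OF g(1,2)] g(3) by (simp add: rs_def)
  qed
  have eq: "(\<forall>f\<in>gen G. rs x f a = y f) \<longleftrightarrow> (\<forall>g\<in>G. rs x g a = t g)" if a: "a \<in> fob x P" for a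
  proof
    assume h: "\<forall>f\<in>gen G. rs x f a = y f"
    show "\<forall>g\<in>G. rs x g a = t g"
    proof
      fix g assume g: "g \<in> G"
      note gh = covD[OF G g]
      note i = cat_ide[OF category_Kp cat_obj(1)[OF category_Kp gh]]
      have gi: "Cmp Kp g (Ide Kp (Dom Kp g)) = g" using cat_idr[OF category_Kp gh] .
      then have "g \<in> gen G" using g i unfolding gen_def by (metis (mono_tags, lifting) mem_Collect_eq)
      then have "rs x g a = y g" using h by blast
      also have "\<dots> = t g" using y[OF g i] gi rs_id[OF x hom_Kp_fp(1)[OF gh] t[OF g]] by simp
      finally show "rs x g a = t g" .
    qed
  next
    assume h: "\<forall>g\<in>G. rs x g a = t g"
    show "\<forall>f\<in>gen G. rs x f a = y f"
    proof
      fix f assume "f \<in> gen G"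
      then obtain g R u where g: "g \<in> G" "u \<in> hom Kp R (Dom Kp g)" "f = Cmp Kp g u" unfolding gen_def by blast
      then show "rs x f a = y f" using y[OF g(1,2)] rs_cmp[OF x covD[OF G g(1)] g(2) a] h by simp
    qed
  qed
  have "\<exists>!a. a \<in> fob x P \<and> (\<forall>f\<in>gen G. rs x f a = y f)" using sheafD[OF x P gen_J[OF G] m] .
  then show ?thesis using eq by (simp cong: conj_cong)
qed

text \<open>Both sections are amalgamations of the family of restrictions of
  \<open>a\<close>.\<close>

lemma separated:
  assumes x: "x \<in> Obj (KK U)" and G: "cov P G" and P: "finite_poset P" and a: "a \<in> fob x P" and b: "b \<in> fob x P"
    and eq: "\<And>g. g \<in> G \<Longrightarrow> rs x g a = rs x g b"
  shows "a = b"
proof -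
  have "\<exists>!c. c \<in> fob x P \<and> (\<forall>g\<in>G. rs x g c = rs x g a)"
  proof (rule glue_ex1[OF x P G])
    fix g assume "g \<in> G" then show "rs x g a \<in> fob x (Dom Kp g)" using rs_in[OF x covD[OF G] a] by blast
  next
    fix g g' R u u' assume h: "g \<in> G" "g' \<in> G" "u \<in> hom Kp R (Dom Kp g)" "u' \<in> hom Kp R (Dom Kp g')"
      "Cmp Kp g u = Cmp Kp g' u'"
    show "rs x u (rs x g a) = rs x u' (rs x g' a)"
      using rs_cmp[OF x covD[OF G h(1)] h(3) a] rs_cmp[OF x covD[OF G h(2)] h(4) a] h(5) by simp
  qed
  then obtain c where c: "\<forall>c'. c' \<in> fob x P \<and> (\<forall>g\<in>G. rs x g c' = rs x g a) \<longrightarrow> c' = c" by (rule ex1E)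
  have "a = c" by (rule c[rule_format]) (simp add: a)
  moreover have "b = c" by (rule c[rule_format]) (simp add: b eq)
  ultimately show ?thesis by simp
qed

lemma cov_single: "f \<in> hom Kp Q P \<Longrightarrow> (\<And>p. p \<in> fst P \<Longrightarrow> \<exists>q\<in>fst Q. pap f q = p) \<Longrightarrow> cov P {f}"
  unfolding cov_def by (auto simp: hom_D)

text \<open>The standard covering on which local properties of sections are tested: each element is
  hit by its own principal upset.\<close>

lemma cov_up:
  assumes "finite_poset P" shows "cov P ((\<lambda>p. inc P (up P p)) ` fst P)"
  unfolding cov_def
proof (intro conjI ballI)
  fix g assume "g \<in> (\<lambda>p. inc P (up P p)) ` fst P"
  then show "g \<in> hom Kp (Dom Kp g) P" using inc_hom[OF assms upset_up[OF assms]] by (auto simp: hom_iff)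
next
  fix p assume p: "p \<in> fst P"
  have "Dom Kp (inc P (up P p)) = sub P (up P p)" by (simp add: inc_def)
  then show "\<exists>g\<in>(\<lambda>p. inc P (up P p)) ` fst P. \<exists>q\<in>fst (Dom Kp g). pap g q = p"
    using p in_up[OF assms p] by (auto intro!: bexI[of _ "inc P (up P p)"] bexI[of _ p])
qed

text \<open>The empty family covers the empty poset.\<close>

lemma fob_empty:
  assumes x: "x \<in> Obj (KK U)" and P: "finite_poset P" "fst P = {}"
  shows "\<exists>!a. a \<in> fob x P"
proof -
  have "cov P {}" using P unfolding cov_def by simp
  from glue_ex1[OF x P(1) this, of "\<lambda>_. undefined"] show ?thesis by simp
qed

subsection \<open>Morphisms of sheaves\<close>

definition cp :: "'u psharr \<Rightarrow> poset \<Rightarrow> 'u \<Rightarrow> 'u" where "cp m P = app (fst (snd m) P)"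

text \<open>Both the components and the family of components are made extensional, so that arrows
  are equal when they act equally on sections.\<close>

definition mkm :: "'u psh \<Rightarrow> 'u psh \<Rightarrow> (poset \<Rightarrow> 'u \<Rightarrow> 'u) \<Rightarrow> 'u psharr" where
  "mkm x y h = (x, \<lambda>P\<in>Obj Kp. (fob x P, restrict (h P) (fob x P), fob y P), y)"

lemma hom_KK: "m \<in> hom (KK U) x y \<longleftrightarrow> x \<in> Obj (KK U) \<and> y \<in> Obj (KK U) \<and>
    (\<exists>\<eta>. m = (x, \<eta>, y) \<and> nat_trans (op_cat Kp) (Sets U) x y \<eta> \<and> \<eta> \<in> extensional (Obj Kp))"
  unfolding Obj_KK by (auto simp: KK_def Sh_def hom_full_sub hom_functor_cat)

lemma hom_KK_obj: "m \<in> hom (KK U) x y \<Longrightarrow> x \<in> Obj (KK U)" "m \<in> hom (KK U) x y \<Longrightarrow> y \<in> Obj (KK U)"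
  by (simp_all add: hom_KK)

lemma cp_comp: "m \<in> hom (KK U) x y \<Longrightarrow> finite_poset P \<Longrightarrow> fst (snd m) P \<in> hom (Sets U) (fob x P) (fob y P)"
  by (auto simp: hom_KK dest: nat_transD(3))

lemma cp_in: "m \<in> hom (KK U) x y \<Longrightarrow> finite_poset P \<Longrightarrow> a \<in> fob x P \<Longrightarrow> cp m P a \<in> fob y P"
  unfolding cp_def using app_in[OF cp_comp] .

lemma cp_nat:
  assumes m: "m \<in> hom (KK U) x y" and f: "f \<in> hom Kp Q P" and a: "a \<in> fob x P"
  shows "cp m Q (rs x f a) = rs y f (cp m P a)"
proof -
  note x = hom_KK_obj(1)[OF m] and y = hom_KK_obj(2)[OF m] and P = hom_Kp_fp(2)[OF f] and Q = hom_Kp_fp(1)[OF f]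
  obtain \<eta> where \<eta>: "m = (x, \<eta>, y)" "nat_trans (op_cat Kp) (Sets U) x y \<eta>" using m by (auto simp: hom_KK)
  have "f \<in> hom (op_cat Kp) P Q" using f by (simp add: hom_op_cat)
  from nat_transD(4)[OF \<eta>(2) this]
  have "Cmp (Sets U) (fst (snd m) Q) (far x f) = Cmp (Sets U) (far y f) (fst (snd m) P)" using \<eta>(1) by simp
  then have "app (Cmp (Sets U) (fst (snd m) Q) (far x f)) a = app (Cmp (Sets U) (far y f) (fst (snd m) P)) a" by simp
  then show ?thesis
    using app_Cmp[OF far_hom[OF x f] cp_comp[OF m Q] a] app_Cmp[OF cp_comp[OF m P] far_hom[OF y f] a]
    by (simp add: cp_def rs_def)
qed

lemma KK_eqI:
  assumes m: "m \<in> hom (KK U) x y" and n: "n \<in> hom (KK U) x y"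
    and eq: "\<And>P a. finite_poset P \<Longrightarrow> a \<in> fob x P \<Longrightarrow> cp m P a = cp n P a"
  shows "m = n"
proof -
  obtain \<eta> \<theta> where \<eta>: "m = (x, \<eta>, y)" "\<eta> \<in> extensional (Obj Kp)" and \<theta>: "n = (x, \<theta>, y)" "\<theta> \<in> extensional (Obj Kp)"
    using m n by (auto simp: hom_KK)
  have "\<eta> = \<theta>"
  proof (rule extensionalityI[OF \<eta>(2) \<theta>(2)])
    fix P assume "P \<in> Obj Kp"
    then have P: "finite_poset P" by simp
    show "\<eta> P = \<theta> P"
      using hom_Sets_eqI[OF cp_comp[OF m P] cp_comp[OF n P]] eq[OF P] \<eta>(1) \<theta>(1) by (simp add: cp_def)
  qed
  then show ?thesis using \<eta> \<theta> by simp
qed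

lemma cp_mkm [simp]: "finite_poset P \<Longrightarrow> a \<in> fob x P \<Longrightarrow> cp (mkm x y h) P a = h P a"
  by (simp add: cp_def mkm_def)

lemma mkm_hom:
  assumes x: "x \<in> Obj (KK U)" and y: "y \<in> Obj (KK U)"
    and h: "\<And>P a. finite_poset P \<Longrightarrow> a \<in> fob x P \<Longrightarrow> h P a \<in> fob y P"
    and nat: "\<And>P Q f a. f \<in> hom Kp Q P \<Longrightarrow> a \<in> fob x P \<Longrightarrow> h Q (rs x f a) = rs y f (h P a)"
  shows "mkm x y h \<in> hom (KK U) x y"
proof -
  let ?\<eta> = "\<lambda>P\<in>Obj Kp. (fob x P, restrict (h P) (fob x P), fob y P)"
  have \<eta>: "?\<eta> P \<in> hom (Sets U) (fob x P) (fob y P)" if "finite_poset P" for P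
    using that h fob_in_U[OF x] fob_in_U[OF y] by (simp add: hom_Sets)
  have "nat_trans (op_cat Kp) (Sets U) x y ?\<eta>"
    unfolding nat_trans_def hom_op_cat
  proof (intro conjI ballI allI KK_functor[OF x] KK_functor[OF y])
    fix P assume "P \<in> Obj (op_cat Kp)"
    then show "?\<eta> P \<in> hom (Sets U) (fob x P) (fob y P)" using \<eta> by simp
  next
    fix P Q f assume f: "f \<in> hom Kp Q P"
    note P = hom_Kp_fp(2)[OF f] and Q = hom_Kp_fp(1)[OF f]
    show "Cmp (Sets U) (?\<eta> Q) (far x f) = Cmp (Sets U) (far y f) (?\<eta> P)"
    proof (rule hom_Sets_eqI[OF cat_cmp[OF category_Sets far_hom[OF x f] \<eta>[OF Q]]
          cat_cmp[OF category_Sets \<eta>[OF P] far_hom[OF y f]]])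
      fix a assume a: "a \<in> fob x P"
      show "app (Cmp (Sets U) (?\<eta> Q) (far x f)) a = app (Cmp (Sets U) (far y f) (?\<eta> P)) a"
        unfolding app_Cmp[OF far_hom[OF x f] \<eta>[OF Q] a] app_Cmp[OF \<eta>[OF P] far_hom[OF y f] a]
        using nat[OF f a] rs_in[OF x f a] P Q a by (simp add: rs_def)
    qed
  qed
  then show ?thesis using x y by (simp add: hom_KK mkm_def)
qed

lemma Cmp_KK: "Cmp (KK U) = Cmp (functor_cat (op_cat Kp) (Sets U))" "Ide (KK U) = Ide (functor_cat (op_cat Kp) (Sets U))"
  by (simp_all add: KK_def Sh_def)

lemma cp_Cmp:
  assumes m: "m \<in> hom (KK U) x y" and n: "n \<in> hom (KK U) y z" and P: "finite_poset P" and a: "a \<in> fob x P"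
  shows "cp (Cmp (KK U) n m) P a = cp n P (cp m P a)"
proof -
  have "fst (snd (Cmp (KK U) n m)) P = Cmp (Sets U) (fst (snd n) P) (fst (snd m) P)"
    using m n P by (auto simp: hom_KK Cmp_KK)
  then show ?thesis unfolding cp_def using app_Cmp[OF cp_comp[OF m P] cp_comp[OF n P] a] by simp
qed

lemma cp_Ide: "finite_poset P \<Longrightarrow> a \<in> fob x P \<Longrightarrow> cp (Ide (KK U) x) P a = a"
  by (simp add: cp_def Cmp_KK)

text \<open>The factorization is the componentwise inverse image; it is natural because the
  injective components of \<open>m\<close> can be cancelled.\<close>

lemma factor_mono:
  assumes m: "m \<in> hom (KK U) a b" and inj: "\<And>P. finite_poset P \<Longrightarrow> inj_on (cp m P) (fob a P)"
    and u: "u \<in> hom (KK U) k b" and im: "\<And>P t. finite_poset P \<Longrightarrow> t \<in> fob k P \<Longrightarrow> cp u P t \<in> cp m P ` fob a P"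
  obtains h where "h \<in> hom (KK U) k a" "Cmp (KK U) m h = u"
proof -
  define h where "h P t = inv_into (fob a P) (cp m P) (cp u P t)" for P t
  have h: "h P t \<in> fob a P" "cp m P (h P t) = cp u P t" if "finite_poset P" "t \<in> fob k P" for P t
    using im[OF that] unfolding h_def by (simp_all add: inv_into_into f_inv_into_f)
  note a = hom_KK_obj(1)[OF m] and k = hom_KK_obj(1)[OF u]
  have hh: "mkm k a h \<in> hom (KK U) k a"
  proof (rule mkm_hom[OF k a h(1)])
    fix P Q f t assume f: "f \<in> hom Kp Q P" and t: "t \<in> fob k P"
    note P = hom_Kp_fp(2)[OF f] and Q = hom_Kp_fp(1)[OF f]
    note kt = rs_in[OF k f t]
    have "cp m Q (h Q (rs k f t)) = rs b f (cp u P t)" using h(2)[OF Q kt] cp_nat[OF u f t] by simp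
    also have "\<dots> = cp m Q (rs a f (h P t))" using cp_nat[OF m f h(1)[OF P t]] h(2)[OF P t] by simp
    finally show "h Q (rs k f t) = rs a f (h P t)"
      using inj_onD[OF inj[OF Q] _ h(1)[OF Q kt] rs_in[OF a f h(1)[OF P t]]] by simp
  qed
  have "Cmp (KK U) m (mkm k a h) = u"
    by (rule KK_eqI[OF cat_cmp[OF category_KK hh m] u]) (simp add: cp_Cmp[OF hh m] h)
  then show ?thesis using that hh by blast
qed

lemma inj_monic:
  assumes m: "m \<in> hom (KK U) a b" and inj: "\<And>P. finite_poset P \<Longrightarrow> inj_on (cp m P) (fob a P)"
    and f: "f \<in> hom (KK U) k a" and g: "g \<in> hom (KK U) k a" and eq: "Cmp (KK U) m f = Cmp (KK U) m g"
  shows "f = g"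
proof (rule KK_eqI[OF f g])
  fix P t assume P: "finite_poset P" and t: "t \<in> fob k P"
  have "cp m P (cp f P t) = cp m P (cp g P t)" using cp_Cmp[OF f m P t] cp_Cmp[OF g m P t] eq by simp
  then show "cp f P t = cp g P t" using inj_onD[OF inj[OF P]] cp_in[OF f P t] cp_in[OF g P t] by blast
qed

lemma monicI:
  assumes m: "m \<in> hom (KK U) a b" and inj: "\<And>P. finite_poset P \<Longrightarrow> inj_on (cp m P) (fob a P)"
  shows "monic (KK U) m"
  unfolding monic_def hom_D(2)[OF m] using inj_monic[OF m inj] hom_D(1)[OF m] by blast

text \<open>Surjectivity lets the identity of \<open>y\<close> factor through \<open>m\<close>. This
  gives a right inverse, which is also a left inverse because \<open>m\<close> can be
  cancelled.\<close>

lemma is_iso_KKI: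
  assumes m: "m \<in> hom (KK U) x y" and bij: "\<And>P. finite_poset P \<Longrightarrow> bij_betw (cp m P) (fob x P) (fob y P)"
  shows "is_iso (KK U) m"
proof -
  note x = hom_KK_obj(1)[OF m] and y = hom_KK_obj(2)[OF m]
  note ix = cat_ide[OF category_KK x] and iy = cat_ide[OF category_KK y]
  have inj: "inj_on (cp m P) (fob x P)" if "finite_poset P" for P using bij[OF that] by (simp add: bij_betw_def)
  have im: "cp (Ide (KK U) y) P t \<in> cp m P ` fob x P" if "finite_poset P" "t \<in> fob y P" for P t
    using bij[OF that(1)] that cp_Ide[OF that] by (simp add: bij_betw_def)
  obtain h where h: "h \<in> hom (KK U) y x" "Cmp (KK U) m h = Ide (KK U) y" using factor_mono[OF m inj iy im] .
  have "Cmp (KK U) m (Cmp (KK U) h m) = Cmp (KK U) m (Ide (KK U) x)"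
    using cat_assoc[OF category_KK m h(1) m] h(2) cat_idl[OF category_KK m] cat_idr[OF category_KK m] by simp
  then have "Cmp (KK U) h m = Ide (KK U) x"
    using inj_monic[OF m inj cat_cmp[OF category_KK m h(1)] ix] by blast
  then show ?thesis using is_isoI[OF m h(1) _ h(2)] by blast
qed

subsection \<open>Presheaves of arbitrary small sets\<close>

text \<open>Turns a presheaf with values of any type into one with values in the universe.
  Representable sheaves and the sheaves in the image of \<nabla> are both of this form.\<close>

definition coded :: "'u set set \<Rightarrow> (poset \<Rightarrow> 'x set) \<Rightarrow> (posetarr \<Rightarrow> 'x \<Rightarrow> 'x) \<Rightarrow> 'u psh" where
  "coded U X act = \<lparr>fob = (\<lambda>P. small_set U (X P)),
     far = (\<lambda>f. small_map U (X (Cod Kp f)) (X (Dom Kp f)) (act f))\<rparr>"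

lemma fob_coded: "fob (coded U X act) P = small_set U (X P)" by (simp add: coded_def)

lemma rs_coded:
  assumes "small U (X P)" "f \<in> hom Kp Q P" "s \<in> X P"
  shows "rs (coded U X act) f (code U (X P) s) = code U (X Q) (act f s)"
  using assms by (simp add: coded_def rs_def hom_D[OF assms(2)] app_small_map)

text \<open>All hypotheses concern the sets before coding, so that the sheaf condition can be
  verified for actual arrows or functions.\<close>

lemma coded_KK:
  assumes sm: "\<And>P. finite_poset P \<Longrightarrow> small U (X P)"
    and act: "\<And>P Q f s. f \<in> hom Kp Q P \<Longrightarrow> s \<in> X P \<Longrightarrow> act f s \<in> X Q"
    and act_id: "\<And>P s. finite_poset P \<Longrightarrow> s \<in> X P \<Longrightarrow> act (Ide Kp P) s = s"
    and act_cmp: "\<And>P Q R f g s. f \<in> hom Kp Q P \<Longrightarrow> g \<in> hom Kp R Q \<Longrightarrow> s \<in> X P \<Longrightarrow> act (Cmp Kp f g) s = act g (act f s)"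
    and sheaf: "\<And>P S y. finite_poset P \<Longrightarrow> S \<in> J_surj P \<Longrightarrow> (\<And>f. f \<in> S \<Longrightarrow> y f \<in> X (Dom Kp f)) \<Longrightarrow>
      (\<And>f g R. f \<in> S \<Longrightarrow> g \<in> hom Kp R (Dom Kp f) \<Longrightarrow> act g (y f) = y (Cmp Kp f g)) \<Longrightarrow>
      \<exists>!s. s \<in> X P \<and> (\<forall>f\<in>S. act f s = y f)"
  shows "coded U X act \<in> Obj (KK U)" (is "?x \<in> _")
  unfolding Obj_KK is_sheaf_def
proof (intro conjI ballI allI impI)
  show "is_functor (op_cat Kp) (Sets U) ?x"
  proof (rule is_functorI[OF category_op_cat[OF category_Kp] category_Sets], unfold hom_op_cat op_cat_simps)
    fix P assume "P \<in> Obj Kp" then show "fob ?x P \<in> Obj (Sets U)" using sm by (simp add: fob_coded small_set_in)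
  next
    fix P Q f assume f: "f \<in> hom Kp Q P"
    show "far ?x f \<in> hom (Sets U) (fob ?x P) (fob ?x Q)"
      using small_map_hom[OF sm[OF hom_Kp_fp(2)[OF f]] sm[OF hom_Kp_fp(1)[OF f]] act[OF f]]
      by (simp add: coded_def hom_D[OF f])
  next
    fix P assume "P \<in> Obj Kp"
    then have P: "finite_poset P" by simp
    show "far ?x (Ide Kp P) = Ide (Sets U) (fob ?x P)"
      using small_map_id[OF sm[OF P] act_id[OF P]] by (simp add: coded_def)
  next
    fix P Q R f g assume f: "f \<in> hom Kp Q P" and g: "g \<in> hom Kp R Q"
    note fg = cat_cmp[OF category_Kp g f]
    show "far ?x (Cmp Kp f g) = Cmp (Sets U) (far ?x g) (far ?x f)"
      using small_map_Cmp[where h = "act f" and k = "act g" and r = "act (Cmp Kp f g)",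
          OF sm[OF hom_Kp_fp(2)[OF f]] sm[OF hom_Kp_fp(1)[OF f]] sm[OF hom_Kp_fp(1)[OF g]]
          act[OF f] act[OF g] act_cmp[OF f g]]
      by (simp add: coded_def hom_D[OF f] hom_D[OF g] hom_D[OF fg])
  qed
next
  fix P S y assume "P \<in> Obj Kp" and S: "S \<in> J_surj P" and mf: "matching_family Kp ?x S y"
  then have P: "finite_poset P" by simp
  have Sh: "f \<in> hom Kp (Dom Kp f) P" if "f \<in> S" for f using S that unfolding J_surj_def sieve_def by (auto simp: hom_iff)
  have yin: "y f \<in> small_set U (X (Dom Kp f))" if "f \<in> S" for f
    using mf that unfolding matching_family_def by (simp add: fob_coded)
  \<comment> \<open>The matching family with its values decoded.\<close>
  define z where "z f = inv_into (X (Dom Kp f)) (code U (X (Dom Kp f))) (y f)" for f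
  have z: "z f \<in> X (Dom Kp f)" "y f = code U (X (Dom Kp f)) (z f)" if "f \<in> S" for f
    using yin[OF that] unfolding z_def small_set_def by (simp_all add: inv_into_into f_inv_into_f)
  have "\<exists>!s. s \<in> X P \<and> (\<forall>f\<in>S. act f s = z f)"
  proof (rule sheaf[OF P S z(1)])
    fix f g R assume f: "f \<in> S" and g: "g \<in> hom Kp R (Dom Kp f)"
    note fh = Sh[OF f]
    have fg: "Cmp Kp f g \<in> S" using S f g unfolding J_surj_def sieve_def by (auto simp: hom_iff)
    have D: "Dom Kp (Cmp Kp f g) = R" using hom_D(2)[OF cat_cmp[OF category_Kp g fh]] .
    have "app (far ?x g) (y f) = y (Cmp Kp f g)"
      using mf f g unfolding matching_family_def by (simp add: hom_iff)
    then have "code U (X R) (act g (z f)) = code U (X R) (z (Cmp Kp f g))"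
      using z(2)[OF f] z(2)[OF fg] D rs_coded[of U X, OF sm[OF hom_Kp_fp(2)[OF g]] g z(1)[OF f], of act] by (simp add: rs_def)
    then show "act g (z f) = z (Cmp Kp f g)"
      using code_eq_iff[OF sm[OF hom_Kp_fp(1)[OF g]] act[OF g z(1)[OF f]], of "z (Cmp Kp f g)"] z(1)[OF fg] D
      by simp
  qed
  then obtain s where s0: "s \<in> X P \<and> (\<forall>f\<in>S. act f s = z f)"
    and su: "\<forall>s'. s' \<in> X P \<and> (\<forall>f\<in>S. act f s' = z f) \<longrightarrow> s' = s" by (rule ex1E)
  then have s: "s \<in> X P" "\<And>f. f \<in> S \<Longrightarrow> act f s = z f" by blast+
  have rsc: "app (far ?x f) (code U (X P) s') = code U (X (Dom Kp f)) (act f s')" if "f \<in> S" "s' \<in> X P" for f s'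
    using rs_coded[of U X, OF sm[OF P] Sh[OF that(1)] that(2), of act] by (simp add: rs_def)
  show "\<exists>!a. a \<in> fob ?x P \<and> (\<forall>f\<in>S. app (far ?x f) a = y f)"
  proof (rule ex1I[of _ "code U (X P) s"], intro conjI ballI)
    show "code U (X P) s \<in> fob ?x P" using s(1) by (simp add: fob_coded code_in)
    fix f assume f: "f \<in> S"
    show "app (far ?x f) (code U (X P) s) = y f" using rsc[OF f s(1)] s(2)[OF f] z(2)[OF f] by simp
  next
    fix a assume a: "a \<in> fob ?x P \<and> (\<forall>f\<in>S. app (far ?x f) a = y f)"
    then obtain s' where s': "s' \<in> X P" "a = code U (X P) s'" by (auto simp: fob_coded elim: small_setE)
    have "s' = s"
    proof (rule su[rule_format], intro conjI ballI s'(1))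
      fix f assume f: "f \<in> S"
      have "code U (X (Dom Kp f)) (act f s') = code U (X (Dom Kp f)) (z f)"
        using a f s'(2) rsc[OF f s'(1)] z(2)[OF f] by simp
      then show "act f s' = z f"
        using code_eq_iff[OF sm[OF hom_Kp_fp(1)[OF Sh[OF f]]] act[OF Sh[OF f] s'(1)] z(1)[OF f]] by simp
    qed
    then show "a = code U (X P) s" using s'(2) by simp
  qed
qed

lemma J_hom: "S \<in> J_surj P \<Longrightarrow> f \<in> S \<Longrightarrow> f \<in> hom Kp (Dom Kp f) P"
  unfolding J_surj_def sieve_def by (auto simp: hom_iff)

lemma J_cmp: "S \<in> J_surj P \<Longrightarrow> f \<in> S \<Longrightarrow> g \<in> hom Kp R (Dom Kp f) \<Longrightarrow> Cmp Kp f g \<in> S"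
  unfolding J_surj_def sieve_def by (auto simp: hom_iff)

lemma J_surjE:
  assumes "S \<in> J_surj P" "p \<in> fst P"
  obtains f q where "f \<in> S" "q \<in> fst (Dom Kp f)" "pap f q = p"
proof -
  obtain Q f P' where "(Q, f, P') \<in> S" "p \<in> f ` fst Q" using assms unfolding J_surj_def by blast
  then show ?thesis using that[of "(Q, f, P')"] by (auto simp: pap_def)
qed

section \<open>Representable sheaves\<close>

lemma finite_hom_Kp: "finite_poset Q \<Longrightarrow> finite_poset P \<Longrightarrow> finite (hom Kp Q P)"
proof (rule finite_subset)
  show "hom Kp Q P \<subseteq> (\<lambda>f. (Q, f, P)) ` (fst Q \<rightarrow>\<^sub>E fst P)" by (auto simp: hom_Kp open_map_def)
  show "finite_poset Q \<Longrightarrow> finite_poset P \<Longrightarrow> finite ((\<lambda>f. (Q, f, P)) ` (fst Q \<rightarrow>\<^sub>E fst P))"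
    using fp_finite by (intro finite_imageI finite_PiE) auto
qed

locale small_universe =
  fixes U :: "'u set set" assumes U: "set_universe U"
begin

definition Y :: "poset \<Rightarrow> 'u psh" where "Y P = coded U (\<lambda>Q. hom Kp Q P) (\<lambda>f g. Cmp Kp g f)"

text \<open>The section of the representable sheaf \<open>Y P\<close> over the domain of
  \<open>g\<close> that corresponds to \<open>g\<close>.\<close>

definition en :: "poset \<Rightarrow> posetarr \<Rightarrow> 'u" where "en P g = code U (hom Kp (Dom Kp g) P) g"

text \<open>The arrow that the Yoneda lemma assigns to a section \<open>a\<close> of
  \<open>x\<close> over \<open>P\<close>.\<close>

definition yar :: "'u psh \<Rightarrow> poset \<Rightarrow> 'u \<Rightarrow> 'u psharr" where
  "yar x P a = mkm (Y P) x (\<lambda>Q t. rs x (inv_into (hom Kp Q P) (code U (hom Kp Q P)) t) a)"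

text \<open>The Yoneda embedding on arrows: \<open>f\<close> is regarded as a section of the
  representable sheaf of its codomain.\<close>

definition ymor :: "posetarr \<Rightarrow> 'u psharr" where
  "ymor f = yar (Y (Cod Kp f)) (Dom Kp f) (en (Cod Kp f) f)"

lemma small_hom: "finite_poset Q \<Longrightarrow> finite_poset P \<Longrightarrow> small U (hom Kp Q P)"
  using small_finite[OF U finite_hom_Kp] .

text \<open>The topology is subcanonical: a matching family of maps glues to a map, because two
  points with the same image are the images of a point of the pullback.\<close>

lemma Y_KK:
  assumes P: "finite_poset P" shows "Y P \<in> Obj (KK U)"
  unfolding Y_def
proof (rule coded_KK)
  fix Q :: poset assume "finite_poset Q" then show "small U (hom Kp Q P)" using small_hom P by blast
next
  fix Q R f g assume "f \<in> hom Kp R Q" "g \<in> hom Kp Q P"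
  then show "Cmp Kp g f \<in> hom Kp R P" using cat_cmp[OF category_Kp] by blast
next
  fix Q s assume "s \<in> hom Kp Q P" then show "Cmp Kp s (Ide Kp Q) = s" using cat_idr[OF category_Kp] by blast
next
  fix Q R S f g s assume "f \<in> hom Kp R Q" "g \<in> hom Kp S R" "s \<in> hom Kp Q P"
  then show "Cmp Kp s (Cmp Kp f g) = Cmp Kp (Cmp Kp s f) g" using cat_assoc[OF category_Kp] by blast
next
  fix Q S y assume Q: "finite_poset Q" and S: "S \<in> J_surj Q" and y: "\<And>f. f \<in> S \<Longrightarrow> y f \<in> hom Kp (Dom Kp f) P"
    and mf: "\<And>f g R. f \<in> S \<Longrightarrow> g \<in> hom Kp R (Dom Kp f) \<Longrightarrow> Cmp Kp (y f) g = y (Cmp Kp f g)"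
  have wd: "pap (y f) q = pap (y f') q'" if f: "f \<in> S" "q \<in> fst (Dom Kp f)" and f': "f' \<in> S" "q' \<in> fst (Dom Kp f')"
    and eq: "pap f q = pap f' q'" for f q f' q'
  proof -
    obtain W u v w where w: "u \<in> hom Kp W (Dom Kp f)" "v \<in> hom Kp W (Dom Kp f')" "Cmp Kp f u = Cmp Kp f' v"
      "w \<in> fst W" "pap u w = q" "pap v w = q'"
      using Kp_amalgam[OF J_hom[OF S f(1)] J_hom[OF S f'(1)] f(2) f'(2) eq] .
    have "Cmp Kp (y f) u = Cmp Kp (y f') v" using mf[OF f(1) w(1)] mf[OF f'(1) w(2)] w(3) by simp
    then show ?thesis using pap_Cmp[OF w(1) y[OF f(1)] w(4)] pap_Cmp[OF w(2) y[OF f'(1)] w(4)] w(5,6) by simp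
  qed
  \<comment> \<open>The glued map evaluates any member of the family at any preimage of
    \<open>p\<close>; the choice does not matter by \<open>wd\<close>.\<close>
  define h where "h p = (SOME r. \<exists>f\<in>S. \<exists>q\<in>fst (Dom Kp f). pap f q = p \<and> r = pap (y f) q)" for p
  have h: "h (pap f q) = pap (y f) q" if f: "f \<in> S" "q \<in> fst (Dom Kp f)" for f q
  proof -
    have "\<exists>r. \<exists>f'\<in>S. \<exists>q'\<in>fst (Dom Kp f'). pap f' q' = pap f q \<and> r = pap (y f') q'" using f by blast
    from someI_ex[OF this] obtain f' q' where "f' \<in> S" "q' \<in> fst (Dom Kp f')" "pap f' q' = pap f q"
      "h (pap f q) = pap (y f') q'" unfolding h_def by blast
    then show ?thesis using wd[OF f, of f' q'] by simp
  qed
  have hh: "kar Q h P \<in> hom Kp Q P"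
  proof (rule kar_hom[OF Q P])
    fix p assume "p \<in> fst Q"
    then obtain f q where f: "f \<in> S" "q \<in> fst (Dom Kp f)" "pap f q = p" using J_surjE[OF S] by blast
    then show "h p \<in> fst P" using h[OF f(1,2)] Kp_in[OF y[OF f(1)] f(2)] by simp
  next
    fix p p' assume pp': "(p, p') \<in> snd Q" and "p \<in> fst Q" "p' \<in> fst Q"
    then obtain f q where f: "f \<in> S" "q \<in> fst (Dom Kp f)" "pap f q = p" using J_surjE[OF S] by blast
    have "(pap f q, p') \<in> snd Q" using pp' f(3) by simp
    \<comment> \<open>Monotonicity of the glued map rests on openness of the covering map
      \<open>f\<close>: the step from \<open>p\<close> to \<open>p'\<close> lifts to its domain,
      where \<open>y f\<close> is monotone.\<close>
    then obtain q' where q': "(q, q') \<in> snd (Dom Kp f)" "pap f q' = p'" using Kp_lift[OF J_hom[OF S f(1)] f(2)] by blast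
    have "q' \<in> fst (Dom Kp f)" using fp_carrier(2)[OF hom_Kp_fp(1)[OF y[OF f(1)]] q'(1)] .
    then show "(h p, h p') \<in> snd P" using h[OF f(1,2)] h[OF f(1), of q'] f(3) q'(2) Kp_mono[OF y[OF f(1)] q'(1)] by simp
  next
    fix p r assume "p \<in> fst Q" and r: "(h p, r) \<in> snd P"
    then obtain f q where f: "f \<in> S" "q \<in> fst (Dom Kp f)" "pap f q = p" using J_surjE[OF S] by blast
    have "(pap (y f) q, r) \<in> snd P" using r h[OF f(1,2)] f(3) by simp
    \<comment> \<open>Openness of the glued map comes from openness of \<open>y f\<close>: the lift
      is found in the domain of \<open>f\<close> and then pushed down along
      \<open>f\<close>.\<close>
    then obtain q' where q': "(q, q') \<in> snd (Dom Kp f)" "pap (y f) q' = r" using Kp_lift[OF y[OF f(1)] f(2)] by blast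
    have "q' \<in> fst (Dom Kp f)" using fp_carrier(2)[OF hom_Kp_fp(1)[OF y[OF f(1)]] q'(1)] .
    then have "h (pap f q') = r" using h[OF f(1)] q'(2) by simp
    moreover have "(p, pap f q') \<in> snd Q" using Kp_mono[OF J_hom[OF S f(1)] q'(1)] f(3) by simp
    ultimately show "\<exists>p'. (p, p') \<in> snd Q \<and> h p' = r" by blast
  qed
  show "\<exists>!s. s \<in> hom Kp Q P \<and> (\<forall>f\<in>S. Cmp Kp s f = y f)"
  proof (rule ex1I[of _ "kar Q h P"], intro conjI ballI hh)
    fix f assume f: "f \<in> S"
    show "Cmp Kp (kar Q h P) f = y f"
    proof (rule hom_Kp_eqI[OF cat_cmp[OF category_Kp J_hom[OF S f] hh] y[OF f]])
      fix q assume q: "q \<in> fst (Dom Kp f)"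
      show "pap (Cmp Kp (kar Q h P) f) q = pap (y f) q"
        using pap_Cmp[OF J_hom[OF S f] hh q] Kp_in[OF J_hom[OF S f] q] h[OF f q] by simp
    qed
  next
    fix s assume s: "s \<in> hom Kp Q P \<and> (\<forall>f\<in>S. Cmp Kp s f = y f)"
    show "s = kar Q h P"
    proof (rule hom_Kp_eqI[OF conjunct1[OF s] hh])
      fix p assume p: "p \<in> fst Q"
      then obtain f q where f: "f \<in> S" "q \<in> fst (Dom Kp f)" "pap f q = p" using J_surjE[OF S] by blast
      have "pap (Cmp Kp s f) q = pap (y f) q" using s f(1) by simp
      then show "pap s p = pap (kar Q h P) p"
        using pap_Cmp[OF J_hom[OF S f(1)] conjunct1[OF s] f(2)] h[OF f(1,2)] f(3) p by simp
    qed
  qed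
qed

lemma fob_Y: "fob (Y P) Q = small_set U (hom Kp Q P)" by (simp add: Y_def fob_coded)

lemma en_in: "g \<in> hom Kp Q P \<Longrightarrow> en P g \<in> fob (Y P) Q"
  by (simp add: fob_Y en_def hom_D code_in)

lemma fob_YE:
  assumes "t \<in> fob (Y P) Q" obtains g where "g \<in> hom Kp Q P" "t = en P g"
  using assms that by (auto simp: fob_Y en_def hom_D elim!: small_setE)

lemma en_eq_iff: "g \<in> hom Kp Q P \<Longrightarrow> g' \<in> hom Kp Q P \<Longrightarrow> en P g = en P g' \<longleftrightarrow> g = g'"
  by (simp add: en_def hom_D code_eq_iff small_hom hom_Kp_fp)

lemma rs_Y: "g \<in> hom Kp Q P \<Longrightarrow> f \<in> hom Kp R Q \<Longrightarrow> rs (Y P) f (en P g) = en P (Cmp Kp g f)"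
  unfolding Y_def en_def using rs_coded[of U "\<lambda>Q. hom Kp Q P" Q f R g "\<lambda>f g. Cmp Kp g f"]
    hom_D(2)[OF cat_cmp[OF category_Kp]] small_hom
  by (simp add: hom_D hom_Kp_fp)

lemma cp_yar:
  assumes "g \<in> hom Kp Q P" shows "cp (yar x P a) Q (en P g) = rs x g a"
proof -
  have "inv_into (hom Kp Q P) (code U (hom Kp Q P)) (en P g) = g"
    using assms small_code(1)[OF small_hom[OF hom_Kp_fp[OF assms]]] by (simp add: en_def hom_D)
  then show ?thesis using cp_mkm[OF hom_Kp_fp(1)[OF assms] en_in[OF assms]] by (simp add: yar_def)
qed

lemma yar_hom:
  assumes x: "x \<in> Obj (KK U)" and P: "finite_poset P" and a: "a \<in> fob x P"
  shows "yar x P a \<in> hom (KK U) (Y P) x"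
proof -
  have inv: "inv_into (hom Kp Q P) (code U (hom Kp Q P)) (en P g) = g" if "g \<in> hom Kp Q P" for Q g
    using that small_code(1)[OF small_hom[OF hom_Kp_fp[OF that]]] by (simp add: en_def hom_D)
  show ?thesis
    unfolding yar_def
  proof (rule mkm_hom[OF Y_KK[OF P] x])
    fix Q t assume "t \<in> fob (Y P) Q"
    then obtain g where g: "g \<in> hom Kp Q P" "t = en P g" by (rule fob_YE)
    then show "rs x (inv_into (hom Kp Q P) (code U (hom Kp Q P)) t) a \<in> fob x Q" using inv rs_in[OF x g(1) a] by simp
  next
    fix Q R f t assume f: "f \<in> hom Kp R Q" and "t \<in> fob (Y P) Q"
    then obtain g where g: "g \<in> hom Kp Q P" "t = en P g" by (metis fob_YE)
    show "rs x (inv_into (hom Kp R P) (code U (hom Kp R P)) (rs (Y P) f t)) a =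
        rs x f (rs x (inv_into (hom Kp Q P) (code U (hom Kp Q P)) t) a)"
      using g(2) rs_Y[OF g(1) f] inv[OF g(1)] inv[OF cat_cmp[OF category_Kp f g(1)]] rs_cmp[OF x g(1) f a] by simp
  qed
qed

lemma Ide_Kp_hom: "finite_poset P \<Longrightarrow> Ide Kp P \<in> hom Kp P P"
  using cat_ide[OF category_Kp] by simp

lemma yoneda:
  assumes m: "m \<in> hom (KK U) (Y P) x" and P: "finite_poset P"
  obtains a where "a \<in> fob x P" "m = yar x P a"
proof -
  let ?a = "cp m P (en P (Ide Kp P))"
  note i = Ide_Kp_hom[OF P]
  have a: "?a \<in> fob x P" using cp_in[OF m P en_in[OF i]] .
  have "m = yar x P ?a"
  proof (rule KK_eqI[OF m yar_hom[OF hom_KK_obj(2)[OF m] P a]])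
    fix Q t assume "t \<in> fob (Y P) Q"
    then obtain g where g: "g \<in> hom Kp Q P" "t = en P g" by (rule fob_YE)
    have "t = rs (Y P) g (en P (Ide Kp P))" using rs_Y[OF i g(1)] cat_idl[OF category_Kp g(1)] g(2) by simp
    then have "cp m Q t = rs x g ?a" using cp_nat[OF m g(1) en_in[OF i]] by simp
    then show "cp m Q t = cp (yar x P ?a) Q t" using cp_yar[OF g(1)] g(2) by simp
  qed
  then show ?thesis using that[OF a] by blast
qed

lemma yar_inj:
  assumes x: "x \<in> Obj (KK U)" and P: "finite_poset P" and a: "a \<in> fob x P" "b \<in> fob x P" and eq: "yar x P a = yar x P b"
  shows "a = b"
  using cp_yar[OF Ide_Kp_hom[OF P], of x a] cp_yar[OF Ide_Kp_hom[OF P], of x b] eq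
    rs_id[OF x P a(1)] rs_id[OF x P a(2)] by simp

lemma yar_Cmp:
  assumes m: "m \<in> hom (KK U) x y" and P: "finite_poset P" and a: "a \<in> fob x P"
  shows "Cmp (KK U) m (yar x P a) = yar y P (cp m P a)"
proof -
  note h = yar_hom[OF hom_KK_obj(1)[OF m] P a]
  show ?thesis
  proof (rule KK_eqI[OF cat_cmp[OF category_KK h m] yar_hom[OF hom_KK_obj(2)[OF m] P cp_in[OF m P a]]])
    fix Q t assume Q: "finite_poset Q" and t: "t \<in> fob (Y P) Q"
    then obtain g where g: "g \<in> hom Kp Q P" "t = en P g" by (metis fob_YE)
    show "cp (Cmp (KK U) m (yar x P a)) Q t = cp (yar y P (cp m P a)) Q t"
      using cp_Cmp[OF h m Q t] cp_yar[OF g(1)] g(2) cp_nat[OF m g(1) a] by simp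
  qed
qed

lemma ymor_hom:
  assumes f: "f \<in> hom Kp Q P" shows "ymor f \<in> hom (KK U) (Y Q) (Y P)"
  unfolding ymor_def hom_D(2)[OF f] hom_D(3)[OF f]
  using yar_hom[OF Y_KK[OF hom_Kp_fp(2)[OF f]] hom_Kp_fp(1)[OF f] en_in[OF f]] .

lemma cp_ymor:
  assumes "f \<in> hom Kp Q P" "g \<in> hom Kp R Q" shows "cp (ymor f) R (en Q g) = en P (Cmp Kp f g)"
  unfolding ymor_def hom_D(2)[OF assms(1)] hom_D(3)[OF assms(1)]
  using cp_yar[OF assms(2)] rs_Y[OF assms] by simp

lemma yar_ymor:
  assumes x: "x \<in> Obj (KK U)" and f: "f \<in> hom Kp Q P" and a: "a \<in> fob x P"
  shows "Cmp (KK U) (yar x P a) (ymor f) = yar x Q (rs x f a)"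
  unfolding ymor_def hom_D(2)[OF f] hom_D(3)[OF f]
  using yar_Cmp[OF yar_hom[OF x hom_Kp_fp(2)[OF f] a] hom_Kp_fp(1)[OF f] en_in[OF f]] cp_yar[OF f] by simp

lemma ymor_inc_inj:
  assumes P: "finite_poset P" and V: "upset V P" and Q: "finite_poset Q"
  shows "inj_on (cp (ymor (inc P V)) Q) (fob (Y (sub P V)) Q)"
proof (rule inj_onI)
  note i = inc_hom[OF P V]
  fix s t assume "s \<in> fob (Y (sub P V)) Q" "t \<in> fob (Y (sub P V)) Q" and eq: "cp (ymor (inc P V)) Q s = cp (ymor (inc P V)) Q t"
  then obtain g h where g: "g \<in> hom Kp Q (sub P V)" "s = en (sub P V) g" and h: "h \<in> hom Kp Q (sub P V)" "t = en (sub P V) h"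
    by (metis fob_YE)
  have e: "Cmp Kp (inc P V) g = Cmp Kp (inc P V) h"
    using eq cp_ymor[OF i g(1)] cp_ymor[OF i h(1)] g(2) h(2) en_eq_iff[OF cat_cmp[OF category_Kp g(1) i] cat_cmp[OF category_Kp h(1) i]] by simp
  have "g = h"
  proof (rule hom_Kp_eqI[OF g(1) h(1)])
    fix q assume q: "q \<in> fst Q"
    have "pap g q \<in> V" "pap h q \<in> V" using Kp_in[OF g(1) q] Kp_in[OF h(1) q] by simp_all
    then show "pap g q = pap h q" using pap_Cmp[OF g(1) i q] pap_Cmp[OF h(1) i q] e by simp
  qed
  then show "s = t" using g h by simp
qed

text \<open>Under Yoneda, precomposition with \<open>ymor f\<close> becomes restriction of sections
  along \<open>f\<close>.\<close>

lemma orthogonal_ymor: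
  assumes x: "x \<in> Obj (KK U)" and f: "f \<in> hom Kp Q P"
  shows "orthogonal (KK U) (ymor f) x \<longleftrightarrow> bij_betw (rs x f) (fob x P) (fob x Q)"
proof
  note P = hom_Kp_fp(2)[OF f] and Q = hom_Kp_fp(1)[OF f]
  note m = ymor_hom[OF f]
  assume o: "orthogonal (KK U) (ymor f) x"
  show "bij_betw (rs x f) (fob x P) (fob x Q)"
    unfolding bij_betw_def
  proof (intro conjI inj_onI equalityI subsetI)
    fix a b assume a: "a \<in> fob x P" and b: "b \<in> fob x P" and "rs x f a = rs x f b"
    then have "Cmp (KK U) (yar x P a) (ymor f) = Cmp (KK U) (yar x P b) (ymor f)"
      using yar_ymor[OF x f a] yar_ymor[OF x f b] by simp
    then have "yar x P a = yar x P b" using orthogonal_eq[OF category_KK o m yar_hom[OF x P a] yar_hom[OF x P b]] by simp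
    then show "a = b" using yar_inj[OF x P a b] by simp
  next
    fix b assume b: "b \<in> fob x Q"
    obtain g where g: "g \<in> hom (KK U) (Y P) x" "Cmp (KK U) g (ymor f) = yar x Q b"
      using o yar_hom[OF x Q b] unfolding orthogonal_iff[OF m] by blast
    obtain a where a: "a \<in> fob x P" "g = yar x P a" using yoneda[OF g(1) P] .
    have "rs x f a = b" using yar_inj[OF x Q rs_in[OF x f a(1)] b] yar_ymor[OF x f a(1)] g(2) a(2) by simp
    then show "b \<in> rs x f ` fob x P" using a(1) by blast
  next
    fix b assume "b \<in> rs x f ` fob x P" then show "b \<in> fob x Q" using rs_in[OF x f] by blast
  qed
next
  note P = hom_Kp_fp(2)[OF f] and Q = hom_Kp_fp(1)[OF f]
  note m = ymor_hom[OF f]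
  assume bij: "bij_betw (rs x f) (fob x P) (fob x Q)"
  show "orthogonal (KK U) (ymor f) x"
    unfolding orthogonal_iff[OF m]
  proof
    fix h assume "h \<in> hom (KK U) (Y Q) x"
    then obtain b where b: "b \<in> fob x Q" "h = yar x Q b" using yoneda[OF _ Q] by metis
    obtain a where a: "a \<in> fob x P" "rs x f a = b" using bij b(1) unfolding bij_betw_def by (metis imageE)
    show "\<exists>!g. g \<in> hom (KK U) (Y P) x \<and> Cmp (KK U) g (ymor f) = h"
    proof (rule ex1I[of _ "yar x P a"])
      show "yar x P a \<in> hom (KK U) (Y P) x \<and> Cmp (KK U) (yar x P a) (ymor f) = h"
        using yar_hom[OF x P a(1)] yar_ymor[OF x f a(1)] a(2) b(2) by simp
      fix g assume g: "g \<in> hom (KK U) (Y P) x \<and> Cmp (KK U) g (ymor f) = h"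
      then obtain a' where a': "a' \<in> fob x P" "g = yar x P a'" using yoneda[OF _ P] by metis
      have "rs x f a' = b" using yar_inj[OF x Q rs_in[OF x f a'(1)] b(1)] yar_ymor[OF x f a'(1)] g a'(2) b(2) by simp
      then have "a' = a" using bij a a'(1) unfolding bij_betw_def by (metis inj_onD)
      then show "g = yar x P a" using a' by simp
    qed
  qed
qed

end

text \<open>A sieve on \<open>P\<close> that is closed for the topology consists of the maps into some upset.\<close>

lemma closed_sieve:
  assumes P: "finite_poset P"
    and stable: "\<And>Q R f g. f \<in> hom Kp Q P \<Longrightarrow> g \<in> hom Kp R Q \<Longrightarrow> \<Phi> f \<Longrightarrow> \<Phi> (Cmp Kp f g)"
    and local: "\<And>Q f G. f \<in> hom Kp Q P \<Longrightarrow> cov Q G \<Longrightarrow> (\<And>g. g \<in> G \<Longrightarrow> \<Phi> (Cmp Kp f g)) \<Longrightarrow> \<Phi> f"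
  defines "V \<equiv> {p \<in> fst P. \<Phi> (inc P (up P p))}"
  shows "upset V P" "f \<in> hom Kp Q P \<Longrightarrow> \<Phi> f \<longleftrightarrow> (\<forall>q\<in>fst Q. pap f q \<in> V)"
proof -
  note inc_up = inc_hom[OF P upset_up[OF P]]
  \<comment> \<open>Openness of \<open>f\<close> says that it maps the principal upset of
    \<open>q\<close> onto the principal upset of its image, so the restricted map \<open>k\<close>
    alone is a covering.\<close>
  have factor: "\<exists>k \<in> hom Kp (sub Q (up Q q)) (sub P (up P (pap f q))).
      Cmp Kp (inc P (up P (pap f q))) k = Cmp Kp f (inc Q (up Q q)) \<and> cov (sub P (up P (pap f q))) {k}"
    if f: "f \<in> hom Kp Q P" and q: "q \<in> fst Q" for f Q q
  proof -
    note Q = hom_Kp_fp(1)[OF f]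
    note i = inc_hom[OF Q upset_up[OF Q]]
    let ?m = "Cmp Kp f (inc Q (up Q q))"
    note m = cat_cmp[OF category_Kp i f]
    have pm: "pap ?m r = pap f r" if "r \<in> up Q q" for r using pap_Cmp[OF i f] that by simp
    have im: "pap ?m r \<in> up P (pap f q)" if "r \<in> fst (sub Q (up Q q))" for r
      using that Kp_mono[OF f, of q r] pm by (simp add: up_def)
    let ?k = "kar (sub Q (up Q q)) (pap ?m) (sub P (up P (pap f q)))"
    note k = corestrict[OF m upset_up[OF P] im]
    have "cov (sub P (up P (pap f q))) {?k}"
    proof (rule cov_single[OF k(1)])
      fix p assume "p \<in> fst (sub P (up P (pap f q)))"
      then have "(pap f q, p) \<in> snd P" by (simp add: up_def)
      then obtain r where r: "(q, r) \<in> snd Q" "pap f r = p" using Kp_lift[OF f q] by metis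
      then have "r \<in> up Q q" by (simp add: up_def)
      then show "\<exists>r\<in>fst (sub Q (up Q q)). pap ?k r = p" using pm r(2) by (intro bexI[of _ r]) simp_all
    qed
    then show ?thesis using k by blast
  qed
  have iff: "\<Phi> f \<longleftrightarrow> (\<forall>q\<in>fst Q. pap f q \<in> V)" if f: "f \<in> hom Kp Q P" for f Q
  proof
    note Q = hom_Kp_fp(1)[OF f]
    assume \<Phi>: "\<Phi> f"
    show "\<forall>q\<in>fst Q. pap f q \<in> V"
    proof
      fix q assume q: "q \<in> fst Q"
      obtain k where k: "k \<in> hom Kp (sub Q (up Q q)) (sub P (up P (pap f q)))"
        "Cmp Kp (inc P (up P (pap f q))) k = Cmp Kp f (inc Q (up Q q))" "cov (sub P (up P (pap f q))) {k}"
        using factor[OF f q] by blast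
      have "\<Phi> (Cmp Kp f (inc Q (up Q q)))" using stable[OF f inc_hom[OF Q upset_up[OF Q]] \<Phi>] .
      \<comment> \<open>Locality along the covering \<open>k\<close> descends the property from the
        upset in \<open>Q\<close> to the upset in \<open>P\<close>.\<close>
      then have "\<Phi> (inc P (up P (pap f q)))" using local[OF inc_up k(3)] k(2) by simp
      then show "pap f q \<in> V" using Kp_in[OF f q] by (simp add: V_def)
    qed
  next
    note Q = hom_Kp_fp(1)[OF f]
    assume V: "\<forall>q\<in>fst Q. pap f q \<in> V"
    show "\<Phi> f"
    proof (rule local[OF f cov_up[OF Q]])
      fix g assume "g \<in> (\<lambda>q. inc Q (up Q q)) ` fst Q"
      then obtain q where q: "q \<in> fst Q" "g = inc Q (up Q q)" by blast
      obtain k where k: "k \<in> hom Kp (sub Q (up Q q)) (sub P (up P (pap f q)))"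
        "Cmp Kp (inc P (up P (pap f q))) k = Cmp Kp f (inc Q (up Q q))" using factor[OF f q(1)] by blast
      have "\<Phi> (inc P (up P (pap f q)))" using V q(1) by (simp add: V_def)
      from stable[OF inc_up k(1) this] show "\<Phi> (Cmp Kp f g)" using k(2) q(2) by simp
    qed
  qed
  show "f \<in> hom Kp Q P \<Longrightarrow> \<Phi> f \<longleftrightarrow> (\<forall>q\<in>fst Q. pap f q \<in> V)" using iff .
  show "upset V P"
    unfolding upset_def
  proof (intro conjI ballI allI impI)
    show "V \<subseteq> fst P" by (auto simp: V_def)
    fix p q assume p: "p \<in> V" and q: "(p, q) \<in> snd P"
    then have "\<Phi> (inc P (up P p))" by (simp add: V_def)
    then have "\<forall>r\<in>up P p. pap (inc P (up P p)) r \<in> V" using iff[OF inc_up[of p]] by simp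
    moreover have "q \<in> up P p" using q by (simp add: up_def)
    ultimately show "q \<in> V" by force
  qed
qed

text \<open>Local preimages under an injective arrow are unique, hence compatible, and glue in
  \<open>B\<close>. So the image of \<open>c\<close> is a subsheaf of \<open>w\<close>.\<close>

lemma local_image:
  assumes c: "c \<in> hom (KK U) B w" and inj: "\<And>Q. finite_poset Q \<Longrightarrow> inj_on (cp c Q) (fob B Q)"
    and G: "cov P G" and P: "finite_poset P" and a: "a \<in> fob w P"
    and h: "\<And>g. g \<in> G \<Longrightarrow> rs w g a \<in> cp c (Dom Kp g) ` fob B (Dom Kp g)"
  shows "a \<in> cp c P ` fob B P"
proof -
  note w = hom_KK_obj(2)[OF c] and B = hom_KK_obj(1)[OF c]
  have "\<forall>g\<in>G. \<exists>b. b \<in> fob B (Dom Kp g) \<and> cp c (Dom Kp g) b = rs w g a"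
  proof
    fix g assume "g \<in> G"
    from h[OF this] show "\<exists>b. b \<in> fob B (Dom Kp g) \<and> cp c (Dom Kp g) b = rs w g a" by auto
  qed
  then obtain t where t: "\<And>g. g \<in> G \<Longrightarrow> t g \<in> fob B (Dom Kp g)"
    "\<And>g. g \<in> G \<Longrightarrow> cp c (Dom Kp g) (t g) = rs w g a" by metis
  have "\<exists>!b. b \<in> fob B P \<and> (\<forall>g\<in>G. rs B g b = t g)"
  proof (rule glue_ex1[OF B P G t(1)])
    fix g g' R u u' assume g: "g \<in> G" "g' \<in> G" and u: "u \<in> hom Kp R (Dom Kp g)" "u' \<in> hom Kp R (Dom Kp g')"
      and eq: "Cmp Kp g u = Cmp Kp g' u'"
    have "cp c R (rs B u (t g)) = rs w (Cmp Kp g u) a"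
      using cp_nat[OF c u(1) t(1)[OF g(1)]] t(2)[OF g(1)] rs_cmp[OF w covD[OF G g(1)] u(1) a] by simp
    also have "\<dots> = cp c R (rs B u' (t g'))"
      using cp_nat[OF c u(2) t(1)[OF g(2)]] t(2)[OF g(2)] rs_cmp[OF w covD[OF G g(2)] u(2) a] eq by simp
    finally show "rs B u (t g) = rs B u' (t g')"
      using inj_onD[OF inj[OF hom_Kp_fp(1)[OF u(1)]] _ rs_in[OF B u(1) t(1)[OF g(1)]] rs_in[OF B u(2) t(1)[OF g(2)]]] by simp
  qed
  then obtain b where b: "b \<in> fob B P \<and> (\<forall>g\<in>G. rs B g b = t g)" by (rule ex1E)
  have "a = cp c P b"
  proof (rule separated[OF w G P a cp_in[OF c P conjunct1[OF b]]])
    fix g assume g: "g \<in> G"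
    show "rs w g a = rs w g (cp c P b)" using cp_nat[OF c covD[OF G g] conjunct1[OF b]] b g t(2)[OF g] by simp
  qed
  then show ?thesis using conjunct1[OF b] by (rule image_eqI)
qed

section \<open>Dense upsets\<close>

locale KK_reflection = small_universe U + lex_reflection "KK U" D L \<eta>
  for U :: "'u set set" and D :: "'u psh set" and L :: "('u psh, 'u psharr, 'u psh, 'u psharr) func"
    and \<eta> :: "'u psh \<Rightarrow> 'u psharr"
begin

definition dense where
  "dense V P \<longleftrightarrow> upset V P \<and> (\<forall>d\<in>D. bij_betw (rs d (inc P V)) (fob d P) (fob d (sub P V)))"

lemma D_KK: "d \<in> D \<Longrightarrow> d \<in> Obj (KK U)" using D_Obj by blast

lemma dense_iff_orthogonal:
  assumes "finite_poset P" "upset V P"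
  shows "dense V P \<longleftrightarrow> (\<forall>d\<in>D. orthogonal (KK U) (ymor (inc P V)) d)"
  unfolding dense_def using assms orthogonal_ymor[OF D_KK inc_hom[OF assms]] by blast

text \<open>The locus where \<alpha> and \<beta> agree and lie in the image of \<open>c\<close> is a
  closed sieve, hence an upset \<open>V\<close>. Then \<open>Y (sub P V)\<close> is the limit of the
  diagram formed by the two sections and \<open>c\<close>. Since the reflector identifies the
  sections and inverts \<open>c\<close>, it inverts the inclusion of \<open>Y (sub P V)\<close> into
  \<open>Y P\<close>.\<close>

lemma dense_closed:
  assumes P: "finite_poset P" and \<alpha>: "\<alpha> \<in> fob w P" and \<beta>: "\<beta> \<in> fob w P"
    and \<alpha>\<beta>: "cp (\<eta> w) P \<alpha> = cp (\<eta> w) P \<beta>"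
    and c: "c \<in> hom (KK U) B w" and inj: "\<And>Q. finite_poset Q \<Longrightarrow> inj_on (cp c Q) (fob B Q)"
    and orth: "\<And>d. d \<in> D \<Longrightarrow> orthogonal (KK U) c d"
  defines "\<Phi> \<equiv> \<lambda>f. rs w f \<alpha> = rs w f \<beta> \<and> rs w f \<alpha> \<in> cp c (Dom Kp f) ` fob B (Dom Kp f)"
  shows "dense {p \<in> fst P. \<Phi> (inc P (up P p))} P"
proof -
  note w = hom_KK_obj(2)[OF c] and B = hom_KK_obj(1)[OF c]
  define V where "V = {p \<in> fst P. \<Phi> (inc P (up P p))}"
  have stable: "\<Phi> (Cmp Kp f g)" if f: "f \<in> hom Kp Q P" and g: "g \<in> hom Kp R Q" and \<Phi>: "\<Phi> f" for Q R f g
  proof -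
    obtain b where b: "b \<in> fob B Q" "rs w f \<alpha> = cp c Q b" using \<Phi> unfolding \<Phi>_def hom_D(2)[OF f] by blast
    have "rs w (Cmp Kp f g) \<alpha> = cp c R (rs B g b)" using rs_cmp[OF w f g \<alpha>] b(2) cp_nat[OF c g b(1)] by simp
    moreover have "rs w (Cmp Kp f g) \<alpha> = rs w (Cmp Kp f g) \<beta>"
      using rs_cmp[OF w f g \<alpha>] rs_cmp[OF w f g \<beta>] \<Phi> unfolding \<Phi>_def by simp
    ultimately show ?thesis
      unfolding \<Phi>_def hom_D(2)[OF cat_cmp[OF category_Kp g f]] using rs_in[OF B g b(1)] by blast
  qed
  have local: "\<Phi> f" if f: "f \<in> hom Kp Q P" and G: "cov Q G" and h: "\<And>g. g \<in> G \<Longrightarrow> \<Phi> (Cmp Kp f g)" for Q f G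
  proof -
    note Q = hom_Kp_fp(1)[OF f]
    note f\<alpha> = rs_in[OF w f \<alpha>] and f\<beta> = rs_in[OF w f \<beta>]
    have Gd: "Dom Kp (Cmp Kp f g) = Dom Kp g" if "g \<in> G" for g
      using hom_D(2)[OF cat_cmp[OF category_Kp covD[OF G that] f]] .
    have "rs w f \<alpha> = rs w f \<beta>"
    proof (rule separated[OF w G Q f\<alpha> f\<beta>])
      fix g assume g: "g \<in> G"
      show "rs w g (rs w f \<alpha>) = rs w g (rs w f \<beta>)"
        using rs_cmp[OF w f covD[OF G g] \<alpha>] rs_cmp[OF w f covD[OF G g] \<beta>] h[OF g] unfolding \<Phi>_def by simp
    qed
    moreover have "rs w f \<alpha> \<in> cp c Q ` fob B Q"
    proof (rule local_image[OF c inj G Q f\<alpha>])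
      fix g assume g: "g \<in> G"
      show "rs w g (rs w f \<alpha>) \<in> cp c (Dom Kp g) ` fob B (Dom Kp g)"
        using conjunct2[OF h[OF g, unfolded \<Phi>_def Gd[OF g]]] rs_cmp[OF w f covD[OF G g] \<alpha>] by simp
    qed
    ultimately show ?thesis unfolding \<Phi>_def hom_D(2)[OF f] by blast
  qed
  have V: "upset V P"
    unfolding V_def by (rule closed_sieve(1)[of P \<Phi>, OF P stable local])
  have V_iff: "\<Phi> f \<longleftrightarrow> (\<forall>q\<in>fst Q. pap f q \<in> V)" if "f \<in> hom Kp Q P" for f Q
    unfolding V_def by (rule closed_sieve(2)[of P \<Phi>, OF P stable local that])
  note i = inc_hom[OF P V]
  note PV = hom_Kp_fp(1)[OF i]
  \<comment> \<open>The inclusion of \<open>V\<close> belongs to the sieve that \<open>V\<close>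
    represents, so over \<open>V\<close> the sections agree and have a preimage \<open>b\<close>,
    which supplies the leg from the limit to \<open>B\<close>.\<close>
  have "\<Phi> (inc P V)" using V_iff[OF i] by simp
  then have e: "rs w (inc P V) \<beta> = rs w (inc P V) \<alpha>" and m: "rs w (inc P V) \<alpha> \<in> cp c (sub P V) ` fob B (sub P V)"
    unfolding \<Phi>_def hom_D(2)[OF i] by metis+
  obtain b where b: "rs w (inc P V) \<alpha> = cp c (sub P V) b" "b \<in> fob B (sub P V)" using m by (rule imageE)
  note p = ymor_hom[OF i] and q = yar_hom[OF B PV b(2)]
  note ya = yar_hom[OF w P \<alpha>] and yb = yar_hom[OF w P \<beta>]
  have comm: "Cmp (KK U) (yar w P \<alpha>) (ymor (inc P V)) = Cmp (KK U) c (yar B (sub P V) b)"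
    "Cmp (KK U) (yar w P \<beta>) (ymor (inc P V)) = Cmp (KK U) c (yar B (sub P V) b)"
    using yar_ymor[OF w i \<alpha>] yar_ymor[OF w i \<beta>] yar_Cmp[OF c PV b(2)] b e by simp_all
  have "orthogonal (KK U) (ymor (inc P V)) d" if d: "d \<in> D" for d
  proof (rule orthogonal_pullback[OF ya yb c p q comm _ _ orth d])
    show "Cmp (KK U) (\<eta> w) (yar w P \<alpha>) = Cmp (KK U) (\<eta> w) (yar w P \<beta>)"
      using yar_Cmp[OF \<eta>_hom[OF w] P \<alpha>] yar_Cmp[OF \<eta>_hom[OF w] P \<beta>] \<alpha>\<beta> by simp
    fix k u v assume u: "u \<in> hom (KK U) k (Y P)" and v: "v \<in> hom (KK U) k B"
      and uv: "Cmp (KK U) (yar w P \<alpha>) u = Cmp (KK U) c v" "Cmp (KK U) (yar w P \<beta>) u = Cmp (KK U) c v"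
    \<comment> \<open>A section of \<open>k\<close> yields an arrow \<open>g\<close> into
      \<open>P\<close> on which both equations hold; thus \<open>g\<close> is in the sieve and
      factors through \<open>V\<close>.\<close>
    have im: "cp u Q t \<in> cp (ymor (inc P V)) Q ` fob (Y (sub P V)) Q" if Q: "finite_poset Q" and t: "t \<in> fob k Q" for Q t
    proof -
      obtain g where g: "g \<in> hom Kp Q P" "cp u Q t = en P g" using fob_YE[OF cp_in[OF u Q t]] .
      have "rs w g \<alpha> = cp c Q (cp v Q t)"
        using cp_Cmp[OF u ya Q t] cp_Cmp[OF v c Q t] uv(1) g(2) cp_yar[OF g(1)] by simp
      moreover have "rs w g \<beta> = cp c Q (cp v Q t)"
        using cp_Cmp[OF u yb Q t] cp_Cmp[OF v c Q t] uv(2) g(2) cp_yar[OF g(1)] by simp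
      ultimately have "\<Phi> g" unfolding \<Phi>_def hom_D(2)[OF g(1)] using cp_in[OF v Q t] by simp
      then have gV: "\<And>q. q \<in> fst Q \<Longrightarrow> pap g q \<in> V" using V_iff[OF g(1)] by blast
      note g' = corestrict[OF g(1) V gV]
      have "cp u Q t = cp (ymor (inc P V)) Q (en (sub P V) (kar Q (pap g) (sub P V)))"
        using cp_ymor[OF i g'(1)] g'(2) g(2) by simp
      then show ?thesis using en_in[OF g'(1)] by blast
    qed
    obtain h where h: "h \<in> hom (KK U) k (Y (sub P V))" "Cmp (KK U) (ymor (inc P V)) h = u"
      using factor_mono[OF p ymor_inc_inj[OF P V] u im] .
    have "Cmp (KK U) c (Cmp (KK U) (yar B (sub P V) b) h) = Cmp (KK U) c v"
      using cat_assoc[OF category_KK h(1) q c] comm(1) cat_assoc[OF category_KK h(1) p ya] h(2) uv(1) by simp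
    then have qh: "Cmp (KK U) (yar B (sub P V) b) h = v"
      using inj_monic[OF c inj cat_cmp[OF category_KK h(1) q] v] by blast
    show "\<exists>!h. h \<in> hom (KK U) k (Y (sub P V)) \<and> Cmp (KK U) (ymor (inc P V)) h = u \<and> Cmp (KK U) (yar B (sub P V) b) h = v"
    proof (rule ex1I[of _ h])
      show "h \<in> hom (KK U) k (Y (sub P V)) \<and> Cmp (KK U) (ymor (inc P V)) h = u \<and> Cmp (KK U) (yar B (sub P V) b) h = v"
        using h qh by blast
      fix h' assume "h' \<in> hom (KK U) k (Y (sub P V)) \<and> Cmp (KK U) (ymor (inc P V)) h' = u \<and> Cmp (KK U) (yar B (sub P V) b) h' = v"
      then show "h' = h" using inj_monic[OF p ymor_inc_inj[OF P V] _ h(1)] h(2) by simp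
    qed
  qed
  then have "dense V P" using dense_iff_orthogonal[OF P V] by blast
  then show ?thesis unfolding V_def .
qed

text \<open>The case of \<open>dense_closed\<close> where both sections are \<open>f\<close>, seen
  as a section of \<open>Y P\<close>, and \<open>c\<close> is the inclusion of the dense upset: a
  map lies in the image of this inclusion exactly where it lands in \<open>V\<close>.\<close>

lemma dense_vimg:
  assumes dn: "dense V P" and f: "f \<in> hom Kp Q P"
  shows "dense (vimg f V) Q"
proof -
  note P = hom_Kp_fp(2)[OF f] and Q = hom_Kp_fp(1)[OF f]
  have V: "upset V P" using dn unfolding dense_def by blast
  note i = inc_hom[OF P V]
  have "dense {q \<in> fst Q. rs (Y P) (inc Q (up Q q)) (en P f) = rs (Y P) (inc Q (up Q q)) (en P f) \<and>
      rs (Y P) (inc Q (up Q q)) (en P f) \<in> cp (ymor (inc P V)) (Dom Kp (inc Q (up Q q))) `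
        fob (Y (sub P V)) (Dom Kp (inc Q (up Q q)))} Q" (is "dense ?W Q")
    using dense_closed[OF Q en_in[OF f] en_in[OF f] refl ymor_hom[OF i] ymor_inc_inj[OF P V]]
      dn[unfolded dense_iff_orthogonal[OF P V]] by blast
  moreover have "?W = vimg f V"
  proof (intro equalityI subsetI)
    fix q assume "q \<in> ?W"
    note iq = inc_hom[OF Q upset_up[OF Q, of q]]
    have q: "q \<in> fst Q" and h: "en P (Cmp Kp f (inc Q (up Q q))) \<in> cp (ymor (inc P V)) (sub Q (up Q q)) ` fob (Y (sub P V)) (sub Q (up Q q))"
      using \<open>q \<in> ?W\<close> rs_Y[OF f iq] hom_D(2)[OF iq] by auto
    then obtain g where g: "g \<in> hom Kp (sub Q (up Q q)) (sub P V)"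
      "en P (Cmp Kp f (inc Q (up Q q))) = cp (ymor (inc P V)) (sub Q (up Q q)) (en (sub P V) g)" by (auto elim!: fob_YE)
    then have "Cmp Kp f (inc Q (up Q q)) = Cmp Kp (inc P V) g"
      using cp_ymor[OF i g(1)] en_eq_iff[OF cat_cmp[OF category_Kp iq f] cat_cmp[OF category_Kp g(1) i]] by simp
    moreover have qu: "q \<in> fst (sub Q (up Q q))" using in_up[OF Q q] by simp
    ultimately have "pap f q = pap (inc P V) (pap g q)"
      using pap_Cmp[OF iq f qu] pap_Cmp[OF g(1) i qu] by simp
    then show "q \<in> vimg f V" using Kp_in[OF g(1) qu] q by (simp add: vimg_iff[OF f])
  next
    fix q assume "q \<in> vimg f V"
    then have q: "q \<in> fst Q" and qV: "pap f q \<in> V" by (simp_all add: vimg_iff[OF f])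
    note iq = inc_hom[OF Q upset_up[OF Q, of q]]
    note fi = cat_cmp[OF category_Kp iq f]
    have "pap (Cmp Kp f (inc Q (up Q q))) r \<in> V" if "r \<in> fst (sub Q (up Q q))" for r
      using pap_Cmp[OF iq f that] that Kp_mono[OF f, of q r] upsetD(2)[OF V qV] by (simp add: up_def)
    note g = corestrict[OF fi V this]
    have "en P (Cmp Kp f (inc Q (up Q q))) = cp (ymor (inc P V)) (sub Q (up Q q)) (en (sub P V) (kar (sub Q (up Q q)) (pap (Cmp Kp f (inc Q (up Q q)))) (sub P V)))"
      using cp_ymor[OF i g(1)] g(2) by simp
    then show "q \<in> ?W" using q rs_Y[OF f iq] hom_D(2)[OF iq] en_in[OF g(1)] by auto
  qed
  ultimately show ?thesis by simp
qed

text \<open>The case of \<open>dense_closed\<close> where \<open>c\<close> is the identity, so that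
  only the equation between the two sections remains.\<close>

lemma dense_equal:
  assumes x: "x \<in> Obj (KK U)" and P: "finite_poset P" and a: "a \<in> fob x P" and b: "b \<in> fob x P"
    and eq: "cp (\<eta> x) P a = cp (\<eta> x) P b"
  shows "dense {p \<in> fst P. rs x (inc P (up P p)) a = rs x (inc P (up P p)) b} P"
proof -
  note i = cat_ide[OF category_KK x]
  have inj: "inj_on (cp (Ide (KK U) x) Q) (fob x Q)" if "finite_poset Q" for Q
    by (rule inj_onI) (simp add: cp_Ide[OF that])
  have orth: "orthogonal (KK U) (Ide (KK U) x) d" for d
    unfolding orthogonal_iff[OF i]
  proof
    fix f assume f: "f \<in> hom (KK U) x d"
    show "\<exists>!g. g \<in> hom (KK U) x d \<and> Cmp (KK U) g (Ide (KK U) x) = f"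
      by (rule ex1I[of _ f]) (use f cat_idr[OF category_KK, where a = x and b = d] in metis)+
  qed
  have "dense {p \<in> fst P. rs x (inc P (up P p)) a = rs x (inc P (up P p)) b \<and>
      rs x (inc P (up P p)) a \<in> cp (Ide (KK U) x) (Dom Kp (inc P (up P p))) ` fob x (Dom Kp (inc P (up P p)))} P"
    using dense_closed[OF P a b eq i inj orth] .
  moreover have "rs x (inc P (up P p)) a \<in> cp (Ide (KK U) x) (Dom Kp (inc P (up P p))) ` fob x (Dom Kp (inc P (up P p)))" for p
  proof -
    note ip = inc_hom[OF P upset_up[OF P, of p]]
    have "rs x (inc P (up P p)) a = cp (Ide (KK U) x) (sub P (up P p)) (rs x (inc P (up P p)) a)"
      using cp_Ide[OF hom_Kp_fp(1)[OF ip] rs_in[OF x ip a]] by simp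
    then show ?thesis unfolding hom_D(2)[OF ip] using rs_in[OF x ip a] by blast
  qed
  ultimately show ?thesis by simp
qed

text \<open>The case of \<open>dense_closed\<close> where both sections are equal and
  \<open>c\<close> is the unit, which is orthogonal to \<open>D\<close> and injective by
  assumption.\<close>

lemma dense_image:
  assumes x: "x \<in> Obj (KK U)" and P: "finite_poset P" and inj: "\<And>Q. finite_poset Q \<Longrightarrow> inj_on (cp (\<eta> x) Q) (fob x Q)"
    and c: "c \<in> fob (fob L x) P"
  shows "dense {p \<in> fst P. rs (fob L x) (inc P (up P p)) c \<in> cp (\<eta> x) (sub P (up P p)) ` fob x (sub P (up P p))} P"
proof -
  have "dense {p \<in> fst P. rs (fob L x) (inc P (up P p)) c = rs (fob L x) (inc P (up P p)) c \<and> rs (fob L x) (inc P (up P p)) c \<in>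
      cp (\<eta> x) (Dom Kp (inc P (up P p))) ` fob x (Dom Kp (inc P (up P p)))} P"
    using dense_closed[OF P c c refl \<eta>_hom[OF x] inj unit_orthogonal[OF x]] .
  then show ?thesis by (simp add: inc_def)
qed

end

section \<open>Global sections and their right adjoint\<close>

lemma max_elems_pt [simp]: "max_elems pt = {0}" by (auto simp: max_elems_def)

lemma finite_max_elems: "finite_poset P \<Longrightarrow> finite (max_elems P)"
  using fp_finite finite_subset[of "max_elems P" "fst P"] by (auto simp: max_elems_def)

context small_universe
begin

definition nv :: "'u set \<Rightarrow> poset \<Rightarrow> (nat \<Rightarrow> 'u) \<Rightarrow> 'u" where "nv S P s = code U (max_elems P \<rightarrow>\<^sub>E S) s"

text \<open>Makes the general lemmas on coded presheaves applicable to \<nabla>.\<close>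

lemma nabla_ob_coded:
  "nabla_ob U S = coded U (\<lambda>P. max_elems P \<rightarrow>\<^sub>E S) (\<lambda>f s. compose (max_elems (Dom Kp f)) s (pap f))"
  by (auto simp: nabla_ob_def coded_def pap_def fun_eq_iff)

lemma small_nabla: "S \<in> U \<Longrightarrow> finite_poset P \<Longrightarrow> small U (max_elems P \<rightarrow>\<^sub>E S)"
  using small_PiE[OF U small_mem finite_max_elems] .

text \<open>Some member of the sieve hits \<open>p\<close>, and since \<open>p\<close> is maximal it
  is hit at a maximal element. The point \<open>p\<close> therefore factors through that
  member.\<close>

lemma J_ptm:
  assumes S: "S \<in> J_surj P" and p: "p \<in> max_elems P" shows "ptm P p \<in> S"
proof -
  obtain f q where f: "f \<in> S" "q \<in> fst (Dom Kp f)" "pap f q = p" using J_surjE[OF S max_elemsD(1)[OF p]] .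
  note fh = J_hom[OF S f(1)]
  obtain q' where q': "q' \<in> max_elems (Dom Kp f)" "pap f q' = p" using Kp_max_surj[OF fh f(2)] p f(3) by metis
  have "Cmp Kp f (ptm (Dom Kp f) q') = ptm P p" using Kp_max(2)[OF fh q'(1)] q'(2) by simp
  then show ?thesis using J_cmp[OF S f(1) ptm_hom[OF hom_Kp_fp(1)[OF fh] q'(1)]] by simp
qed

lemma nabla_ob_KK:
  assumes S: "S \<in> U" shows "nabla_ob U S \<in> Obj (KK U)"
  unfolding nabla_ob_coded
proof (rule coded_KK)
  fix P assume "finite_poset P" then show "small U (max_elems P \<rightarrow>\<^sub>E S)" using small_nabla[OF S] by blast
next
  fix P Q f s assume f: "f \<in> hom Kp Q P" and s: "s \<in> max_elems P \<rightarrow>\<^sub>E S"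
  then show "compose (max_elems (Dom Kp f)) s (pap f) \<in> max_elems Q \<rightarrow>\<^sub>E S"
    using Kp_max(1)[OF f] by (auto simp: hom_D[OF f] compose_def)
next
  fix P s assume "s \<in> max_elems P \<rightarrow>\<^sub>E S"
  then show "compose (max_elems (Dom Kp (Ide Kp P))) s (pap (Ide Kp P)) = s"
    using max_elemsD(1)[of _ P] by (auto simp: compose_def pap_def PiE_iff fun_eq_iff extensional_def restrict_def)
next
  fix P Q R f g s assume f: "f \<in> hom Kp Q P" and g: "g \<in> hom Kp R Q" and s: "s \<in> max_elems P \<rightarrow>\<^sub>E S"
  show "compose (max_elems (Dom Kp (Cmp Kp f g))) s (pap (Cmp Kp f g)) =
      compose (max_elems (Dom Kp g)) (compose (max_elems (Dom Kp f)) s (pap f)) (pap g)"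
    unfolding hom_D(2)[OF cat_cmp[OF category_Kp g f]] hom_D(2)[OF f] hom_D(2)[OF g] compose_def
    using Kp_max(1)[OF g] max_elemsD(1)[of _ R] pap_Cmp[OF g f] by (intro restrict_ext) simp
next
  fix P C y assume P: "finite_poset P" and C: "C \<in> J_surj P" and y: "\<And>f. f \<in> C \<Longrightarrow> y f \<in> max_elems (Dom Kp f) \<rightarrow>\<^sub>E S"
    and mf: "\<And>f g R. f \<in> C \<Longrightarrow> g \<in> hom Kp R (Dom Kp f) \<Longrightarrow>
      compose (max_elems (Dom Kp g)) (y f) (pap g) = y (Cmp Kp f g)"
  have Dp: "Dom Kp (ptm R p) = pt" for R p by (simp add: ptm_def)
  \<comment> \<open>A covering sieve contains all points of \<open>P\<close>, so the amalgamation
    can be read off from the values of the family at these points; \<open>0\<close> is the element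
    of \<open>pt\<close>.\<close>
  define s where "s = (\<lambda>p\<in>max_elems P. y (ptm P p) 0)"
  have sS: "s \<in> max_elems P \<rightarrow>\<^sub>E S"
    unfolding s_def using y[OF J_ptm[OF C]] Dp by (auto simp: PiE_iff)
  show "\<exists>!s. s \<in> max_elems P \<rightarrow>\<^sub>E S \<and> (\<forall>f\<in>C. compose (max_elems (Dom Kp f)) s (pap f) = y f)"
  proof (rule ex1I[of _ s], intro conjI ballI sS)
    fix f assume f: "f \<in> C"
    note fh = J_hom[OF C f]
    show "compose (max_elems (Dom Kp f)) s (pap f) = y f"
    proof (rule extensionalityI[of _ "max_elems (Dom Kp f)"])
      show "y f \<in> extensional (max_elems (Dom Kp f))" using y[OF f] by (simp add: PiE_def)
      fix q assume q: "q \<in> max_elems (Dom Kp f)"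
      have "y (ptm P (pap f q)) 0 = compose (max_elems pt) (y f) (pap (ptm (Dom Kp f) q)) 0"
        using mf[OF f ptm_hom[OF hom_Kp_fp(1)[OF fh] q]] Kp_max(2)[OF fh q] Dp by simp
      then show "compose (max_elems (Dom Kp f)) s (pap f) q = y f q"
        using q Kp_max(1)[OF fh q] by (simp add: compose_def s_def)
    qed (simp add: compose_def)
  next
    fix s' assume s': "s' \<in> max_elems P \<rightarrow>\<^sub>E S \<and> (\<forall>f\<in>C. compose (max_elems (Dom Kp f)) s' (pap f) = y f)"
    show "s' = s"
    proof (rule PiE_ext[OF conjunct1[OF s'] sS])
      fix p assume p: "p \<in> max_elems P"
      have "compose (max_elems pt) s' (pap (ptm P p)) = y (ptm P p)" using bspec[OF conjunct2[OF s'] J_ptm[OF C p]] by (simp add: Dp)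
      then have "compose (max_elems pt) s' (pap (ptm P p)) 0 = y (ptm P p) 0" by simp
      then show "s' p = s p" using p by (simp add: compose_def s_def)
    qed
  qed
qed

lemma fob_nabla: "fob (nabla_ob U S) P = small_set U (max_elems P \<rightarrow>\<^sub>E S)" by (simp add: nabla_ob_def)

lemma nv_in: "s \<in> max_elems P \<rightarrow>\<^sub>E S \<Longrightarrow> nv S P s \<in> fob (nabla_ob U S) P"
  by (simp add: nv_def fob_nabla code_in)

lemma nvE:
  assumes "t \<in> fob (nabla_ob U S) P" obtains s where "s \<in> max_elems P \<rightarrow>\<^sub>E S" "t = nv S P s"
  using assms that by (auto simp: fob_nabla nv_def elim!: small_setE)

lemma nv_eq_iff: "S \<in> U \<Longrightarrow> finite_poset P \<Longrightarrow> s \<in> max_elems P \<rightarrow>\<^sub>E S \<Longrightarrow> s' \<in> max_elems P \<rightarrow>\<^sub>E S \<Longrightarrow>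
    nv S P s = nv S P s' \<longleftrightarrow> s = s'"
  by (simp add: nv_def code_eq_iff small_nabla)

lemma rs_nabla:
  assumes S: "S \<in> U" and f: "f \<in> hom Kp Q P" and s: "s \<in> max_elems P \<rightarrow>\<^sub>E S"
  shows "rs (nabla_ob U S) f (nv S P s) = nv S Q (compose (max_elems Q) s (pap f))"
  unfolding nabla_ob_coded nv_def
  using rs_coded[of U "\<lambda>P. max_elems P \<rightarrow>\<^sub>E S", OF small_nabla[OF S hom_Kp_fp(2)[OF f]] f s] hom_D(2)[OF f] by simp

lemma compose_PiE: "f \<in> hom Kp Q P \<Longrightarrow> s \<in> max_elems P \<rightarrow>\<^sub>E S \<Longrightarrow> compose (max_elems Q) s (pap f) \<in> max_elems Q \<rightarrow>\<^sub>E S"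
  using Kp_max(1)[of f Q P] by (auto simp: compose_def)

lemma rs_nabla_ptm:
  assumes S: "S \<in> U" and P: "finite_poset P" and p: "p \<in> max_elems P" and s: "s \<in> max_elems P \<rightarrow>\<^sub>E S"
  shows "rs (nabla_ob U S) (ptm P p) (nv S P s) = nv S pt (\<lambda>_\<in>{0}. s p)"
proof -
  have "compose (max_elems pt) s (pap (ptm P p)) = (\<lambda>_\<in>{0}. s p)" by (auto simp: compose_def fun_eq_iff)
  then show ?thesis using rs_nabla[OF S ptm_hom[OF P p] s] by simp
qed

lemma far_nabla:
  "far (nabla U) (S, g, T) = mkm (nabla_ob U S) (nabla_ob U T)
     (\<lambda>P. app (small_map U (max_elems P \<rightarrow>\<^sub>E S) (max_elems P \<rightarrow>\<^sub>E T) (\<lambda>s. compose (max_elems P) g s)))"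
  by (auto simp: nabla_def mkm_def fob_nabla small_map_def fun_eq_iff restrict_def)

lemma fob_nabla_func [simp]: "fob (nabla U) S = nabla_ob U S" by (simp add: nabla_def)

lemma cp_nabla:
  assumes g: "g \<in> hom (Sets U) S T" and P: "finite_poset P" and s: "s \<in> max_elems P \<rightarrow>\<^sub>E S"
  shows "cp (far (nabla U) g) P (nv S P s) = nv T P (compose (max_elems P) (app g) s)"
proof -
  obtain g' where g': "g = (S, g', T)" and S: "S \<in> U" using g by (auto simp: hom_Sets)
  show ?thesis unfolding g' far_nabla using cp_mkm[OF P nv_in[OF s]] app_small_map[OF small_nabla[OF S P] s] by (simp add: nv_def)
qed

lemma compose_app_PiE: "g \<in> hom (Sets U) S T \<Longrightarrow> s \<in> max_elems P \<rightarrow>\<^sub>E S \<Longrightarrow> compose (max_elems P) (app g) s \<in> max_elems P \<rightarrow>\<^sub>E T"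
  using app_in[of g U S T] by (auto simp: compose_def PiE_iff)

lemma nabla_hom:
  assumes g: "g \<in> hom (Sets U) S T"
  shows "far (nabla U) g \<in> hom (KK U) (nabla_ob U S) (nabla_ob U T)"
proof -
  obtain g' where g': "g = (S, g', T)" and S: "S \<in> U" and T: "T \<in> U" using g by (auto simp: hom_Sets)
  let ?h = "\<lambda>P. app (small_map U (max_elems P \<rightarrow>\<^sub>E S) (max_elems P \<rightarrow>\<^sub>E T) (\<lambda>s. compose (max_elems P) g' s))"
  have h: "?h P (nv S P s) = nv T P (compose (max_elems P) (app g) s)" if "finite_poset P" "s \<in> max_elems P \<rightarrow>\<^sub>E S" for P s
    using app_small_map[OF small_nabla[OF S that(1)] that(2)] g' by (simp add: nv_def)
  show ?thesis
    unfolding g' far_nabla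
  proof (rule mkm_hom[OF nabla_ob_KK[OF S] nabla_ob_KK[OF T]])
    fix P t assume P: "finite_poset P" and "t \<in> fob (nabla_ob U S) P"
    then obtain s where s: "s \<in> max_elems P \<rightarrow>\<^sub>E S" "t = nv S P s" by (metis nvE)
    then show "?h P t \<in> fob (nabla_ob U T) P" using h[OF P s(1)] nv_in[OF compose_app_PiE[OF g s(1)]] by simp
  next
    fix P Q f t assume f: "f \<in> hom Kp Q P" and "t \<in> fob (nabla_ob U S) P"
    then obtain s where s: "s \<in> max_elems P \<rightarrow>\<^sub>E S" "t = nv S P s" by (metis nvE)
    note c = compose_PiE[OF f s(1)] and ca = compose_app_PiE[OF g s(1)]
    have "compose (max_elems Q) (app g) (compose (max_elems Q) s (pap f)) =
        compose (max_elems Q) (compose (max_elems P) (app g) s) (pap f)"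
      using Kp_max(1)[OF f] by (auto simp: compose_def intro!: restrict_ext)
    then show "?h Q (rs (nabla_ob U S) f t) = rs (nabla_ob U T) f (?h P t)"
      using s(2) rs_nabla[OF S f s(1)] h[OF hom_Kp_fp(1)[OF f] c] h[OF hom_Kp_fp(2)[OF f] s(1)] rs_nabla[OF T f ca] by simp
  qed
qed

lemma is_functor_nabla: "is_functor (Sets U) (KK U) (nabla U)"
proof (rule is_functorI[OF category_Sets category_KK])
  fix S assume "S \<in> Obj (Sets U)" then show "fob (nabla U) S \<in> Obj (KK U)" using nabla_ob_KK by simp
next
  fix S T g assume "g \<in> hom (Sets U) S T"
  then show "far (nabla U) g \<in> hom (KK U) (fob (nabla U) S) (fob (nabla U) T)" using nabla_hom by simp
next
  fix S assume S': "S \<in> Obj (Sets U)"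
  then have S: "S \<in> U" by simp
  note i = cat_ide[OF category_Sets S']
  note N = nabla_ob_KK[OF S]
  have "far (nabla U) (Ide (Sets U) S) = Ide (KK U) (nabla_ob U S)"
  proof (rule KK_eqI[OF nabla_hom[OF i] cat_ide[OF category_KK N]])
    fix P t assume P: "finite_poset P" and t: "t \<in> fob (nabla_ob U S) P"
    then obtain s where s: "s \<in> max_elems P \<rightarrow>\<^sub>E S" "t = nv S P s" by (metis nvE)
    have "compose (max_elems P) (app (Ide (Sets U) S)) s = s"
      using s(1) by (auto simp: compose_def fun_eq_iff PiE_iff extensional_def)
    then show "cp (far (nabla U) (Ide (Sets U) S)) P t = cp (Ide (KK U) (nabla_ob U S)) P t"
      using cp_nabla[OF i P s(1)] s(2) cp_Ide[OF P t] by simp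
  qed
  then show "far (nabla U) (Ide (Sets U) S) = Ide (KK U) (fob (nabla U) S)" by simp
next
  fix R S T f g assume f: "f \<in> hom (Sets U) R S" and g: "g \<in> hom (Sets U) S T"
  note gf = cat_cmp[OF category_Sets f g]
  note nf = nabla_hom[OF f] and ng = nabla_hom[OF g]
  show "far (nabla U) (Cmp (Sets U) g f) = Cmp (KK U) (far (nabla U) g) (far (nabla U) f)"
  proof (rule KK_eqI[OF nabla_hom[OF gf] cat_cmp[OF category_KK nf ng]])
    fix P t assume P: "finite_poset P" and t: "t \<in> fob (nabla_ob U R) P"
    then obtain s where s: "s \<in> max_elems P \<rightarrow>\<^sub>E R" "t = nv R P s" by (metis nvE)
    have "compose (max_elems P) (app (Cmp (Sets U) g f)) s = compose (max_elems P) (app g) (compose (max_elems P) (app f) s)"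
      using s(1) app_Cmp[OF f g] by (auto simp: compose_def PiE_iff intro!: restrict_ext)
    then show "cp (far (nabla U) (Cmp (Sets U) g f)) P t = cp (Cmp (KK U) (far (nabla U) g) (far (nabla U) f)) P t"
      using cp_nabla[OF gf P s(1)] cp_nabla[OF f P s(1)] cp_nabla[OF g P compose_app_PiE[OF f s(1)]] s(2) cp_Cmp[OF nf ng P t]
      by simp
  qed
qed

text \<open>Sections of \<nabla>\<open>S\<close> are functions on maximal elements, and restriction
  to a point is evaluation at that element.\<close>

lemma nabla_eqI:
  assumes S: "S \<in> U" and P: "finite_poset P" and t: "t \<in> fob (nabla_ob U S) P" "t' \<in> fob (nabla_ob U S) P"
    and eq: "\<And>p. p \<in> max_elems P \<Longrightarrow> rs (nabla_ob U S) (ptm P p) t = rs (nabla_ob U S) (ptm P p) t'"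
  shows "t = t'"
proof -
  obtain s where s: "s \<in> max_elems P \<rightarrow>\<^sub>E S" "t = nv S P s" using nvE[OF t(1)] .
  obtain s' where s': "s' \<in> max_elems P \<rightarrow>\<^sub>E S" "t' = nv S P s'" using nvE[OF t(2)] .
  have "s = s'"
  proof (rule PiE_ext[OF s(1) s'(1)])
    fix p assume p: "p \<in> max_elems P"
    have "s p \<in> S" "s' p \<in> S" using p s(1) s'(1) by (auto simp: PiE_iff)
    then have "(\<lambda>_\<in>{0}. s p) = (\<lambda>_\<in>{0::nat}. s' p)"
      using eq[OF p] rs_nabla_ptm[OF S P p s(1)] rs_nabla_ptm[OF S P p s'(1)] s(2) s'(2)
        nv_eq_iff[OF S fp_pt, of "\<lambda>_\<in>{0}. s p" "\<lambda>_\<in>{0}. s' p"] by (simp add: PiE_iff)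
    from fun_cong[OF this, of 0] show "s p = s' p" by simp
  qed
  then show ?thesis using s s' by simp
qed

lemma nabla_pt_bij: "S \<in> U \<Longrightarrow> bij_betw (\<lambda>c. nv S pt (\<lambda>_\<in>{0}. c)) S (fob (nabla_ob U S) pt)"
proof (rule bij_betw_imageI)
  assume S: "S \<in> U"
  show "inj_on (\<lambda>c. nv S pt (\<lambda>_\<in>{0}. c)) S"
  proof (rule inj_onI)
    fix c d assume "c \<in> S" "d \<in> S" "nv S pt (\<lambda>_\<in>{0}. c) = nv S pt (\<lambda>_\<in>{0}. d)"
    then have "(\<lambda>_\<in>{0::nat}. c) = (\<lambda>_\<in>{0}. d)" using nv_eq_iff[OF S fp_pt, of "\<lambda>_\<in>{0}. c" "\<lambda>_\<in>{0}. d"] by (simp add: PiE_iff)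
    from fun_cong[OF this, of 0] show "c = d" by simp
  qed
  show "(\<lambda>c. nv S pt (\<lambda>_\<in>{0}. c)) ` S = fob (nabla_ob U S) pt"
  proof (intro equalityI subsetI)
    fix t assume "t \<in> (\<lambda>c. nv S pt (\<lambda>_\<in>{0}. c)) ` S"
    then show "t \<in> fob (nabla_ob U S) pt" by (auto intro!: nv_in)
  next
    fix t assume "t \<in> fob (nabla_ob U S) pt"
    then obtain s where s: "s \<in> {0} \<rightarrow>\<^sub>E S" "t = nv S pt s" by (metis nvE max_elems_pt)
    then have e: "s = (\<lambda>_\<in>{0}. s 0)" and s0: "s 0 \<in> S" by (auto simp: fun_eq_iff PiE_iff extensional_def)
    have "t = nv S pt (\<lambda>_\<in>{0}. s 0)" using s(2) arg_cong[OF e, of "nv S pt"] by (rule trans)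
    then show "t \<in> (\<lambda>c. nv S pt (\<lambda>_\<in>{0}. c)) ` S" using s0 by (rule image_eqI)
  qed
qed

text \<open>Over \<open>pt\<close>, \<nabla>\<open>S\<close> is \<open>S\<close> itself, so an arrow
  induces a function between the sets. Naturality along the points shows that the arrow is recovered
  from this function.\<close>

lemma fully_faithful_nabla: "fully_faithful (Sets U) (KK U) (nabla U)"
  unfolding fully_faithful_def
proof (intro ballI)
  fix S T assume "S \<in> Obj (Sets U)" "T \<in> Obj (Sets U)"
  then have S: "S \<in> U" and T: "T \<in> U" by simp_all
  let ?c = "\<lambda>S c. nv S pt (\<lambda>_\<in>{0}. c)"
  have cS: "?c S c \<in> fob (nabla_ob U S) pt" if "c \<in> S" for c using bij_betwE[OF nabla_pt_bij[OF S]] that by blast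
  have cp_c: "cp (far (nabla U) g) pt (?c S c) = ?c T (app g c)" if g: "g \<in> hom (Sets U) S T" and c: "c \<in> S" for g c
  proof -
    have "(\<lambda>_\<in>{0}. c) \<in> max_elems pt \<rightarrow>\<^sub>E S" using c by auto
    moreover have "compose (max_elems pt) (app g) (\<lambda>_\<in>{0}. c) = (\<lambda>_\<in>{0}. app g c)" by (auto simp: compose_def fun_eq_iff)
    ultimately show ?thesis using cp_nabla[OF g fp_pt] by simp
  qed
  have "bij_betw (far (nabla U)) (hom (Sets U) S T) (hom (KK U) (nabla_ob U S) (nabla_ob U T))"
  proof (rule bij_betw_imageI)
    show "inj_on (far (nabla U)) (hom (Sets U) S T)"
    proof (rule inj_onI)
      fix g g' assume g: "g \<in> hom (Sets U) S T" and g': "g' \<in> hom (Sets U) S T" and eq: "far (nabla U) g = far (nabla U) g'"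
      show "g = g'"
      proof (rule hom_Sets_eqI[OF g g'])
        fix c assume c: "c \<in> S"
        have "?c T (app g c) = ?c T (app g' c)" using cp_c[OF g c] cp_c[OF g' c] eq by simp
        then show "app g c = app g' c"
          using inj_onD[OF bij_betw_imp_inj_on[OF nabla_pt_bij[OF T]]] app_in[OF g c] app_in[OF g' c] by blast
      qed
    qed
    show "far (nabla U) ` hom (Sets U) S T = hom (KK U) (nabla_ob U S) (nabla_ob U T)"
    proof (intro equalityI subsetI)
      fix m assume "m \<in> far (nabla U) ` hom (Sets U) S T"
      then show "m \<in> hom (KK U) (nabla_ob U S) (nabla_ob U T)" using nabla_hom by blast
    next
      fix m assume m: "m \<in> hom (KK U) (nabla_ob U S) (nabla_ob U T)"
      have "\<forall>c\<in>S. \<exists>d\<in>T. cp m pt (?c S c) = ?c T d"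
      proof
        fix c assume "c \<in> S"
        from cp_in[OF m fp_pt cS[OF this]] have "cp m pt (?c S c) \<in> ?c T ` T"
          using bij_betw_imp_surj_on[OF nabla_pt_bij[OF T]] by simp
        then show "\<exists>d\<in>T. cp m pt (?c S c) = ?c T d" by blast
      qed
      \<comment> \<open>The function is read off from the action of \<open>m\<close> over
        \<open>pt\<close>.\<close>
      then obtain h where h: "\<And>c. c \<in> S \<Longrightarrow> h c \<in> T" "\<And>c. c \<in> S \<Longrightarrow> cp m pt (?c S c) = ?c T (h c)" by metis
      let ?g = "(S, restrict h S, T)"
      have g: "?g \<in> hom (Sets U) S T" using S T h(1) by (auto simp: hom_Sets)
      have "m = far (nabla U) ?g"
      proof (rule KK_eqI[OF m nabla_hom[OF g]])
        fix P t assume P: "finite_poset P" and t: "t \<in> fob (nabla_ob U S) P"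
        obtain s where s: "s \<in> max_elems P \<rightarrow>\<^sub>E S" "t = nv S P s" using nvE[OF t] .
        show "cp m P t = cp (far (nabla U) ?g) P t"
        proof (rule nabla_eqI[OF T P cp_in[OF m P t] cp_in[OF nabla_hom[OF g] P t]])
          fix p assume p: "p \<in> max_elems P"
          have c: "s p \<in> S" using s(1) p by (auto simp: PiE_iff)
          have "rs (nabla_ob U T) (ptm P p) (cp m P t) = ?c T (h (s p))"
            using cp_nat[OF m ptm_hom[OF P p] t] s(2) rs_nabla_ptm[OF S P p s(1)] h(2)[OF c] by simp
          moreover have "rs (nabla_ob U T) (ptm P p) (cp (far (nabla U) ?g) P t) = ?c T (h (s p))"
            using cp_nat[OF nabla_hom[OF g] ptm_hom[OF P p] t] s(2) rs_nabla_ptm[OF S P p s(1)] cp_c[OF g c] c by simp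
          ultimately show "rs (nabla_ob U T) (ptm P p) (cp m P t) = rs (nabla_ob U T) (ptm P p) (cp (far (nabla U) ?g) P t)"
            by simp
        qed
      qed
      then show "m \<in> far (nabla U) ` hom (Sets U) S T" using g by blast
    qed
  qed
  then show "bij_betw (far (nabla U)) (hom (Sets U) S T) (hom (KK U) (fob (nabla U) S) (fob (nabla U) T))" by simp
qed

subsection \<open>Global sections are the sections over the point\<close>

abbreviation "one \<equiv> terminal_obj (KK U)"

lemma Ide_pt_unique: "g \<in> hom Kp pt pt \<Longrightarrow> g = Ide Kp pt"
  using toPt_unique Ide_Kp_hom[OF fp_pt] by metis

text \<open>Supplies a witness for the choice in \<open>terminal_obj\<close>. The chosen object
  \<open>one\<close> is only known to be terminal, so its sections are computed through
  \<open>Y pt\<close> or through Yoneda.\<close>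

lemma terminal_Y_pt: "terminal (KK U) (Y pt)"
  unfolding terminal_def
proof (intro conjI ballI Y_KK[OF fp_pt])
  fix x assume x: "x \<in> Obj (KK U)"
  let ?m = "mkm x (Y pt) (\<lambda>P a. en pt (toPt P))"
  have m: "?m \<in> hom (KK U) x (Y pt)"
  proof (rule mkm_hom[OF x Y_KK[OF fp_pt]])
    fix P assume "finite_poset P" then show "en pt (toPt P) \<in> fob (Y pt) P" using en_in toPt_hom by blast
  next
    fix P Q f assume f: "f \<in> hom Kp Q P"
    show "en pt (toPt Q) = rs (Y pt) f (en pt (toPt P))"
      using rs_Y[OF toPt_hom[OF hom_Kp_fp(2)[OF f]] f] toPt_unique[OF cat_cmp[OF category_Kp f toPt_hom[OF hom_Kp_fp(2)[OF f]]]] by simp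
  qed
  show "\<exists>!f. f \<in> hom (KK U) x (Y pt)"
  proof (rule ex1I[of _ ?m], rule m)
    fix f assume f: "f \<in> hom (KK U) x (Y pt)"
    show "f = ?m"
    proof (rule KK_eqI[OF f m])
      fix P a assume P: "finite_poset P" and a: "a \<in> fob x P"
      obtain g where "g \<in> hom Kp P pt" "cp f P a = en pt g" using fob_YE[OF cp_in[OF f P a]] .
      then show "cp f P a = cp ?m P a" using toPt_unique P a by simp
    qed
  qed
qed

lemma terminal_one: "terminal (KK U) one"
  unfolding terminal_obj_def using someI[of "terminal (KK U)", OF terminal_Y_pt] .

lemma one_KK: "one \<in> Obj (KK U)" using terminal_one unfolding terminal_def by blast

text \<open>Sections of \<open>one\<close> over \<open>P\<close> are arrows from \<open>Y P\<close>
  to a terminal object.\<close>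

lemma fob_one_unique:
  assumes P: "finite_poset P" shows "\<exists>!t. t \<in> fob one P"
proof -
  have ex1: "\<exists>!f. f \<in> hom (KK U) (Y P) one" using terminal_one Y_KK[OF P] unfolding terminal_def by blast
  then obtain f where f: "f \<in> hom (KK U) (Y P) one" and fu: "\<forall>g. g \<in> hom (KK U) (Y P) one \<longrightarrow> g = f" by (rule ex1E)
  obtain t where t: "t \<in> fob one P" using yoneda[OF f P] by metis
  show ?thesis
  proof (rule ex1I[of _ t], rule t)
    fix t' assume t': "t' \<in> fob one P"
    have "yar one P t' = yar one P t" using fu[rule_format, OF yar_hom[OF one_KK P t]] fu[rule_format, OF yar_hom[OF one_KK P t']] by simp
    then show "t' = t" using yar_inj[OF one_KK P t' t] by simp
  qed
qed

definition star where "star = (THE t. t \<in> fob one pt)"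

lemma star: "star \<in> fob one pt" unfolding star_def using theI'[OF fob_one_unique[OF fp_pt]] .

text \<open>The only section of \<open>one\<close> over \<open>P\<close> is the restriction of
  \<open>star\<close> along the map to \<open>pt\<close>, so an arrow out of \<open>one\<close> is
  determined by its value at \<open>star\<close>, and any value can be prescribed.\<close>

lemma bij_betw_global_sections:
  assumes x: "x \<in> Obj (KK U)" shows "bij_betw (\<lambda>m. cp m pt star) (hom (KK U) one x) (fob x pt)"
proof (rule bij_betw_imageI)
  show "inj_on (\<lambda>m. cp m pt star) (hom (KK U) one x)"
  proof (rule inj_onI)
    fix m n assume m: "m \<in> hom (KK U) one x" and n: "n \<in> hom (KK U) one x" and eq: "cp m pt star = cp n pt star"
    show "m = n"
    proof (rule KK_eqI[OF m n])
      fix P t assume P: "finite_poset P" and t: "t \<in> fob one P"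
      have "t = rs one (toPt P) star" using fob_one_unique[OF P] t rs_in[OF one_KK toPt_hom[OF P] star] by auto
      then show "cp m P t = cp n P t" using cp_nat[OF m toPt_hom[OF P] star] cp_nat[OF n toPt_hom[OF P] star] eq by simp
    qed
  qed
  show "(\<lambda>m. cp m pt star) ` hom (KK U) one x = fob x pt"
  proof (intro equalityI subsetI)
    fix a assume "a \<in> (\<lambda>m. cp m pt star) ` hom (KK U) one x"
    then show "a \<in> fob x pt" using cp_in[OF _ fp_pt star] by blast
  next
    fix a assume a: "a \<in> fob x pt"
    obtain e where e: "e \<in> hom (KK U) one (Y pt)" using terminal_Y_pt one_KK unfolding terminal_def by blast
    note ya = yar_hom[OF x fp_pt a]
    obtain g where g: "g \<in> hom Kp pt pt" "cp e pt star = en pt g" using fob_YE[OF cp_in[OF e fp_pt star]] .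
    have "cp (Cmp (KK U) (yar x pt a) e) pt star = a"
      using cp_Cmp[OF e ya fp_pt star] g cp_yar[OF g(1)] Ide_pt_unique[OF g(1)] rs_id[OF x fp_pt a] by simp
    then show "a \<in> (\<lambda>m. cp m pt star) ` hom (KK U) one x" using cat_cmp[OF category_KK e ya] by (intro image_eqI) auto
  qed
qed

lemma small_hom_one: "x \<in> Obj (KK U) \<Longrightarrow> small U (hom (KK U) one x)"
  using small_inj[OF U small_mem[OF fob_in_U[OF _ fp_pt]]] bij_betw_global_sections unfolding bij_betw_def by blast

lemma is_functor_Gamma: "is_functor (KK U) (Sets U) (Gamma U)"
  unfolding Gamma_def using is_functor_hom_func[OF category_KK small_hom_one] .

lemma lex_Gamma: "preserves_finite_limits (KK U) (Sets U) (Gamma U)"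
  unfolding Gamma_def using hom_func_preserves_finite_limits[OF category_KK small_hom_one one_KK] .

section \<open>The unit of the adjunction between \<Gamma> and \<nabla>\<close>

definition gm :: "'u psh \<Rightarrow> 'u \<Rightarrow> 'u" where
  "gm x a = code U (hom (KK U) one x) (inv_into (hom (KK U) one x) (\<lambda>m. cp m pt star) a)"

lemma gm_bij:
  assumes x: "x \<in> Obj (KK U)" shows "bij_betw (gm x) (fob x pt) (fob (Gamma U) x)"
proof -
  have "bij_betw (code U (hom (KK U) one x) \<circ> inv_into (hom (KK U) one x) (\<lambda>m. cp m pt star)) (fob x pt) (small_set U (hom (KK U) one x))"
    using bij_betw_trans[OF bij_betw_inv_into[OF bij_betw_global_sections[OF x]] bij_betw_code[OF small_hom_one[OF x]]] .
  then show ?thesis by (simp add: gm_def[abs_def] Gamma_def hom_func_def comp_def)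
qed

lemma gm_nat:
  assumes m: "m \<in> hom (KK U) x y" and a: "a \<in> fob x pt"
  shows "app (far (Gamma U) m) (gm x a) = gm y (cp m pt a)"
proof -
  note x = hom_KK_obj(1)[OF m] and y = hom_KK_obj(2)[OF m]
  let ?s = "inv_into (hom (KK U) one x) (\<lambda>m. cp m pt star) a"
  have s: "?s \<in> hom (KK U) one x" "cp ?s pt star = a"
    using bij_betw_imp_surj_on[OF bij_betw_global_sections[OF x]] a
      inv_into_into[of a "\<lambda>m. cp m pt star" "hom (KK U) one x"] f_inv_into_f[of a "\<lambda>m. cp m pt star" "hom (KK U) one x"]
    by simp_all
  note ms = cat_cmp[OF category_KK s(1) m]
  have "cp (Cmp (KK U) m ?s) pt star = cp m pt a" using cp_Cmp[OF s(1) m fp_pt star] s(2) by simp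
  then have "inv_into (hom (KK U) one y) (\<lambda>m. cp m pt star) (cp m pt a) = Cmp (KK U) m ?s"
    using inv_into_f_f[OF bij_betw_imp_inj_on[OF bij_betw_global_sections[OF y]] ms] by simp
  then show ?thesis
    using app_small_map[OF small_hom_one[OF x] s(1)] by (simp add: gm_def Gamma_def hom_func_def hom_D[OF m])
qed

text \<open>A section goes to the family of its values at the points of \<open>P\<close>;
  \<open>gm\<close> turns each value over \<open>pt\<close> into the coded global section required
  by \<Gamma>.\<close>

definition nu :: "'u psh \<Rightarrow> 'u psharr" where
  "nu x = mkm x (nabla_ob U (fob (Gamma U) x))
     (\<lambda>P a. nv (fob (Gamma U) x) P (\<lambda>p\<in>max_elems P. gm x (rs x (ptm P p) a)))"

lemma Gamma_in_U: "x \<in> Obj (KK U) \<Longrightarrow> fob (Gamma U) x \<in> U" using fun_ob[OF is_functor_Gamma] by simp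

lemma nu_fun:
  assumes x: "x \<in> Obj (KK U)" and P: "finite_poset P" and a: "a \<in> fob x P"
  shows "(\<lambda>p\<in>max_elems P. gm x (rs x (ptm P p) a)) \<in> max_elems P \<rightarrow>\<^sub>E fob (Gamma U) x"
proof -
  have "gm x (rs x (ptm P p) a) \<in> fob (Gamma U) x" if "p \<in> max_elems P" for p
    using bij_betwE[OF gm_bij[OF x]] rs_in[OF x ptm_hom[OF P that] a] by blast
  then show ?thesis by simp
qed

lemma cp_nu: "finite_poset P \<Longrightarrow> a \<in> fob x P \<Longrightarrow>
    cp (nu x) P a = nv (fob (Gamma U) x) P (\<lambda>p\<in>max_elems P. gm x (rs x (ptm P p) a))"
  by (simp add: nu_def)

lemma nu_hom:
  assumes x: "x \<in> Obj (KK U)" shows "nu x \<in> hom (KK U) x (nabla_ob U (fob (Gamma U) x))"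
  unfolding nu_def
proof (rule mkm_hom[OF x nabla_ob_KK[OF Gamma_in_U[OF x]]])
  fix P a assume "finite_poset P" "a \<in> fob x P"
  then show "nv (fob (Gamma U) x) P (\<lambda>p\<in>max_elems P. gm x (rs x (ptm P p) a)) \<in> fob (nabla_ob U (fob (Gamma U) x)) P"
    using nv_in[OF nu_fun[OF x]] by blast
next
  fix P Q f a assume f: "f \<in> hom Kp Q P" and a: "a \<in> fob x P"
  note P = hom_Kp_fp(2)[OF f] and Q = hom_Kp_fp(1)[OF f]
  have "(\<lambda>q\<in>max_elems Q. gm x (rs x (ptm Q q) (rs x f a))) =
      compose (max_elems Q) (\<lambda>p\<in>max_elems P. gm x (rs x (ptm P p) a)) (pap f)"
    unfolding compose_def
  proof (rule restrict_ext)
    fix q assume q: "q \<in> max_elems Q"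
    show "gm x (rs x (ptm Q q) (rs x f a)) = (\<lambda>p\<in>max_elems P. gm x (rs x (ptm P p) a)) (pap f q)"
      using rs_cmp[OF x f ptm_hom[OF Q q] a] Kp_max[OF f q] by simp
  qed
  then show "nv (fob (Gamma U) x) Q (\<lambda>p\<in>max_elems Q. gm x (rs x (ptm Q p) (rs x f a))) =
      rs (nabla_ob U (fob (Gamma U) x)) f (nv (fob (Gamma U) x) P (\<lambda>p\<in>max_elems P. gm x (rs x (ptm P p) a)))"
    using rs_nabla[OF Gamma_in_U[OF x] f nu_fun[OF x P a]] by simp
qed

lemma ptm_pt: "ptm pt 0 = Ide Kp pt" using Ide_pt_unique[OF ptm_hom[OF fp_pt]] by simp

lemma cp_nu_pt:
  assumes x: "x \<in> Obj (KK U)" and a: "a \<in> fob x pt"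
  shows "cp (nu x) pt a = nv (fob (Gamma U) x) pt (\<lambda>_\<in>{0}. gm x a)"
proof -
  have "(\<lambda>p\<in>max_elems pt. gm x (rs x (ptm pt p) a)) = (\<lambda>_\<in>{0}. gm x a)"
    using ptm_pt rs_id[OF x fp_pt a] by (auto simp: fun_eq_iff)
  then show ?thesis using cp_nu[OF fp_pt a] by simp
qed

lemma cp_nabla_const:
  assumes g: "g \<in> hom (Sets U) S T" and c: "c \<in> S"
  shows "cp (far (nabla U) g) pt (nv S pt (\<lambda>_\<in>{0}. c)) = nv T pt (\<lambda>_\<in>{0}. app g c)"
proof -
  have "(\<lambda>_\<in>{0}. c) \<in> max_elems pt \<rightarrow>\<^sub>E S" using c by auto
  moreover have "compose (max_elems pt) (app g) (\<lambda>_\<in>{0}. c) = (\<lambda>_\<in>{0}. app g c)" by (auto simp: compose_def fun_eq_iff)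
  ultimately show ?thesis using cp_nabla[OF g fp_pt] by simp
qed

text \<open>Sections of \<nabla>\<open>S\<close> are separated by points, and naturality reduces the
  value at a point to the component over \<open>pt\<close>.\<close>

lemma into_nabla_eqI:
  assumes m: "m \<in> hom (KK U) x (nabla_ob U S)" and n: "n \<in> hom (KK U) x (nabla_ob U S)" and S: "S \<in> U"
    and eq: "\<And>a. a \<in> fob x pt \<Longrightarrow> cp m pt a = cp n pt a"
  shows "m = n"
proof (rule KK_eqI[OF m n])
  fix P a assume P: "finite_poset P" and a: "a \<in> fob x P"
  show "cp m P a = cp n P a"
  proof (rule nabla_eqI[OF S P cp_in[OF m P a] cp_in[OF n P a]])
    fix p assume p: "p \<in> max_elems P"
    note i = ptm_hom[OF P p]
    show "rs (nabla_ob U S) (ptm P p) (cp m P a) = rs (nabla_ob U S) (ptm P p) (cp n P a)"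
      using cp_nat[OF m i a] cp_nat[OF n i a] eq[OF rs_in[OF hom_KK_obj(1)[OF m] i a]] by simp
  qed
qed

lemma universal_unit_nabla: "universal_unit (KK U) (Sets U) (Gamma U) (nabla U) nu"
  unfolding universal_unit_def
proof (intro conjI is_functor_Gamma is_functor_nabla ballI allI)
  fix x assume "x \<in> Obj (KK U)"
  then show "nu x \<in> hom (KK U) x (fob (nabla U) (fob (Gamma U) x))" using nu_hom by simp
next
  fix x y m assume m: "m \<in> hom (KK U) x y"
  note x = hom_KK_obj(1)[OF m] and y = hom_KK_obj(2)[OF m]
  note Gm = fun_ar[OF is_functor_Gamma m]
  note nGm = nabla_hom[OF Gm]
  show "Cmp (KK U) (nu y) m = Cmp (KK U) (far (nabla U) (far (Gamma U) m)) (nu x)"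
  proof (rule into_nabla_eqI[OF cat_cmp[OF category_KK m nu_hom[OF y]] cat_cmp[OF category_KK nu_hom[OF x] nGm] Gamma_in_U[OF y]])
    fix a assume a: "a \<in> fob x pt"
    have g: "gm x a \<in> fob (Gamma U) x" using bij_betwE[OF gm_bij[OF x]] a by blast
    show "cp (Cmp (KK U) (nu y) m) pt a = cp (Cmp (KK U) (far (nabla U) (far (Gamma U) m)) (nu x)) pt a"
      using cp_Cmp[OF m nu_hom[OF y] fp_pt a] cp_Cmp[OF nu_hom[OF x] nGm fp_pt a] cp_nu_pt[OF x a]
        cp_nu_pt[OF y cp_in[OF m fp_pt a]] cp_nabla_const[OF Gm g] gm_nat[OF m a] by simp
  qed
next
  fix x S h assume x: "x \<in> Obj (KK U)" and "S \<in> Obj (Sets U)" and "h \<in> hom (KK U) x (fob (nabla U) S)"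
  then have S: "S \<in> U" and h: "h \<in> hom (KK U) x (nabla_ob U S)" by simp_all
  note gb = gm_bij[OF x]
  \<comment> \<open>The factoring function is forced over \<open>pt\<close>: it sends the global
    section \<open>gm x a\<close> to the element of \<open>S\<close> that encodes the value of
    \<open>h\<close> at \<open>a\<close>.\<close>
  have "\<forall>c\<in>fob (Gamma U) x. \<exists>d\<in>S. \<forall>a\<in>fob x pt. gm x a = c \<longrightarrow> cp h pt a = nv S pt (\<lambda>_\<in>{0}. d)"
  proof
    fix c assume "c \<in> fob (Gamma U) x"
    then obtain a where a: "a \<in> fob x pt" "c = gm x a" using bij_betw_imp_surj_on[OF gb] by blast
    have "cp h pt a \<in> (\<lambda>c. nv S pt (\<lambda>_\<in>{0}. c)) ` S"
      using cp_in[OF h fp_pt a(1)] bij_betw_imp_surj_on[OF nabla_pt_bij[OF S]] by simp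
    then obtain d where d: "d \<in> S" "cp h pt a = nv S pt (\<lambda>_\<in>{0}. d)" by blast
    have "a' = a" if "a' \<in> fob x pt" "gm x a' = c" for a'
      using inj_onD[OF bij_betw_imp_inj_on[OF gb], of a' a] that a by simp
    then show "\<exists>d\<in>S. \<forall>a\<in>fob x pt. gm x a = c \<longrightarrow> cp h pt a = nv S pt (\<lambda>_\<in>{0}. d)" using d by blast
  qed
  then obtain k where k0: "\<forall>c\<in>fob (Gamma U) x. k c \<in> S \<and> (\<forall>a\<in>fob x pt. gm x a = c \<longrightarrow> cp h pt a = nv S pt (\<lambda>_\<in>{0}. k c))"
    by metis
  have g: "gm x a \<in> fob (Gamma U) x" if "a \<in> fob x pt" for a using bij_betwE[OF gb] that by blast
  have k: "cp h pt a = nv S pt (\<lambda>_\<in>{0}. k (gm x a))" if "a \<in> fob x pt" for a using k0 g[OF that] that by blast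
  let ?k = "(fob (Gamma U) x, restrict k (fob (Gamma U) x), S)"
  have kh: "?k \<in> hom (Sets U) (fob (Gamma U) x) S" using k0 Gamma_in_U[OF x] S by (auto simp: hom_Sets)
  have cpk: "cp (Cmp (KK U) (far (nabla U) k') (nu x)) pt a = nv S pt (\<lambda>_\<in>{0}. app k' (gm x a))"
    if k': "k' \<in> hom (Sets U) (fob (Gamma U) x) S" and a: "a \<in> fob x pt" for k' a
    using cp_Cmp[OF nu_hom[OF x] nabla_hom[OF k'] fp_pt a] cp_nu_pt[OF x a] cp_nabla_const[OF k' g[OF a]] by simp
  show "\<exists>!k. k \<in> hom (Sets U) (fob (Gamma U) x) S \<and> Cmp (KK U) (far (nabla U) k) (nu x) = h"
  proof (rule ex1I[of _ ?k])
    have "Cmp (KK U) (far (nabla U) ?k) (nu x) = h"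
      by (rule into_nabla_eqI[OF cat_cmp[OF category_KK nu_hom[OF x] nabla_hom[OF kh]] h S])
        (simp add: cpk[OF kh] k g)
    then show "?k \<in> hom (Sets U) (fob (Gamma U) x) S \<and> Cmp (KK U) (far (nabla U) ?k) (nu x) = h" using kh by blast
  next
    fix k' assume k': "k' \<in> hom (Sets U) (fob (Gamma U) x) S \<and> Cmp (KK U) (far (nabla U) k') (nu x) = h"
    show "k' = ?k"
    proof (rule hom_Sets_eqI[OF conjunct1[OF k'] kh])
      fix c assume c: "c \<in> fob (Gamma U) x"
      then obtain a where a: "a \<in> fob x pt" "c = gm x a" using bij_betw_imp_surj_on[OF gb] by blast
      have "nv S pt (\<lambda>_\<in>{0}. app k' c) = nv S pt (\<lambda>_\<in>{0}. k c)"
        using cpk[OF conjunct1[OF k'] a(1)] conjunct2[OF k'] k[OF a(1)] a(2) by simp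
      then have "app k' c = k c"
        using inj_onD[OF bij_betw_imp_inj_on[OF nabla_pt_bij[OF S]]] app_in[OF conjunct1[OF k'] c] k0 c by blast
      then show "app k' c = app ?k c" using c by simp
    qed
  qed
qed

lemma geometric_embedding_nabla: "geometric_embedding (Sets U) (KK U) (Gamma U) (nabla U)"
  unfolding geometric_embedding_def
  using universal_unit_imp_left_adjoint[OF universal_unit_nabla] lex_Gamma fully_faithful_nabla by blast

end

section \<open>Double negation sheaves\<close>

text \<open>The empty poset. Its representable sheaf has no points and gives the bottom subobject of
  every sheaf.\<close>

definition ep :: poset where "ep = ({}, {})"

lemma ep_simps [simp]: "fst ep = {}" "snd ep = {}" by (simp_all add: ep_def)

lemma fp_ep: "finite_poset ep" unfolding ep_def by (rule finite_posetI) auto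

lemma SubD:
  assumes "n \<in> Sub (KK U) b"
  shows "n \<in> hom (KK U) (Dom (KK U) n) b" "monic (KK U) n"
  using assms unfolding Sub_def monic_def by (auto simp: hom_iff)

lemma SubI:
  assumes "m \<in> hom (KK U) a b" "\<And>P. finite_poset P \<Longrightarrow> inj_on (cp m P) (fob a P)"
  shows "m \<in> Sub (KK U) b"
  unfolding Sub_def using monicI[OF assms] hom_D(3)[OF assms(1)] by simp

lemma sub_leI: "f \<in> hom C (Dom C m) (Dom C n) \<Longrightarrow> m = Cmp C n f \<Longrightarrow> sub_le C m n"
  unfolding sub_le_def by blast

lemma sub_leE:
  assumes "sub_le C m n" obtains f where "f \<in> hom C (Dom C m) (Dom C n)" "m = Cmp C n f"
  using assms unfolding sub_le_def by blast

context small_universe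
begin

section \<open>Sheaves without points as least subobjects\<close>

lemma no_points_empty:
  assumes x: "x \<in> Obj (KK U)" and np: "fob x pt = {}" and P: "finite_poset P" and a: "a \<in> fob x P"
  shows "fst P = {}"
proof (rule ccontr)
  assume "fst P \<noteq> {}"
  then obtain p where "p \<in> fst P" by blast
  then obtain q where "q \<in> max_elems P" using ex_max_above[OF P] by metis
  then have "rs x (ptm P q) a \<in> fob x pt" using rs_in[OF x ptm_hom[OF P] a] by blast
  then show False using np by simp
qed

text \<open>A nonempty poset has a maximal element, at which any section restricts to a point. So
  \<open>k\<close> has sections over the empty poset only, where every sheaf has exactly one
  section, and \<open>k\<close> maps uniquely to everything.\<close>

lemma no_points_factor:
  assumes l: "l \<in> hom (KK U) k b" and np: "fob k pt = {}" and n: "n \<in> hom (KK U) c b"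
  obtains h where "h \<in> hom (KK U) k c" "Cmp (KK U) n h = l"
proof -
  note k = hom_KK_obj(1)[OF l] and c = hom_KK_obj(1)[OF n] and b = hom_KK_obj(2)[OF n]
  let ?h = "mkm k c (\<lambda>P _. THE s. s \<in> fob c P)"
  have the: "(THE s. s \<in> fob c P) \<in> fob c P" if "finite_poset P" "t \<in> fob k P" for P t
    using theI'[OF fob_empty[OF c that(1) no_points_empty[OF k np that]]] .
  have h: "?h \<in> hom (KK U) k c"
  proof (rule mkm_hom[OF k c the])
    fix P Q f t assume f: "f \<in> hom Kp Q P" and t: "t \<in> fob k P"
    note P = hom_Kp_fp(2)[OF f] and Q = hom_Kp_fp(1)[OF f]
    note t' = rs_in[OF k f t]
    have "\<exists>!s. s \<in> fob c Q" using fob_empty[OF c Q no_points_empty[OF k np Q t']] .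
    then show "(THE s. s \<in> fob c Q) = rs c f (THE s. s \<in> fob c P)"
      using the[OF Q t'] rs_in[OF c f the[OF P t]] by (auto simp del: ex1_eq)
  qed
  have "Cmp (KK U) n ?h = l"
  proof (rule KK_eqI[OF cat_cmp[OF category_KK h n] l])
    fix P t assume P: "finite_poset P" and t: "t \<in> fob k P"
    have "\<exists>!s. s \<in> fob b P" using fob_empty[OF b P no_points_empty[OF k np P t]] .
    then show "cp (Cmp (KK U) n ?h) P t = cp l P t"
      using cp_in[OF cat_cmp[OF category_KK h n] P t] cp_in[OF l P t] by auto
  qed
  then show ?thesis using that h by blast
qed

lemma no_points_le:
  assumes "k \<in> Sub (KK U) b" "fob (Dom (KK U) k) pt = {}" "k' \<in> Sub (KK U) b"
  shows "sub_le (KK U) k k'"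
proof -
  obtain h where "h \<in> hom (KK U) (Dom (KK U) k) (Dom (KK U) k')" "Cmp (KK U) k' h = k"
    using no_points_factor[OF SubD(1)[OF assms(1)] assms(2) SubD(1)[OF assms(3)]] .
  then show ?thesis using sub_leI by metis
qed

lemma le_no_points:
  assumes "sub_le (KK U) k n" "fob (Dom (KK U) n) pt = {}" shows "fob (Dom (KK U) k) pt = {}"
proof -
  obtain f where f: "f \<in> hom (KK U) (Dom (KK U) k) (Dom (KK U) n)" using assms(1) by (rule sub_leE)
  show ?thesis using cp_in[OF f fp_pt] assms(2) by auto
qed

text \<open>The arrow from \<open>Y ep\<close> given by the unique section of \<open>b\<close> over
  the empty poset is injective, because two maps into the empty poset are equal.\<close>

lemma ex_bottom:
  assumes b: "b \<in> Obj (KK U)" obtains n where "n \<in> Sub (KK U) b" "fob (Dom (KK U) n) pt = {}"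
proof -
  obtain a where a: "a \<in> fob b ep" using fob_empty[OF b fp_ep] by auto
  note n = yar_hom[OF b fp_ep a]
  have 1: "yar b ep a \<in> Sub (KK U) b"
  proof (rule SubI[OF n], rule inj_onI)
    fix P s t assume P: "finite_poset P" and "s \<in> fob (Y ep) P" "t \<in> fob (Y ep) P"
    then obtain g h where g: "g \<in> hom Kp P ep" "s = en ep g" and h: "h \<in> hom Kp P ep" "t = en ep h" by (metis fob_YE)
    have "g = h" by (rule hom_Kp_eqI[OF g(1) h(1)]) (use Kp_in[OF g(1)] in auto)
    then show "s = t" using g h by simp
  qed
  have 2: "fob (Y ep) pt = {}"
  proof (rule ccontr)
    assume "fob (Y ep) pt \<noteq> {}"
    then obtain g where g: "g \<in> hom Kp pt ep" by (metis all_not_in_conv fob_YE)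
    show False using Kp_in[OF g, of 0] by simp
  qed
  show ?thesis using that[OF 1] 2 hom_D(2)[OF n] by simp
qed

lemma least_no_points:
  assumes "k \<in> Sub (KK U) b" "\<And>k'. k' \<in> Sub (KK U) b \<Longrightarrow> sub_le (KK U) k k'"
  shows "fob (Dom (KK U) k) pt = {}"
proof -
  obtain n where "n \<in> Sub (KK U) b" "fob (Dom (KK U) n) pt = {}"
    using ex_bottom[OF hom_KK_obj(2)[OF SubD(1)[OF assms(1)]]] .
  then show ?thesis using le_no_points assms(2) by blast
qed

text \<open>A point defines a subobject because two maps from any poset to \<open>pt\<close> are
  equal.\<close>

lemma point_Sub:
  assumes b: "b \<in> Obj (KK U)" and \<beta>: "\<beta> \<in> fob b pt"
  shows "yar b pt \<beta> \<in> Sub (KK U) b"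
proof (rule SubI[OF yar_hom[OF b fp_pt \<beta>]], rule inj_onI)
  fix P s t assume P: "finite_poset P" and "s \<in> fob (Y pt) P" "t \<in> fob (Y pt) P"
  then obtain g h where g: "g \<in> hom Kp P pt" "s = en pt g" and h: "h \<in> hom Kp P pt" "t = en pt h" by (metis fob_YE)
  then show "s = t" using toPt_unique[OF g(1)] toPt_unique[OF h(1)] by simp
qed

lemma disjoint_no_points:
  assumes "fob (Dom (KK U) m) pt = {} \<or> fob (Dom (KK U) n) pt = {}"
  shows "sub_disjoint (KK U) b m n"
  unfolding sub_disjoint_def
proof (intro ballI impI)
  fix k k' assume k: "k \<in> Sub (KK U) b" and le: "sub_le (KK U) k m \<and> sub_le (KK U) k n" and k': "k' \<in> Sub (KK U) b"
  have "fob (Dom (KK U) k) pt = {}" using le_no_points le assms by blast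
  then show "sub_le (KK U) k k'" using no_points_le[OF k _ k'] by blast
qed

lemma Ide_Sub: "b \<in> Obj (KK U) \<Longrightarrow> Ide (KK U) b \<in> Sub (KK U) b"
  by (rule SubI[OF cat_ide[OF category_KK]]) (auto intro!: inj_onI simp: cp_Ide)

lemma sub_le_Ide: "n \<in> Sub (KK U) b \<Longrightarrow> sub_le (KK U) n (Ide (KK U) b)"
  using SubD(1)[of n U b] cat_idl[OF category_KK SubD(1)[of n U b]]
    hom_D(2)[OF cat_ide[OF category_KK hom_KK_obj(2)[OF SubD(1)[of n U b]]]]
  by (intro sub_leI[of n]) simp_all

lemma sub_le_refl: "n \<in> Sub (KK U) b \<Longrightarrow> sub_le (KK U) n n"
  by (rule sub_leI[OF cat_ide[OF category_KK hom_KK_obj(1)[OF SubD(1)]] cat_idr[OF category_KK SubD(1), symmetric]])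

text \<open>A point \<open>\<beta>\<close> outside \<open>m\<close> would be a subobject disjoint from \<open>m\<close>, hence contained in the negation
  of \<open>m\<close>, which has no points.\<close>

lemma nn_dense_bij:
  assumes nn: "nn_dense (KK U) b m"
  shows "bij_betw (cp m pt) (fob (Dom (KK U) m) pt) (fob b pt)"
proof -
  let ?a = "Dom (KK U) m"
  obtain n where mS: "m \<in> Sub (KK U) b" and neg: "is_neg (KK U) b m n" and neg2: "is_neg (KK U) b n (Ide (KK U) b)"
    using nn unfolding nn_dense_def by blast
  note m = SubD(1)[OF mS]
  note a = hom_KK_obj(1)[OF m] and b = hom_KK_obj(2)[OF m]
  have nS: "n \<in> Sub (KK U) b" using neg unfolding is_neg_def by blast
  \<comment> \<open>Since the negation of \<open>n\<close> is everything, \<open>n\<close> is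
    disjoint from the top element; as \<open>n\<close> lies below both, it is least.\<close>
  have "sub_le (KK U) n k'" if "k' \<in> Sub (KK U) b" for k'
    using neg2 nS sub_le_refl[OF nS] sub_le_Ide[OF nS] that unfolding is_neg_def sub_disjoint_def by blast
  then have np: "fob (Dom (KK U) n) pt = {}" using least_no_points[OF nS] by blast
  show ?thesis
  proof (rule bij_betw_imageI)
    show "inj_on (cp m pt) (fob ?a pt)"
    proof (rule inj_onI)
      fix s t assume s: "s \<in> fob ?a pt" and t: "t \<in> fob ?a pt" and eq: "cp m pt s = cp m pt t"
      \<comment> \<open>A monomorphism is injective on points, since points of \<open>?a\<close> are
        arrows out of \<open>Y pt\<close>.\<close>
      have "Cmp (KK U) m (yar ?a pt s) = Cmp (KK U) m (yar ?a pt t)" using yar_Cmp[OF m fp_pt s] yar_Cmp[OF m fp_pt t] eq by simp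
      then have "yar ?a pt s = yar ?a pt t"
        using SubD(2)[OF mS] yar_hom[OF a fp_pt s] yar_hom[OF a fp_pt t] unfolding monic_def by blast
      then show "s = t" using yar_inj[OF a fp_pt s t] by simp
    qed
    show "cp m pt ` fob ?a pt = fob b pt"
    proof (intro equalityI subsetI)
      fix \<beta> assume "\<beta> \<in> cp m pt ` fob ?a pt" then show "\<beta> \<in> fob b pt" using cp_in[OF m fp_pt] by blast
    next
      fix \<beta> assume \<beta>: "\<beta> \<in> fob b pt"
      let ?k = "yar b pt \<beta>"
      note k = yar_hom[OF b fp_pt \<beta>] and kS = point_Sub[OF b \<beta>]
      show "\<beta> \<in> cp m pt ` fob ?a pt"
      proof (rule ccontr)
        assume nin: "\<beta> \<notin> cp m pt ` fob ?a pt"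
        have "sub_disjoint (KK U) b m ?k"
          unfolding sub_disjoint_def
        proof (intro ballI impI)
          fix l k' assume lS: "l \<in> Sub (KK U) b" and le: "sub_le (KK U) l m \<and> sub_le (KK U) l ?k" and k': "k' \<in> Sub (KK U) b"
          obtain f where f: "f \<in> hom (KK U) (Dom (KK U) l) ?a" "l = Cmp (KK U) m f" using conjunct1[OF le] by (rule sub_leE)
          obtain g where g: "g \<in> hom (KK U) (Dom (KK U) l) (Y pt)" "l = Cmp (KK U) ?k g"
            using conjunct2[OF le] unfolding sub_le_def hom_D(2)[OF k] by blast
          have "fob (Dom (KK U) l) pt = {}"
          proof (rule ccontr)
            assume "fob (Dom (KK U) l) pt \<noteq> {}"
            then obtain s where s: "s \<in> fob (Dom (KK U) l) pt" by blast
            obtain h where h: "h \<in> hom Kp pt pt" "cp g pt s = en pt h" using fob_YE[OF cp_in[OF g(1) fp_pt s]] .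
            have "cp l pt s = \<beta>"
              using g(2) cp_Cmp[OF g(1) k fp_pt s] h(2) cp_yar[OF h(1)] Ide_pt_unique[OF h(1)] rs_id[OF b fp_pt \<beta>] by simp
            moreover have "cp l pt s = cp m pt (cp f pt s)" using f(2) cp_Cmp[OF f(1) m fp_pt s] by simp
            ultimately show False using nin cp_in[OF f(1) fp_pt s] by blast
          qed
          then show "sub_le (KK U) l k'" using no_points_le[OF lS _ k'] by blast
        qed
        then have "sub_le (KK U) ?k n" using neg kS unfolding is_neg_def by blast
        from le_no_points[OF this np] have "fob (Y pt) pt = {}" unfolding hom_D(2)[OF k] .
        then show False using en_in[OF Ide_Kp_hom[OF fp_pt]] by blast
      qed
    qed
  qed
qed

text \<open>Every point of \<open>Q\<close> is a maximal element and so lies in this subobject. A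
  subobject disjoint from it therefore has no points, which makes the bottom subobject its negation,
  and the negation of the bottom is the top.\<close>

lemma nn_dense_max:
  assumes Q: "finite_poset Q" shows "nn_dense (KK U) (Y Q) (ymor (inc Q (max_elems Q)))" (is "nn_dense _ _ ?m")
proof -
  let ?M = "sub Q (max_elems Q)"
  note b = Y_KK[OF Q]
  note i = inc_hom[OF Q upset_max]
  note m = ymor_hom[OF i]
  have mS: "?m \<in> Sub (KK U) (Y Q)" by (rule SubI[OF m ymor_inc_inj[OF Q upset_max]])
  obtain n where nS: "n \<in> Sub (KK U) (Y Q)" and np: "fob (Dom (KK U) n) pt = {}" using ex_bottom[OF b] .
  have "sub_le (KK U) n' n" if n': "n' \<in> Sub (KK U) (Y Q)" and dj: "sub_disjoint (KK U) (Y Q) ?m n'" for n'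
  proof -
    note nh = SubD(1)[OF n']
    have "fob (Dom (KK U) n') pt = {}"
    proof (rule ccontr)
      assume "fob (Dom (KK U) n') pt \<noteq> {}"
      then obtain s where s: "s \<in> fob (Dom (KK U) n') pt" by blast
      obtain g where g: "g \<in> hom Kp pt Q" "cp n' pt s = en Q g" using fob_YE[OF cp_in[OF nh fp_pt s]] .
      have im: "pap g q \<in> max_elems Q" if "q \<in> fst pt" for q using ptm_unique(1)[OF g(1)] that by simp
      let ?g = "kar pt (pap g) ?M"
      note g' = corestrict[OF g(1) upset_max im]
      \<comment> \<open>The point \<open>g\<close> of \<open>n'\<close>, as a subobject, lies below
        both \<open>n'\<close> and the inclusion of the maximal elements. Disjointness would make it
        least, although it has a point.\<close>
      let ?k = "yar (Y Q) pt (en Q g)"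
      note k = yar_hom[OF b fp_pt en_in[OF g(1)]] and kS = point_Sub[OF b en_in[OF g(1)]]
      have "sub_le (KK U) ?k n'"
        using yar_hom[OF hom_KK_obj(1)[OF nh] fp_pt s] yar_Cmp[OF nh fp_pt s] g(2) hom_D(2)[OF k]
        by (intro sub_leI[of "yar (Dom (KK U) n') pt s"]) simp_all
      moreover have "sub_le (KK U) ?k ?m"
        using yar_hom[OF hom_KK_obj(1)[OF m] fp_pt en_in[OF g'(1)]] yar_Cmp[OF m fp_pt en_in[OF g'(1)]]
          cp_ymor[OF i g'(1)] g'(2) hom_D(2)[OF k] hom_D(2)[OF m]
        by (intro sub_leI[of "yar (Y ?M) pt (en ?M ?g)"]) simp_all
      ultimately have "sub_le (KK U) ?k k'" if "k' \<in> Sub (KK U) (Y Q)" for k'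
        using dj kS that unfolding sub_disjoint_def by blast
      then have "fob (Y pt) pt = {}" using least_no_points[OF kS] hom_D(2)[OF k] by simp
      then show False using en_in[OF Ide_Kp_hom[OF fp_pt]] by blast
    qed
    then show ?thesis using no_points_le[OF n' _ nS] by blast
  qed
  then have "is_neg (KK U) (Y Q) ?m n"
    unfolding is_neg_def using nS disjoint_no_points[of ?m n "Y Q"] np by blast
  moreover have "is_neg (KK U) (Y Q) n (Ide (KK U) (Y Q))"
    unfolding is_neg_def using Ide_Sub[OF b] disjoint_no_points[of n "Ide (KK U) (Y Q)" "Y Q"] np sub_le_Ide by blast
  ultimately show ?thesis unfolding nn_dense_def using mS by blast
qed

section \<open>Sheaves determined by their values at maximal elements\<close>

definition maxdet :: "'u psh \<Rightarrow> bool" where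
  "maxdet x \<longleftrightarrow> (\<forall>P. finite_poset P \<longrightarrow>
     bij_betw (\<lambda>a. \<lambda>p\<in>max_elems P. rs x (ptm P p) a) (fob x P) (max_elems P \<rightarrow>\<^sub>E fob x pt))"

lemma maxdet_eqI:
  assumes "maxdet x" "finite_poset P" "a \<in> fob x P" "b \<in> fob x P"
    and eq: "\<And>p. p \<in> max_elems P \<Longrightarrow> rs x (ptm P p) a = rs x (ptm P p) b"
  shows "a = b"
proof -
  have "inj_on (\<lambda>a. \<lambda>p\<in>max_elems P. rs x (ptm P p) a) (fob x P)"
    using assms(1,2) unfolding maxdet_def bij_betw_def by blast
  moreover have "(\<lambda>p\<in>max_elems P. rs x (ptm P p) a) = (\<lambda>p\<in>max_elems P. rs x (ptm P p) b)"
    using eq by (rule restrict_ext)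
  ultimately show ?thesis using assms(3,4) by (rule inj_onD)
qed

lemma maxdet_ex:
  assumes "maxdet x" "finite_poset P" and s: "\<And>p. p \<in> max_elems P \<Longrightarrow> s p \<in> fob x pt"
  shows "\<exists>a\<in>fob x P. \<forall>p\<in>max_elems P. rs x (ptm P p) a = s p"
proof -
  have "restrict s (max_elems P) \<in> max_elems P \<rightarrow>\<^sub>E fob x pt" using s by auto
  then obtain a where a: "a \<in> fob x P" "(\<lambda>p\<in>max_elems P. rs x (ptm P p) a) = restrict s (max_elems P)"
    using assms(1,2) unfolding maxdet_def bij_betw_def by (metis (no_types, lifting) imageE)
  have "rs x (ptm P p) a = s p" if "p \<in> max_elems P" for p using fun_cong[OF a(2), of p] that by simp
  then show ?thesis using a(1) by blast
qed

text \<open>The maximal elements form an antichain, covered by its points. Two points meet only over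
  the empty poset or coincide, so sections over the antichain are arbitrary families of values over
  \<open>pt\<close>.\<close>

lemma maxdetI:
  assumes x: "x \<in> Obj (KK U)"
    and bij: "\<And>P. finite_poset P \<Longrightarrow> bij_betw (rs x (inc P (max_elems P))) (fob x P) (fob x (sub P (max_elems P)))"
  shows "maxdet x"
  unfolding maxdet_def
proof (intro allI impI)
  fix P assume P: "finite_poset P"
  let ?M = "sub P (max_elems P)"
  note i = inc_hom[OF P upset_max]
  note M = hom_Kp_fp(1)[OF i]
  have mM: "max_elems ?M = max_elems P" unfolding max_elems_def by auto
  have pi: "Cmp Kp (inc P (max_elems P)) (ptm ?M p) = ptm P p" if "p \<in> max_elems P" for p
    using Kp_max(2)[OF i, of p] that mM by simp
  have rp: "rs x (ptm ?M p) (rs x (inc P (max_elems P)) a) = rs x (ptm P p) a" if "p \<in> max_elems P" "a \<in> fob x P" for p a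
    using rs_cmp[OF x i ptm_hom[OF M] that(2)] pi that(1) mM by simp
  have Dp: "Dom Kp (ptm R p) = pt" for R p by (simp add: ptm_def)
  let ?G = "ptm ?M ` max_elems P"
  have G: "cov ?M ?G"
    unfolding cov_def using ptm_hom[OF M] mM Dp by auto
  show "bij_betw (\<lambda>a. \<lambda>p\<in>max_elems P. rs x (ptm P p) a) (fob x P) (max_elems P \<rightarrow>\<^sub>E fob x pt)"
  proof (rule bij_betw_imageI)
    show "inj_on (\<lambda>a. \<lambda>p\<in>max_elems P. rs x (ptm P p) a) (fob x P)"
    proof (rule inj_onI)
      fix a b assume a: "a \<in> fob x P" and b: "b \<in> fob x P"
        and eq: "(\<lambda>p\<in>max_elems P. rs x (ptm P p) a) = (\<lambda>p\<in>max_elems P. rs x (ptm P p) b)"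
      have "rs x (inc P (max_elems P)) a = rs x (inc P (max_elems P)) b"
      proof (rule separated[OF x G M rs_in[OF x i a] rs_in[OF x i b]])
        fix g assume "g \<in> ?G"
        then obtain p where p: "p \<in> max_elems P" "g = ptm ?M p" by blast
        show "rs x g (rs x (inc P (max_elems P)) a) = rs x g (rs x (inc P (max_elems P)) b)"
          using fun_cong[OF eq, of p] p rp a b by simp
      qed
      then show "a = b" using inj_onD[OF bij_betw_imp_inj_on[OF bij[OF P]]] a b by blast
    qed
    show "(\<lambda>a. \<lambda>p\<in>max_elems P. rs x (ptm P p) a) ` fob x P = max_elems P \<rightarrow>\<^sub>E fob x pt"
    proof (intro equalityI subsetI)
      fix s assume "s \<in> (\<lambda>a. \<lambda>p\<in>max_elems P. rs x (ptm P p) a) ` fob x P"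
      then show "s \<in> max_elems P \<rightarrow>\<^sub>E fob x pt" using rs_in[OF x ptm_hom[OF P]] by auto
    next
      fix s assume s: "s \<in> max_elems P \<rightarrow>\<^sub>E fob x pt"
      have "\<exists>!t. t \<in> fob x ?M \<and> (\<forall>g\<in>?G. rs x g t = s (pap g 0))"
      proof (rule glue_ex1[OF x M G])
        fix g assume "g \<in> ?G" then show "s (pap g 0) \<in> fob x (Dom Kp g)" using s by (auto simp: Dp)
      next
        fix g g' R u u' assume g: "g \<in> ?G" "g' \<in> ?G" and u: "u \<in> hom Kp R (Dom Kp g)" "u' \<in> hom Kp R (Dom Kp g')"
          and eq: "Cmp Kp g u = Cmp Kp g' u'"
        have gd: "Dom Kp g = pt" "Dom Kp g' = pt" using g by (auto simp: Dp)
        have uu: "u = toPt R" "u' = toPt R" using u(1)[unfolded gd] u(2)[unfolded gd] toPt_unique by blast+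
        have sp: "s (pap g 0) \<in> fob x pt" "s (pap g' 0) \<in> fob x pt" using g s by auto
        note R = hom_Kp_fp(1)[OF u(1)]
        show "rs x u (s (pap g 0)) = rs x u' (s (pap g' 0))"
        \<comment> \<open>Two distinct points have only empty common refinements, over which all
          sections agree; over a nonempty \<open>R\<close> the two points are the same.\<close>
        proof (cases "fst R = {}")
          case True
          have "\<exists>!a. a \<in> fob x R" using fob_empty[OF x R True] .
          then show ?thesis using rs_in[OF x toPt_hom[OF R] sp(1)] rs_in[OF x toPt_hom[OF R] sp(2)] uu by auto
        next
          case False
          then obtain r where r: "r \<in> fst R" by blast
          have 0: "pap (toPt R) r = 0" using r by (simp add: toPt_def)
          have "pap g 0 = pap g' 0"
            using pap_Cmp[OF u(1) covD[OF G g(1)] r] pap_Cmp[OF u(2) covD[OF G g(2)] r] eq uu 0 by simp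
          then show ?thesis using uu by simp
        qed
      qed
      then obtain t where t: "t \<in> fob x ?M \<and> (\<forall>g\<in>?G. rs x g t = s (pap g 0))" by (rule ex1E)
      have "t \<in> rs x (inc P (max_elems P)) ` fob x P"
        using bij_betw_imp_surj_on[OF bij[OF P]] conjunct1[OF t] by simp
      then obtain a where a: "a \<in> fob x P" "rs x (inc P (max_elems P)) a = t" by auto
      have "s = (\<lambda>p\<in>max_elems P. rs x (ptm P p) a)"
      proof (rule extensionalityI[of _ "max_elems P"])
        show "s \<in> extensional (max_elems P)" using s by (simp add: PiE_def)
        fix p assume p: "p \<in> max_elems P"
        have "rs x (ptm ?M p) t = s (pap (ptm ?M p) 0)" using conjunct2[OF t] p by blast
        then show "s p = (\<lambda>p\<in>max_elems P. rs x (ptm P p) a) p" using rp[OF p a(1)] a(2) p by simp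
      qed simp
      then show "s \<in> (\<lambda>a. \<lambda>p\<in>max_elems P. rs x (ptm P p) a) ` fob x P" using a(1) by (rule image_eqI)
    qed
  qed
qed

text \<open>The inclusions of maximal elements into representables are enough as test
  arrows.\<close>

lemma nn_sheaf_maxdet:
  assumes "x \<in> nn_sheaves (KK U)" shows "maxdet x"
proof (rule maxdetI)
  show x: "x \<in> Obj (KK U)" using assms unfolding nn_sheaves_def by blast
  fix P assume P: "finite_poset P"
  note i = inc_hom[OF P upset_max]
  have "\<forall>f\<in>hom (KK U) (Dom (KK U) (ymor (inc P (max_elems P)))) x.
      \<exists>!g. g \<in> hom (KK U) (Y P) x \<and> Cmp (KK U) g (ymor (inc P (max_elems P))) = f"
    using assms Y_KK[OF P] nn_dense_max[OF P] unfolding nn_sheaves_def by blast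
  then have "orthogonal (KK U) (ymor (inc P (max_elems P))) x"
    unfolding orthogonal_def hom_D(3)[OF ymor_hom[OF i]] .
  then show "bij_betw (rs x (inc P (max_elems P))) (fob x P) (fob x (sub P (max_elems P)))"
    using orthogonal_ymor[OF x i] by blast
qed

text \<open>Under this condition the unit \<open>nu x\<close> is bijective on sections over each
  poset, hence an isomorphism onto a sheaf in the image of \<nabla>.\<close>

lemma maxdet_ess_image:
  assumes x: "x \<in> Obj (KK U)" and md: "maxdet x"
  shows "x \<in> ess_image (Sets U) (KK U) (nabla U)"
proof -
  note G = Gamma_in_U[OF x] and gb = gm_bij[OF x]
  have "bij_betw (cp (nu x) P) (fob x P) (fob (nabla_ob U (fob (Gamma U) x)) P)" if P: "finite_poset P" for P
  proof (rule bij_betw_imageI)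
    show "inj_on (cp (nu x) P) (fob x P)"
    proof (rule inj_onI)
      fix a b assume a: "a \<in> fob x P" and b: "b \<in> fob x P" and eq: "cp (nu x) P a = cp (nu x) P b"
      have e: "(\<lambda>p\<in>max_elems P. gm x (rs x (ptm P p) a)) = (\<lambda>p\<in>max_elems P. gm x (rs x (ptm P p) b))"
        using eq cp_nu[OF P a] cp_nu[OF P b] nv_eq_iff[OF G P nu_fun[OF x P a] nu_fun[OF x P b]] by simp
      show "a = b"
      proof (rule maxdet_eqI[OF md P a b])
        fix p assume p: "p \<in> max_elems P"
        have "gm x (rs x (ptm P p) a) = gm x (rs x (ptm P p) b)" using fun_cong[OF e, of p] p by simp
        then show "rs x (ptm P p) a = rs x (ptm P p) b"
          using inj_onD[OF bij_betw_imp_inj_on[OF gb]] rs_in[OF x ptm_hom[OF P p]] a b by blast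
      qed
    qed
    show "cp (nu x) P ` fob x P = fob (nabla_ob U (fob (Gamma U) x)) P"
    proof (intro equalityI subsetI)
      fix t assume "t \<in> cp (nu x) P ` fob x P"
      then show "t \<in> fob (nabla_ob U (fob (Gamma U) x)) P" using cp_in[OF nu_hom[OF x] P] by blast
    next
      fix t assume "t \<in> fob (nabla_ob U (fob (Gamma U) x)) P"
      then obtain s where s: "s \<in> max_elems P \<rightarrow>\<^sub>E fob (Gamma U) x" "t = nv (fob (Gamma U) x) P s" by (rule nvE)
      have "inv_into (fob x pt) (gm x) (s p) \<in> fob x pt" "gm x (inv_into (fob x pt) (gm x) (s p)) = s p" if "p \<in> max_elems P" for p
        using bij_betw_imp_surj_on[OF gb] s(1) that inv_into_into[of "s p" "gm x" "fob x pt"]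
          f_inv_into_f[of "s p" "gm x" "fob x pt"] by (auto simp: PiE_iff)
      note r = this
      have "\<exists>a\<in>fob x P. \<forall>p\<in>max_elems P. rs x (ptm P p) a = inv_into (fob x pt) (gm x) (s p)"
        by (rule maxdet_ex[OF md P]) (rule r(1))
      then obtain a where a: "a \<in> fob x P" "\<And>p. p \<in> max_elems P \<Longrightarrow> rs x (ptm P p) a = inv_into (fob x pt) (gm x) (s p)"
        by blast
      have "(\<lambda>p\<in>max_elems P. gm x (rs x (ptm P p) a)) = s"
        by (rule PiE_ext[OF nu_fun[OF x P a(1)] s(1)]) (simp add: a r)
      then have "t = cp (nu x) P a" using cp_nu[OF P a(1)] s(2) by simp
      then show "t \<in> cp (nu x) P ` fob x P" using a(1) by (rule image_eqI)
    qed
  qed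
  then have iso: "is_iso (KK U) (nu x)" by (rule is_iso_KKI[OF nu_hom[OF x]])
  obtain g where "g \<in> hom (KK U) (nabla_ob U (fob (Gamma U) x)) x" "is_iso (KK U) g" using is_isoE[OF iso nu_hom[OF x]] by metis
  then show ?thesis using x G unfolding ess_image_def isomorphic_def by auto
qed

text \<open>A dense subobject has the same points as the whole, so \<Gamma> inverts its inclusion;
  by the adjunction every \<nabla>\<open>S\<close> is orthogonal to it.\<close>

lemma nabla_nn_sheaf:
  assumes "x \<in> ess_image (Sets U) (KK U) (nabla U)" shows "x \<in> nn_sheaves (KK U)"
  unfolding nn_sheaves_def
proof (intro CollectI conjI ballI allI impI)
  show x: "x \<in> Obj (KK U)" using assms unfolding ess_image_def by blast
  obtain S where S: "S \<in> U" "isomorphic (KK U) (nabla_ob U S) x" using assms unfolding ess_image_def by auto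
  fix b m f assume nn: "nn_dense (KK U) b m" and f: "f \<in> hom (KK U) (Dom (KK U) m) x"
  have m: "m \<in> hom (KK U) (Dom (KK U) m) b" using nn SubD(1) unfolding nn_dense_def by blast
  note a = hom_KK_obj(1)[OF m] and b = hom_KK_obj(2)[OF m]
  note Gm = fun_ar[OF is_functor_Gamma m]
  have "bij_betw (app (far (Gamma U) m)) (fob (Gamma U) (Dom (KK U) m)) (fob (Gamma U) b)"
  proof -
    have 1: "bij_betw (gm b \<circ> cp m pt) (fob (Dom (KK U) m) pt) (fob (Gamma U) b)"
      using bij_betw_trans[OF nn_dense_bij[OF nn] gm_bij[OF b]] .
    have 2: "bij_betw (app (far (Gamma U) m) \<circ> gm (Dom (KK U) m)) (fob (Dom (KK U) m) pt) (fob (Gamma U) b)"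
      using 1 gm_nat[OF m] by (subst bij_betw_cong[of _ _ "gm b \<circ> cp m pt"]) simp_all
    show ?thesis using bij_betw_comp_iff[OF gm_bij[OF a]] 2 by blast
  qed
  then have "is_iso (Sets U) (far (Gamma U) m)" by (rule is_iso_SetsI[OF Gm])
  then have "orthogonal (KK U) m (nabla_ob U S)" using orthogonal_of_iso[OF universal_unit_nabla m _, of S] S(1) by simp
  from orthogonal_isomorphic[OF category_KK m this S(2)]
  show "\<exists>!g. g \<in> hom (KK U) b x \<and> Cmp (KK U) g m = f" using f unfolding orthogonal_iff[OF m] by blast
qed

lemma nn_sheaves_Obj: "x \<in> nn_sheaves (KK U) \<Longrightarrow> x \<in> Obj (KK U)"
  by (simp add: nn_sheaves_def)

lemma nn_sheaves_ess_image: "nn_sheaves (KK U) = ess_image (Sets U) (KK U) (nabla U)"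
  using nn_sheaf_maxdet maxdet_ess_image nabla_nn_sheaf nn_sheaves_Obj by (intro equalityI subsetI) metis+

text \<open>The cycle from double negation sheaves through \<open>maxdet\<close> and the essential
  image of \<nabla> back to double negation sheaves makes all three classes equal.\<close>

lemma nn_sheaves_iff: "x \<in> nn_sheaves (KK U) \<longleftrightarrow> x \<in> Obj (KK U) \<and> maxdet x"
  using nn_sheaf_maxdet maxdet_ess_image nabla_nn_sheaf nn_sheaves_Obj by metis

end

section \<open>Classification of the subtoposes\<close>

definition two :: poset where "two = ({0, 1}, {(0, 0), (0, 1), (1, 1)})"

lemma two_simps [simp]: "fst two = {0, 1}" "snd two = {(0, 0), (0, 1), (1, 1)}" by (simp_all add: two_def)

lemma fp_two: "finite_poset two" unfolding two_def by (rule finite_posetI) auto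

lemma upset_two: "upset {1} two" unfolding upset_def by auto

lemma max_elems_two: "max_elems two = {1}" unfolding max_elems_def by auto

context KK_reflection
begin

lemma dense_upset: "dense V P \<Longrightarrow> upset V P" unfolding dense_def by blast

lemma dense_bij: "dense V P \<Longrightarrow> d \<in> D \<Longrightarrow> bij_betw (rs d (inc P V)) (fob d P) (fob d (sub P V))"
  unfolding dense_def by blast

lemma dense_eqI:
  assumes "dense V P" "d \<in> D" "a \<in> fob d P" "b \<in> fob d P" "rs d (inc P V) a = rs d (inc P V) b"
  shows "a = b"
  using inj_onD[OF bij_betw_imp_inj_on[OF dense_bij[OF assms(1,2)]] assms(5,3,4)] .

lemma dense_ex:
  assumes "dense V P" "d \<in> D" "b \<in> fob d (sub P V)"
  obtains a where "a \<in> fob d P" "rs d (inc P V) a = b"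
proof -
  have "b \<in> rs d (inc P V) ` fob d P" using bij_betw_imp_surj_on[OF dense_bij[OF assms(1,2)]] assms(3) by simp
  then show ?thesis using that by auto
qed

text \<open>Pulling back along the map to \<open>pt\<close> makes the empty upset dense in every
  poset. An object of \<open>D\<close> then has as many sections over any poset as over the empty
  one, namely one.\<close>

lemma degenerate_of_dense_empty:
  assumes dn: "dense {} pt" shows "degenerate (full_sub (KK U) D)"
  unfolding degenerate_def
proof (intro conjI ballI)
  show "Obj (full_sub (KK U) D) \<noteq> {}" using L_ob[OF one_KK] D_KK by auto
  have sing: "\<exists>!t. t \<in> fob d Q" if d: "d \<in> D" and Q: "finite_poset Q" for d Q
  proof -
    have "vimg (toPt Q) {} = {}" by (simp add: vimg_def)
    then have dQ: "dense {} Q" using dense_vimg[OF dn toPt_hom[OF Q]] by simp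
    have "\<exists>!t. t \<in> fob d (sub Q {})"
      using fob_empty[OF D_KK[OF d] fp_sub_upset[OF Q dense_upset[OF dQ]]] by simp
    then obtain b where b: "b \<in> fob d (sub Q {})" and bu: "\<forall>b'. b' \<in> fob d (sub Q {}) \<longrightarrow> b' = b" by (rule ex1E)
    obtain a where a: "a \<in> fob d Q" "rs d (inc Q {}) a = b" using dense_ex[OF dQ d b] .
    note i = inc_hom[OF Q dense_upset[OF dQ]]
    show ?thesis
    proof (rule ex1I[of _ a], rule a(1))
      fix a' assume a': "a' \<in> fob d Q"
      have "rs d (inc Q {}) a' = rs d (inc Q {}) a"
        using bu[rule_format, OF rs_in[OF D_KK[OF d] i a']] a(2) by simp
      then show "a' = a" using dense_eqI[OF dQ d a' a(1)] by simp
    qed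
  qed
  fix d assume "d \<in> Obj (full_sub (KK U) D)"
  then have d: "d \<in> D" by simp
  show "terminal (full_sub (KK U) D) d"
    unfolding terminal_def
  proof (intro conjI ballI)
    show "d \<in> Obj (full_sub (KK U) D)" using d D_KK by simp
    fix x assume "x \<in> Obj (full_sub (KK U) D)"
    then have x: "x \<in> D" by simp
    let ?m = "mkm x d (\<lambda>P _. THE t. t \<in> fob d P)"
    have the: "(THE t. t \<in> fob d P) \<in> fob d P" if "finite_poset P" for P using theI'[OF sing[OF d that]] .
    have m: "?m \<in> hom (KK U) x d"
    proof (rule mkm_hom[OF D_KK[OF x] D_KK[OF d] the])
      fix P Q f assume f: "f \<in> hom Kp Q P"
      show "(THE t. t \<in> fob d Q) = rs d f (THE t. t \<in> fob d P)"
        by (rule the1_equality[OF sing[OF d hom_Kp_fp(1)[OF f]]]) (rule rs_in[OF D_KK[OF d] f the[OF hom_Kp_fp(2)[OF f]]])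
    qed
    show "\<exists>!f. f \<in> hom (full_sub (KK U) D) x d"
    proof (rule ex1I[of _ ?m])
      show "?m \<in> hom (full_sub (KK U) D) x d" using m x d by (simp add: hom_full_sub)
      fix f assume "f \<in> hom (full_sub (KK U) D) x d"
      then have f: "f \<in> hom (KK U) x d" by (rule hom_full_subD)
      show "f = ?m"
      proof (rule KK_eqI[OF f m])
        fix P a assume P: "finite_poset P" and a: "a \<in> fob x P"
        show "cp f P a = cp ?m P a"
          using the1_equality[OF sing[OF d P] cp_in[OF f P a]] cp_mkm[OF P a] by simp
      qed
    qed
  qed
qed

text \<open>Restricting to the principal upset of a maximal element outside the dense upset and
  collapsing everything above this element to a point gives a dense point of \<open>two\<close>.\<close>

lemma dense_two:
  assumes dn: "dense V P" and P: "finite_poset P" and ne: "V \<noteq> fst P" and nd: "\<not> dense {} pt"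
  shows "dense {1} two"
proof -
  note V = dense_upset[OF dn]
  obtain p0 where p0: "p0 \<in> fst P - V" using ne upsetD(1)[OF V] by blast
  have "fst P - V \<subseteq> fst P" by blast
  from ex_maximal_in[OF P this p0]
  obtain p where p: "p \<in> fst P - V" and pm: "\<forall>r\<in>fst P - V. (p, r) \<in> snd P \<longrightarrow> r = p" by metis
  have pP: "p \<in> fst P" and pV: "p \<notin> V" using p by auto
  \<comment> \<open>If \<open>p\<close> were maximal, pulling \<open>V\<close> back along the point
    \<open>p\<close> would make the empty upset of \<open>pt\<close> dense.\<close>
  have "p \<notin> max_elems P"
  proof
    assume pmax: "p \<in> max_elems P"
    have "vimg (ptm P p) V = {}" using pV vimg_iff[OF ptm_hom[OF P pmax]] by auto
    then show False using dense_vimg[OF dn ptm_hom[OF P pmax]] nd by simp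
  qed
  then obtain q0 where q0: "(p, q0) \<in> snd P" "q0 \<noteq> p" using pP unfolding max_elems_def by blast
  let ?R = "sub P (up P p)"
  note j = inc_hom[OF P upset_up[OF P, of p]]
  note R = hom_Kp_fp(1)[OF j]
  have upP: "q \<in> fst P" if "q \<in> up P p" for q using that fp_carrier(2)[OF P] by (auto simp: up_def)
  \<comment> \<open>By maximality of \<open>p\<close> in the complement of \<open>V\<close>,
    everything strictly above \<open>p\<close> lies in \<open>V\<close>; hence \<open>?W\<close> is
    the preimage of \<open>V\<close>.\<close>
  let ?W = "{q \<in> up P p. q \<noteq> p}"
  have "vimg (inc P (up P p)) V = ?W"
  proof (intro equalityI subsetI)
    fix q assume "q \<in> vimg (inc P (up P p)) V"
    then show "q \<in> ?W" using pV by (auto simp: vimg_iff[OF j])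
  next
    fix q assume q: "q \<in> ?W"
    then have "q \<in> V" using pm upP[of q] by (auto simp: up_def)
    then show "q \<in> vimg (inc P (up P p)) V" using q by (simp add: vimg_iff[OF j])
  qed
  then have dW: "dense ?W ?R" using dense_vimg[OF dn j] by simp
  \<comment> \<open>The collapse. At \<open>p\<close> openness requires an element above
    \<open>p\<close> with value 1, and \<open>q0\<close> is one because \<open>p\<close> is not
    maximal; the same element makes the collapse surjective.\<close>
  let ?f = "kar ?R (\<lambda>q. if q = p then 0 else 1) two"
  have q0u: "q0 \<in> up P p" using q0 by (simp add: up_def)
  have pu: "p \<in> up P p" using in_up[OF P pP] .
  have f: "?f \<in> hom Kp ?R two"
  proof (rule kar_hom[OF R fp_two])
    fix q q' assume "(q, q') \<in> snd ?R" "q \<in> fst ?R" "q' \<in> fst ?R"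
    then have "(p, q) \<in> snd P" "(q, q') \<in> snd P" by (auto simp: up_def)
    then show "(if q = p then 0 else 1, if q' = p then 0 else 1) \<in> snd two"
      using fp_antisym[OF P, of p q] by auto
  next
    fix q r assume q: "q \<in> fst ?R" and r: "(if q = p then 0 else 1, r) \<in> snd two"
    have qq: "(q, q) \<in> snd ?R" using fp_refl[OF R q] .
    have pq0: "(p, q0) \<in> snd ?R" using q0(1) q0u pu by simp
    consider "r = (if q = p then 0 else 1)" | "q = p" "r = 1" using r by (auto split: if_splits)
    then show "\<exists>q'. (q, q') \<in> snd ?R \<and> (if q' = p then 0 else 1) = r"
    proof cases
      case 1 then show ?thesis using qq by (intro exI[of _ q]) simp
    next
      case 2 then show ?thesis using pq0 q0(2) by (intro exI[of _ q0]) simp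
    qed
  qed auto
  have fv: "pap ?f q = (if q = p then 0 else 1)" if "q \<in> up P p" for q using that by simp
  have Wf: "vimg ?f {1} = ?W" using fv by (auto simp: vimg_iff[OF f])
  have covf: "cov two {?f}"
  proof (rule cov_single[OF f])
    fix r assume "r \<in> fst two"
    then have "r = 0 \<or> r = 1" by simp
    then show "\<exists>q\<in>fst ?R. pap ?f q = r" using fv[OF pu] fv[OF q0u] q0(2) pu q0u by auto
  qed
  obtain fm where fm: "fm \<in> hom Kp (sub ?R ?W) (sub two {1})" "Cmp Kp (inc two {1}) fm = Cmp Kp ?f (inc ?R ?W)"
    using vimg_square[OF f upset_two, unfolded Wf] .
  have covfm: "cov (sub two {1}) {fm}"
  proof (rule cov_single[OF fm(1)])
    fix r assume "r \<in> fst (sub two {1})"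
    moreover have "q0 \<in> fst (sub ?R ?W)" using q0u q0(2) by simp
    moreover from this have "pap fm q0 \<in> fst (sub two {1})" by (rule Kp_in[OF fm(1)])
    ultimately show "\<exists>q\<in>fst (sub ?R ?W). pap fm q = r" by (intro bexI[of _ q0]) simp_all
  qed
  note i1 = inc_hom[OF fp_two upset_two]
  note iW = inc_hom[OF R dense_upset[OF dW]]
  have "bij_betw (rs d (inc two {1})) (fob d two) (fob d (sub two {1}))" if d: "d \<in> D" for d
  proof (rule bij_betw_imageI)
    note dK = D_KK[OF d]
    have sq: "rs d (inc ?R ?W) (rs d ?f a) = rs d fm (rs d (inc two {1}) a)" if a: "a \<in> fob d two" for a
      using rs_cmp[OF dK f iW a] rs_cmp[OF dK i1 fm(1) a] fm(2) by simp
    show "inj_on (rs d (inc two {1})) (fob d two)"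
    proof (rule inj_onI)
      fix a b assume a: "a \<in> fob d two" and b: "b \<in> fob d two" and eq: "rs d (inc two {1}) a = rs d (inc two {1}) b"
      have "rs d ?f a = rs d ?f b"
        using dense_eqI[OF dW d rs_in[OF dK f a] rs_in[OF dK f b]] sq[OF a] sq[OF b] eq by simp
      then show "a = b" by (intro separated[OF dK covf fp_two a b]) blast
    qed
    show "rs d (inc two {1}) ` fob d two = fob d (sub two {1})"
    proof (intro equalityI subsetI)
      fix s assume "s \<in> rs d (inc two {1}) ` fob d two"
      then show "s \<in> fob d (sub two {1})" using rs_in[OF dK i1] by blast
    next
      fix s assume s: "s \<in> fob d (sub two {1})"
      \<comment> \<open>The section \<open>s\<close> is pulled back to \<open>?W\<close> and
        extended to \<open>?R\<close> by density; it remains to descend the extension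
        \<open>t\<close> along the collapse.\<close>
      obtain t where t: "t \<in> fob d ?R" "rs d (inc ?R ?W) t = rs d fm s" using dense_ex[OF dW d rs_in[OF dK fm(1) s]] .
      \<comment> \<open>Since \<open>?W\<close> is the preimage of 1, the maps \<open>g\<close> and
        \<open>g'\<close> have the same preimage of \<open>?W\<close>, and this preimage is dense in
        \<open>Q\<close>. It suffices to compare the two restrictions of \<open>t\<close> there,
        where \<open>t\<close> comes from \<open>s\<close>.\<close>
      have compat: "rs d g t = rs d g' t" if g: "g \<in> hom Kp Q ?R" and g': "g' \<in> hom Kp Q ?R"
        and eq: "Cmp Kp ?f g = Cmp Kp ?f g'" for g g' Q
      proof -
        note Q = hom_Kp_fp(1)[OF g]
        have Wmem: "q \<in> ?W \<longleftrightarrow> pap ?f q = 1" if "q \<in> fst ?R" for q using that fv by simp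
        have Wgg: "pap g q \<in> ?W \<longleftrightarrow> pap g' q \<in> ?W" if q: "q \<in> fst Q" for q
          using Wmem[OF Kp_in[OF g q]] Wmem[OF Kp_in[OF g' q]] pap_Cmp[OF g f q] pap_Cmp[OF g' f q] eq by metis
        have W': "vimg g' ?W = vimg g ?W"
        proof (rule set_eqI)
          fix q show "q \<in> vimg g' ?W \<longleftrightarrow> q \<in> vimg g ?W"
            unfolding vimg_iff[OF g] vimg_iff[OF g'] by (rule conj_cong[OF refl Wgg[symmetric]])
        qed
        note dW' = dense_vimg[OF dW g]
        note iW' = inc_hom[OF Q dense_upset[OF dW']]
        obtain h where h: "h \<in> hom Kp (sub Q (vimg g ?W)) (sub ?R ?W)" "Cmp Kp (inc ?R ?W) h = Cmp Kp g (inc Q (vimg g ?W))"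
          using vimg_square[OF g dense_upset[OF dW]] .
        obtain h' where h': "h' \<in> hom Kp (sub Q (vimg g ?W)) (sub ?R ?W)" "Cmp Kp (inc ?R ?W) h' = Cmp Kp g' (inc Q (vimg g ?W))"
          using vimg_square[OF g' dense_upset[OF dW], unfolded W'] .
        \<comment> \<open>The target has the single element 1, so any two maps into it
          agree.\<close>
        have hh: "Cmp Kp fm h = Cmp Kp fm h'"
        proof (rule hom_Kp_eqI[OF cat_cmp[OF category_Kp h(1) fm(1)] cat_cmp[OF category_Kp h'(1) fm(1)]])
          fix q assume q: "q \<in> fst (sub Q (vimg g ?W))"
          show "pap (Cmp Kp fm h) q = pap (Cmp Kp fm h') q"
            using Kp_in[OF cat_cmp[OF category_Kp h(1) fm(1)] q] Kp_in[OF cat_cmp[OF category_Kp h'(1) fm(1)] q] by simp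
        qed
        have 1: "rs d (inc Q (vimg g ?W)) (rs d g t) = rs d (Cmp Kp fm h) s"
          using rs_cmp[OF dK g iW' t(1)] h(2) rs_cmp[OF dK iW h(1) t(1)] t(2) rs_cmp[OF dK fm(1) h(1) s] by simp
        have 2: "rs d (inc Q (vimg g ?W)) (rs d g' t) = rs d (Cmp Kp fm h') s"
          using rs_cmp[OF dK g' iW' t(1)] h'(2) rs_cmp[OF dK iW h'(1) t(1)] t(2) rs_cmp[OF dK fm(1) h'(1) s] by simp
        show ?thesis using dense_eqI[OF dW' d rs_in[OF dK g t(1)] rs_in[OF dK g' t(1)]] 1 2 hh by simp
      qed
      have "\<exists>!a. a \<in> fob d two \<and> (\<forall>g\<in>{?f}. rs d g a = t)"
      proof (rule glue_ex1[OF dK fp_two covf])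
        fix g assume "g \<in> {?f}" then show "t \<in> fob d (Dom Kp g)" using t(1) by simp
      next
        fix g g' Q u u' assume "g \<in> {?f}" "g' \<in> {?f}" "u \<in> hom Kp Q (Dom Kp g)" "u' \<in> hom Kp Q (Dom Kp g')" "Cmp Kp g u = Cmp Kp g' u'"
        then show "rs d u t = rs d u' t" using compat[of u Q u'] by simp
      qed
      then obtain a where a0: "a \<in> fob d two \<and> (\<forall>g\<in>{?f}. rs d g a = t)" by (rule ex1E)
      then have a: "a \<in> fob d two" "rs d ?f a = t" by simp_all
      \<comment> \<open>Both sections agree after restriction along the surjection
        \<open>fm\<close>, which covers the one element poset.\<close>
      have "s = rs d (inc two {1}) a"
        by (rule separated[OF dK covfm hom_Kp_fp(1)[OF i1] s rs_in[OF dK i1 a(1)]]) (use sq[OF a(1)] a(2) t(2) in simp)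
      then show "s \<in> rs d (inc two {1}) ` fob d two" using a(1) by (rule image_eqI)
    qed
  qed
  then show ?thesis unfolding dense_def using upset_two by blast
qed

text \<open>The maximal elements of any poset are the preimage of the dense point under the
  characteristic map to \<open>two\<close>.\<close>

lemma maxdet_of_dense_two:
  assumes dn: "dense {1} two" and d: "d \<in> D"
  shows "maxdet d"
proof (rule maxdetI[OF D_KK[OF d]])
  fix Q assume Q: "finite_poset Q"
  \<comment> \<open>Openness holds because every element of a finite poset lies below a maximal one,
    so the value 1 can always be reached from below.\<close>
  let ?c = "kar Q (\<lambda>q. if q \<in> max_elems Q then 1 else 0) two"
  have c: "?c \<in> hom Kp Q two"
  proof (rule kar_hom[OF Q fp_two])
    fix q q' assume "(q, q') \<in> snd Q"
    then show "(if q \<in> max_elems Q then 1 else 0, if q' \<in> max_elems Q then 1 else 0) \<in> snd two"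
      using max_elemsD(2)[of q Q q'] by auto
  next
    fix q r assume q: "q \<in> fst Q" and r: "(if q \<in> max_elems Q then 1 else 0, r) \<in> snd two"
    obtain q' where q': "q' \<in> max_elems Q" "(q, q') \<in> snd Q" using ex_max_above[OF Q q] .
    consider "r = (if q \<in> max_elems Q then 1 else 0)" | "r = 1" using r by (auto split: if_splits)
    then show "\<exists>q'. (q, q') \<in> snd Q \<and> (if q' \<in> max_elems Q then 1 else 0) = r"
    proof cases
      case 1 then show ?thesis using fp_refl[OF Q q] by (intro exI[of _ q]) simp
    next
      case 2 then show ?thesis using q' by (intro exI[of _ q']) simp
    qed
  qed auto
  have "vimg ?c {1} = max_elems Q" using max_elemsD(1)[of _ Q] by (auto simp: vimg_iff[OF c] split: if_splits)
  then have "dense (max_elems Q) Q" using dense_vimg[OF dn c] by simp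
  then show "bij_betw (rs d (inc Q (max_elems Q))) (fob d Q) (fob d (sub Q (max_elems Q)))" using dense_bij d by blast
qed

text \<open>The locus where two identified sections agree is dense, hence all of \<open>P\<close>,
  and principal upsets cover \<open>P\<close>. Only density in this one poset matters, so that the
  lemma also applies to \<open>pt\<close> alone.\<close>

lemma unit_inj_at:
  assumes x: "x \<in> Obj (KK U)" and P: "finite_poset P" and full: "\<And>V. dense V P \<Longrightarrow> V = fst P"
  shows "inj_on (cp (\<eta> x) P) (fob x P)"
proof (rule inj_onI)
  fix a b assume a: "a \<in> fob x P" and b: "b \<in> fob x P" and eq: "cp (\<eta> x) P a = cp (\<eta> x) P b"
  have V: "{p \<in> fst P. rs x (inc P (up P p)) a = rs x (inc P (up P p)) b} = fst P"
    using full[OF dense_equal[OF x P a b eq]] .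
  show "a = b"
  proof (rule separated[OF x cov_up[OF P] P a b])
    fix g assume "g \<in> (\<lambda>p. inc P (up P p)) ` fst P"
    then show "rs x g a = rs x g b" using V by blast
  qed
qed

text \<open>The locus where a section lies in the image of the unit is dense, hence all of
  \<open>P\<close>, and local membership in the image of an injective arrow is global
  membership.\<close>

lemma unit_surj_at:
  assumes x: "x \<in> Obj (KK U)" and inj: "\<And>Q. finite_poset Q \<Longrightarrow> inj_on (cp (\<eta> x) Q) (fob x Q)"
    and P: "finite_poset P" and full: "\<And>V. dense V P \<Longrightarrow> V = fst P"
  shows "cp (\<eta> x) P ` fob x P = fob (fob L x) P"
proof (intro equalityI subsetI)
  fix c assume "c \<in> cp (\<eta> x) P ` fob x P" then show "c \<in> fob (fob L x) P" using cp_in[OF \<eta>_hom[OF x] P] by blast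
next
  fix c assume c: "c \<in> fob (fob L x) P"
  have V: "{p \<in> fst P. rs (fob L x) (inc P (up P p)) c \<in> cp (\<eta> x) (sub P (up P p)) ` fob x (sub P (up P p))} = fst P"
    using full[OF dense_image[OF x P inj c]] .
  show "c \<in> cp (\<eta> x) P ` fob x P"
  proof (rule local_image[OF \<eta>_hom[OF x] inj cov_up[OF P] P c])
    fix g assume "g \<in> (\<lambda>p. inc P (up P p)) ` fst P"
    then obtain p where p: "p \<in> fst P" "g = inc P (up P p)" by blast
    have "Dom Kp g = sub P (up P p)" using p(2) by (simp add: inc_def)
    moreover have "rs (fob L x) (inc P (up P p)) c \<in> cp (\<eta> x) (sub P (up P p)) ` fob x (sub P (up P p))"
      using V p(1) by blast
    ultimately show "rs (fob L x) g c \<in> cp (\<eta> x) (Dom Kp g) ` fob x (Dom Kp g)" using p(2) by simp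
  qed
qed

lemma mem_of_no_dense:
  assumes full: "\<And>P V. finite_poset P \<Longrightarrow> dense V P \<Longrightarrow> V = fst P" and x: "x \<in> Obj (KK U)"
  shows "x \<in> D"
proof (rule unit_iso_imp_mem[OF x is_iso_KKI[OF \<eta>_hom[OF x]]])
  fix P assume P: "finite_poset P"
  have inj: "inj_on (cp (\<eta> x) Q) (fob x Q)" if "finite_poset Q" for Q using unit_inj_at[OF x that full[OF that]] .
  show "bij_betw (cp (\<eta> x) P) (fob x P) (fob (fob L x) P)"
    using inj[OF P] unit_surj_at[OF x inj P full[OF P]] by (rule bij_betw_imageI)
qed

text \<open>Over \<open>pt\<close> no proper upset is dense, so the unit is bijective there. As
  \<open>x\<close> and its reflection are both determined by their values at maximal points,
  bijectivity over \<open>pt\<close> spreads to all posets.\<close>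

lemma mem_of_maxdet:
  assumes dn: "dense {1} two" and nd: "\<not> dense {} pt" and x: "x \<in> Obj (KK U)" and md: "maxdet x"
  shows "x \<in> D"
proof (rule unit_iso_imp_mem[OF x is_iso_KKI[OF \<eta>_hom[OF x]]])
  note e = \<eta>_hom[OF x]
  note Lx = D_KK[OF L_ob[OF x]]
  have mdL: "maxdet (fob L x)" using maxdet_of_dense_two[OF dn L_ob[OF x]] .
  \<comment> \<open>The only upsets of \<open>pt\<close> are the empty one, which is excluded, and
    the whole.\<close>
  have full: "V = fst pt" if V: "dense V pt" for V
  proof -
    have "V \<subseteq> {0}" using upsetD(1)[OF dense_upset[OF V]] by simp
    moreover have "V \<noteq> {}" using V nd by blast
    ultimately show ?thesis by auto
  qed
  have inj: "inj_on (cp (\<eta> x) Q) (fob x Q)" if Q: "finite_poset Q" for Q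
  proof (rule inj_onI)
    fix a b assume a: "a \<in> fob x Q" and b: "b \<in> fob x Q" and eq: "cp (\<eta> x) Q a = cp (\<eta> x) Q b"
    show "a = b"
    proof (rule maxdet_eqI[OF md Q a b])
      fix p assume p: "p \<in> max_elems Q"
      note i = ptm_hom[OF Q p]
      have "cp (\<eta> x) pt (rs x (ptm Q p) a) = cp (\<eta> x) pt (rs x (ptm Q p) b)"
        using cp_nat[OF e i a] cp_nat[OF e i b] eq by simp
      then show "rs x (ptm Q p) a = rs x (ptm Q p) b"
        using inj_onD[OF unit_inj_at[OF x fp_pt full]] rs_in[OF x i a] rs_in[OF x i b] by blast
    qed
  qed
  fix P assume P: "finite_poset P"
  have surj_pt: "cp (\<eta> x) pt ` fob x pt = fob (fob L x) pt" using unit_surj_at[OF x inj fp_pt full] .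
  have "cp (\<eta> x) P ` fob x P = fob (fob L x) P"
  proof (intro equalityI subsetI)
    fix c assume "c \<in> cp (\<eta> x) P ` fob x P" then show "c \<in> fob (fob L x) P" using cp_in[OF e P] by blast
  next
    fix c assume c: "c \<in> fob (fob L x) P"
    have "\<forall>p\<in>max_elems P. \<exists>s. s \<in> fob x pt \<and> cp (\<eta> x) pt s = rs (fob L x) (ptm P p) c"
    proof
      fix p assume "p \<in> max_elems P"
      then have "rs (fob L x) (ptm P p) c \<in> cp (\<eta> x) pt ` fob x pt" using rs_in[OF Lx ptm_hom[OF P] c] surj_pt by simp
      then show "\<exists>s. s \<in> fob x pt \<and> cp (\<eta> x) pt s = rs (fob L x) (ptm P p) c" by auto
    qed
    \<comment> \<open>Preimages are chosen at the maximal points and assembled into a section of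
      \<open>x\<close>, which is possible because \<open>x\<close> is determined by arbitrary values
      there.\<close>
    then obtain s where s: "\<And>p. p \<in> max_elems P \<Longrightarrow> s p \<in> fob x pt"
      "\<And>p. p \<in> max_elems P \<Longrightarrow> cp (\<eta> x) pt (s p) = rs (fob L x) (ptm P p) c" by metis
    have "\<exists>a\<in>fob x P. \<forall>p\<in>max_elems P. rs x (ptm P p) a = s p" by (rule maxdet_ex[OF md P]) (rule s(1))
    then obtain a where a: "a \<in> fob x P" "\<And>p. p \<in> max_elems P \<Longrightarrow> rs x (ptm P p) a = s p" by blast
    have "c = cp (\<eta> x) P a"
    proof (rule maxdet_eqI[OF mdL P c cp_in[OF e P a(1)]])
      fix p assume p: "p \<in> max_elems P"
      show "rs (fob L x) (ptm P p) c = rs (fob L x) (ptm P p) (cp (\<eta> x) P a)"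
        using cp_nat[OF e ptm_hom[OF P p] a(1)] a(2)[OF p] s(2)[OF p] by simp
    qed
    then show "c \<in> cp (\<eta> x) P ` fob x P" using a(1) by (rule image_eqI)
  qed
  then show "bij_betw (cp (\<eta> x) P) (fob x P) (fob (fob L x) P)" using inj[OF P] by (intro bij_betw_imageI)
qed

lemma classification:
  assumes ne: "D \<noteq> Obj (KK U)" and nd: "\<not> degenerate (full_sub (KK U) D)"
  shows "D = nn_sheaves (KK U)"
proof -
  have nd': "\<not> dense {} pt" using degenerate_of_dense_empty nd by blast
  have "\<exists>P V. finite_poset P \<and> dense V P \<and> V \<noteq> fst P"
  proof (rule ccontr)
    assume "\<not> (\<exists>P V. finite_poset P \<and> dense V P \<and> V \<noteq> fst P)"
    then have "Obj (KK U) \<subseteq> D" using mem_of_no_dense by (intro subsetI) metis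
    then show False using D_Obj ne by blast
  qed
  then have dn: "dense {1} two" using dense_two nd' by blast
  show ?thesis
  proof (intro equalityI subsetI)
    fix x assume "x \<in> D"
    then show "x \<in> nn_sheaves (KK U)" using nn_sheaves_iff D_KK maxdet_of_dense_two[OF dn] by simp
  next
    fix x assume "x \<in> nn_sheaves (KK U)"
    then show "x \<in> D" using nn_sheaves_iff mem_of_maxdet[OF dn nd'] by simp
  qed
qed

end

context small_universe
begin

text \<open>The sheaf represented by the two element chain is not determined by maximal elements:
  the identity of the chain and the constant map 1 agree at its only maximal element.\<close>

lemma nn_sheaves_proper: "nn_sheaves (KK U) \<noteq> Obj (KK U)"
proof
  assume "nn_sheaves (KK U) = Obj (KK U)"
  then have md: "maxdet (Y two)" using nn_sheaves_iff Y_KK[OF fp_two] by blast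
  let ?c = "kar two (\<lambda>_. 1) two"
  have c: "?c \<in> hom Kp two two" by (rule kar_hom[OF fp_two fp_two]) auto
  note i = Ide_Kp_hom[OF fp_two]
  have "en two (Ide Kp two) = en two ?c"
  proof (rule maxdet_eqI[OF md fp_two en_in[OF i] en_in[OF c]])
    fix p assume p: "p \<in> max_elems two"
    note pp = ptm_hom[OF fp_two p]
    have "Cmp Kp (Ide Kp two) (ptm two p) = Cmp Kp ?c (ptm two p)"
    proof (rule hom_Kp_eqI[OF cat_cmp[OF category_Kp pp i] cat_cmp[OF category_Kp pp c]])
      fix q assume q: "q \<in> fst pt"
      then have "pap (ptm two p) q = 1" using p max_elems_two by simp
      then show "pap (Cmp Kp (Ide Kp two) (ptm two p)) q = pap (Cmp Kp ?c (ptm two p)) q"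
        unfolding pap_Cmp[OF pp i q] pap_Cmp[OF pp c q] using pap_Ide[of 1 two] by simp
    qed
    then show "rs (Y two) (ptm two p) (en two (Ide Kp two)) = rs (Y two) (ptm two p) (en two ?c)"
      using rs_Y[OF i pp] rs_Y[OF c pp] by simp
  qed
  then have "Ide Kp two = ?c" using en_eq_iff[OF i c] by simp
  then have "pap (Ide Kp two) 0 = pap ?c 0" by simp
  then show False using pap_Ide[of 0 two] by simp
qed

text \<open>The image under \<nabla> of a two element set has two different endomorphisms, given by
  the constant functions, so it is not terminal.\<close>

lemma nn_sheaves_nondegenerate: "\<not> degenerate (full_sub (KK U) (nn_sheaves (KK U)))"
proof
  assume dg: "degenerate (full_sub (KK U) (nn_sheaves (KK U)))"
  obtain x y where xy: "x \<noteq> y" "{x, y} \<in> U" using U unfolding set_universe_def by blast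
  let ?S = "{x, y}"
  let ?N = "nabla_ob U ?S"
  have N: "?N \<in> nn_sheaves (KK U)"
    using fob_in_ess_image[OF is_functor_nabla, of ?S] xy(2) nn_sheaves_ess_image by simp
  then have "terminal (full_sub (KK U) (nn_sheaves (KK U))) ?N"
    using dg nn_sheaves_Obj unfolding degenerate_def by simp
  then have "\<exists>!f. f \<in> hom (full_sub (KK U) (nn_sheaves (KK U))) ?N ?N" unfolding terminal_def by blast
  then obtain h where h: "\<forall>f. f \<in> hom (full_sub (KK U) (nn_sheaves (KK U))) ?N ?N \<longrightarrow> f = h" by (rule ex1E)
  let ?g = "\<lambda>c. (?S, \<lambda>_\<in>?S. c, ?S)"
  have g: "?g c \<in> hom (Sets U) ?S ?S" if "c \<in> ?S" for c using that xy(2) by (auto simp: hom_Sets)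
  have "far (nabla U) (?g c) = h" if "c \<in> ?S" for c
    by (rule h[rule_format]) (use nabla_hom[OF g[OF that]] N in \<open>simp add: hom_full_sub\<close>)
  then have "far (nabla U) (?g x) = far (nabla U) (?g y)" by simp
  then have "?g x = ?g y"
    using ff_inj[OF fully_faithful_nabla, of ?S ?S "?g x" "?g y"] g xy(2) by simp
  then have "(\<lambda>_\<in>?S. x) = (\<lambda>_\<in>?S. y)" by simp
  from fun_cong[OF this, of x] show False using xy(1) by simp
qed

end

theorem theorem6p5:
  fixes U :: "'u set set"
  assumes "set_universe U"
  shows "{D. subtopos (KK U) D \<and> D \<noteq> Obj (KK U) \<and> \<not> degenerate (full_sub (KK U) D)}
           = {nn_sheaves (KK U)}
       \<and> is_equivalence (Sets U) (full_sub (KK U) (nn_sheaves (KK U))) (nabla U)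
       \<and> geometric_embedding (Sets U) (KK U) (Gamma U) (nabla U)"
proof (intro conjI)
  interpret small_universe U using assms by (rule small_universe.intro)
  show ge: "geometric_embedding (Sets U) (KK U) (Gamma U) (nabla U)" by (rule geometric_embedding_nabla)
  show "is_equivalence (Sets U) (full_sub (KK U) (nn_sheaves (KK U))) (nabla U)"
    unfolding nn_sheaves_ess_image
    by (rule ff_equivalence_ess_image[OF fully_faithful_nabla is_functor_nabla])
  have "D = nn_sheaves (KK U)"
    if st: "subtopos (KK U) D" and nt: "D \<noteq> Obj (KK U)" "\<not> degenerate (full_sub (KK U) D)" for D
  proof -
    obtain L \<eta> where "lex_reflection (KK U) D L \<eta>" using subtopos_lex_reflection[OF st] .
    then interpret lex_reflection "KK U" D L \<eta> .
    interpret KK_reflection U D L \<eta> ..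
    show ?thesis using classification[OF nt] .
  qed
  moreover have "subtopos (KK U) (nn_sheaves (KK U))"
    unfolding nn_sheaves_ess_image using subtopos_ess_image[OF ge] .
  ultimately show "{D. subtopos (KK U) D \<and> D \<noteq> Obj (KK U) \<and> \<not> degenerate (full_sub (KK U) D)} = {nn_sheaves (KK U)}"
    using nn_sheaves_proper nn_sheaves_nondegenerate by blast
qed

end
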